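(* Let $f:\mathbb{R}^{m\times n}\to\mathbb{R}$ be differentiable with $f^*:=\inf_{\mathbf{X}} f(\mathbf{X})>-\infty$, let $K\ge 1$ be an integer, and let $(\mathbf{X}_k,\mathbf{G}_k,\mathbf{M}_k,\mathbf{V}_k,\mathbf{P}_{k},\mathbf{Q}_{k})$ be generated by the Generalized SOAP algorithm (defined in the context) with hyperparameters $\eta,\theta,\beta,\varepsilon$. Suppose that, for constants $L>0$, $\sigma_F\ge 0$, $\sigma_{op}>0$: 1. (Smoothness) $\|\nabla f(\mathbf{Y})-\nabla f(\mathbf{X})\|_F\le L\|\mathbf{Y}-\mathbf{X}\|_F$ for all $\mathbf{X},\mathbf{Y}\in\mathbb{R}^{m\times n}$; 2. (Unbiasedness) $\mathbb{E}[\mathbf{G}_k\mid\mathcal{F}_{k-1}]=\nabla f(\mathbf{X}_k)$ for all $k=1,\dots,K$; 3. (Bounded noise variance) $\mathbb{E}[\|\mathbf{G}_k-\nabla f(\mathbf{X}_k)\|_F^2\mid\mathcal{F}_{k-1}]\le\sigma_F^2$ and $\mathbb{E}[\|\mathbf{G}_k-\nabla f(\mathbf{X}_k)\|_{op}^2\mid\mathcal{F}_{k-1}]\le\sigma_{op}^2$ for all $k=1,\dots,K$. Let $\gamma\in(0,1]$ be arbitrary and let $$\hat\sigma_F^2=\max\left\{\sigma_F^2,\frac{L(f(\mathbf{X}_1)-f^* )}{K\gamma^2}\right\},$$ assumed positive. Let $$1-\theta=\sqrt{\frac{L(f(\mathbf{X}_1)-f^* )}{K\hat\sigma_F^2}},\qquad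 0\le\beta<1,\qquad \varepsilon=\sigma_{op}^2,\qquad \eta=\sqrt{\frac{\varepsilon(f(\mathbf{X}_1)-f^* )}{4LK\hat\sigma_F^2}}.$$ Then $$\frac1K\sum_{k=1}^K\mathbb{E}\left[\left\|\mathbf{P}_{k-1}^T\nabla f(\mathbf{X}_k)\mathbf{Q}_{k-1}\right\|_1\right]\le 10\sqrt{\frac{\hat\sigma_F^2L(f(\mathbf{X}_1)-f^* )}{K\sigma_{op}^2}}+4\sqrt{mn}\,\sqrt[4]{\frac{\hat\sigma_F^2L(f(\mathbf{X}_1)-f^* )}{K}},$$ and $$\frac1K\sum_{k=1}^K\mathbb{E}\left[\left\|\nabla f(\mathbf{X}_k)\right\|_*\right]\le 10\sqrt{\frac{\hat\sigma_F^2L(f(\mathbf{X}_1)-f^* )}{K\sigma_{op}^2}}+4\sqrt{mn}\,\sqrt[4]{\frac{\hat\sigma_F^2L(f(\mathbf{X}_1)-f^* )}{K}}.$$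
   Context: Norms on $\mathbb{R}^{m\times n}$: $\|\cdot\|_F$ is the Frobenius norm, $\|\cdot\|_{op}$ the spectral norm (largest singular value), $\|\cdot\|_*$ the nuclear norm (sum of singular values), $\|\cdot\|_1$ the entrywise $\ell_1$ norm (sum of absolute values of entries). Entrywise conventions: for matrices $\mathbf{A},\mathbf{B}$ of the same size, $\frac{\mathbf{A}}{\mathbf{B}}$, $\mathbf{A}^2$, $\sqrt{\mathbf{A}}$ denote entrywise division, square and square root, and $\mathbf{A}+\varepsilon$ adds the scalar $\varepsilon$ to every entry. Randomness: $\zeta_1,\zeta_2,\dots$ are the random samples used by the stochastic gradient oracle; $\mathcal{F}_k=\sigma(\zeta_1,\dots,\zeta_k)$, with $\mathcal{F}_0$ trivial. $\mathbb{E}$ is total expectation. Generalized SOAP algorithm: given hyperparameters $\eta,\theta,\beta,\varepsilon$, a deterministic $\mathbf{X}_1\in\mathbb{R}^{m\times n}$, $\mathbf{M}_0=\mathbf{0}$, $\mathbf{V}_0=\mathbf{0}$ (in $\mathbb{R}^{m\times n}$), and deterministic orthogonal matrices $\mathbf{P}_0\in\mathbb{R}^{m\times m}$, $\mathbf{Q}_0\in\mathbb{R}^{n\times n}$, for $k=1,2,\dots,K$: - obtain the stochastic gradient $\mathbf{G}_k\in\mathbb{R}^{m\times n}$ at $\mathbf{X}_k$ (a function of $\mathbf{X}_k$ and $\zeta_k$, hence $\mathcal{F}_k$-measurable); - $\mathbf{M}_k=\theta\mathbf{M}_{k-1}+(1-\theta)\mathbf{G}_k$; - $\mathbf{G}_k'=\mathbf{P}_{k-1}^T\mathbf{G}_k\mathbf{Q}_{k-1}$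 and $\mathbf{M}_k'=\mathbf{P}_{k-1}^T\mathbf{M}_k\mathbf{Q}_{k-1}$; - $\mathbf{V}_k=\beta\mathbf{V}_{k-1}+(1-\beta)(\mathbf{G}_k')^2$; - $\mathbf{X}_{k+1}=\mathbf{X}_k-\eta\,\mathbf{P}_{k-1}\frac{\mathbf{M}_k'}{\sqrt{\mathbf{V}_k+\varepsilon}}\mathbf{Q}_{k-1}^T$; - generate, by any procedure, orthogonal matrices $\mathbf{P}_k\in\mathbb{R}^{m\times m}$ and $\mathbf{Q}_k\in\mathbb{R}^{n\times n}$ that are $\mathcal{F}_k$-measurable (so that $\mathbf{P}_{k-1},\mathbf{Q}_{k-1}$ are non-random given $\mathcal{F}_{k-1}$). *)

theory Defs
  imports "HOL-Probability.Probability"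
begin

text \<open>
  An \<open>m \<times> n\<close> matrix has type \<^typ>\<open>real^'n^'m\<close>.
  The library norm and inner product of this type are the Frobenius ones.
\<close>

lemma norm_eq_frobenius:
  "norm (A :: real^'n^'m) = sqrt (\<Sum>i\<in>UNIV. \<Sum>j\<in>UNIV. (A $ i $ j)\<^sup>2)"
  by (simp add: norm_vec_def L2_set_def sum_nonneg)

definition entry_l1_norm :: "real^'n^'m \<Rightarrow> real" where
  "entry_l1_norm A = (\<Sum>i\<in>UNIV. \<Sum>j\<in>UNIV. \<bar>A $ i $ j\<bar>)"

text \<open>
  The singular values of \<open>A\<close> are the square roots of the eigenvalues of the symmetric matrix
  \<open>A\<^sup>T A\<close>. Multiplicities are dimensions of eigenspaces, which for a symmetric matrix agree with
  the algebraic multiplicities. If \<open>m < n\<close>, then \<open>A\<^sup>T A\<close> has additional zero eigenvalues;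
  they affect neither the largest singular value nor the sum.
\<close>

definition singular_space :: "real^'n^'m \<Rightarrow> real \<Rightarrow> (real^'n) set" where
  "singular_space A s = {x. (transpose A ** A) *v x = s\<^sup>2 *\<^sub>R x}"

definition singular_values :: "real^'n^'m \<Rightarrow> real set" where
  "singular_values A = {s. 0 \<le> s \<and> (\<exists>x\<in>singular_space A s. x \<noteq> 0)}"

definition spectral_norm :: "real^'n^'m \<Rightarrow> real" where
  "spectral_norm A = Max (singular_values A)"

definition nuclear_norm :: "real^'n^'m \<Rightarrow> real" where
  "nuclear_norm A = (\<Sum>s\<in>singular_values A. real (dim (singular_space A s)) * s)"

lemma gram_inner:
  fixes A :: "real^'n^'m"
  shows "((transpose A ** A) *v x) \<bullet> y = (A *v x) \<bullet> (A *v y)"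
proof -
  have "((transpose A ** A) *v x) \<bullet> y = (transpose A *v (A *v x)) \<bullet> y"
    by (simp add: matrix_vector_mul_assoc)
  also have "\<dots> = ((A *v x) v* A) \<bullet> y"
    by simp
  also have "\<dots> = (A *v x) \<bullet> (A *v y)"
    by (rule dot_lmul_matrix)
  finally show ?thesis .
qed

lemma singular_spaces_orthogonal:
  fixes A :: "real^'n^'m"
  assumes "x \<in> singular_space A s" "y \<in> singular_space A t" "0 \<le> s" "0 \<le> t" "s \<noteq> t"
  shows "x \<bullet> y = 0"
proof -
  have "s\<^sup>2 * (x \<bullet> y) = (A *v x) \<bullet> (A *v y)"
    using assms(1) gram_inner[of A x y] by (simp add: singular_space_def)
  moreover have "t\<^sup>2 * (x \<bullet> y) = (A *v x) \<bullet> (A *v y)"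
    using assms(2) gram_inner[of A y x] by (simp add: singular_space_def inner_commute)
  ultimately have "s\<^sup>2 * (x \<bullet> y) = t\<^sup>2 * (x \<bullet> y)" by simp
  moreover have "s\<^sup>2 \<noteq> t\<^sup>2" using assms by (simp add: power2_eq_iff)
  ultimately show ?thesis by simp
qed

lemma finite_singular_values: "finite (singular_values (A :: real^'n^'m))"
proof -
  have "\<forall>s\<in>singular_values A. \<exists>x. x \<in> singular_space A s \<and> x \<noteq> 0"
    by (auto simp: singular_values_def)
  then obtain v where v: "\<And>s. s \<in> singular_values A \<Longrightarrow> v s \<in> singular_space A s \<and> v s \<noteq> 0"
    by metis
  have orth: "v s \<bullet> v t = 0" if "s \<in> singular_values A" "t \<in> singular_values A" "s \<noteq> t" for s t
    using singular_spaces_orthogonal[of "v s" A s "v t" t] v that by (auto simp: singular_values_def)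
  have inj: "inj_on v (singular_values A)"
    by (intro inj_onI) (metis orth v inner_eq_zero_iff)
  have "independent (v ` singular_values A)"
    by (rule pairwise_orthogonal_independent)
      (use orth v in \<open>auto simp: pairwise_def orthogonal_def\<close>)
  then have "finite (v ` singular_values A)"
    by (rule independent_imp_finite)
  then show ?thesis using inj by (rule finite_imageD)
qed

lemma onorm_in_singular_values:
  fixes A :: "real^'n^'m"
  shows "onorm ((*v) A) \<in> singular_values A"
proof -
  have "\<exists>x\<in>sphere (0::real^'n) 1. \<forall>y\<in>sphere 0 1. norm (A *v y) \<le> norm (A *v x)"
    by (rule continuous_attains_sup)
      (simp_all add: continuous_on_norm linear_continuous_on)
  then obtain x where x: "norm x = 1"
    and max: "\<And>y. norm y = 1 \<Longrightarrow> norm (A *v y) \<le> norm (A *v x)"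
    by auto
  define s where "s = norm (A *v x)"
  have bound: "norm (A *v y) \<le> s * norm y" for y
  proof (cases "y = 0")
    case False
    have "norm (A *v (y /\<^sub>R norm y)) \<le> s"
      unfolding s_def by (rule max) (use False in simp)
    then have "norm (A *v y) / norm y \<le> s"
      by (simp add: matrix_vector_mult_scaleR divide_inverse mult.commute)
    then show ?thesis using False by (simp add: pos_divide_le_eq)
  qed simp
  have on: "onorm ((*v) A) = s"
  proof (rule antisym)
    show "onorm ((*v) A) \<le> s" by (rule onorm_le) (rule bound)
    show "s \<le> onorm ((*v) A)"
      using onorm[of "(*v) A" x] x by (simp add: s_def)
  qed
  define y where "y = s\<^sup>2 *\<^sub>R x - (transpose A ** A) *v x"
  define a where "a = s\<^sup>2 * (y \<bullet> y) - (A *v y) \<bullet> (A *v y)"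
  have yy: "y \<bullet> y = s\<^sup>2 * (x \<bullet> y) - (A *v x) \<bullet> (A *v y)"
    using gram_inner[of A x y] by (subst (1) y_def) (simp add: inner_diff_left)
  have xs: "(A *v x) \<bullet> (A *v x) = s\<^sup>2 * (x \<bullet> x)"
    using x by (simp add: s_def power2_norm_eq_inner[symmetric])
  have quad: "0 \<le> t\<^sup>2 * a + 2 * t * (y \<bullet> y)" for t
  proof -
    have "(norm (A *v (x + t *\<^sub>R y)))\<^sup>2 \<le> (s * norm (x + t *\<^sub>R y))\<^sup>2"
      by (rule power_mono[OF bound]) simp
    then have "(A *v x + t *\<^sub>R (A *v y)) \<bullet> (A *v x + t *\<^sub>R (A *v y))
        \<le> s\<^sup>2 * ((x + t *\<^sub>R y) \<bullet> (x + t *\<^sub>R y))"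
      by (simp add: power2_norm_eq_inner power_mult_distrib matrix_vector_right_distrib
          matrix_vector_mult_scaleR)
    then have "0 \<le> t\<^sup>2 * a + 2 * t * (s\<^sup>2 * (x \<bullet> y) - (A *v x) \<bullet> (A *v y))"
      unfolding a_def using xs
      by (simp add: inner_add_left inner_add_right inner_commute power2_eq_square algebra_simps)
    then show ?thesis by (simp only: yy)
  qed
  have "y \<bullet> y = 0"
  proof (cases "a = 0")
    case True
    then show ?thesis using quad[of "-1"] inner_ge_zero[of y] by simp
  next
    case False
    have "0 \<le> a"
      using quad[of 1] quad[of "-1"] by simp
    then have "0 < a" using False by simp
    have "(- (y \<bullet> y) / a)\<^sup>2 * a + 2 * (- (y \<bullet> y) / a) * (y \<bullet> y) = - ((y \<bullet> y)\<^sup>2 / a)"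
      using \<open>0 < a\<close> by (simp add: field_simps power2_eq_square)
    then have "(y \<bullet> y)\<^sup>2 / a \<le> 0"
      using quad[of "- (y \<bullet> y) / a"] by simp
    then show ?thesis using \<open>0 < a\<close> by (simp add: divide_le_0_iff)
  qed
  then have "x \<in> singular_space A s" by (simp add: y_def singular_space_def)
  moreover have "x \<noteq> 0" using x by auto
  moreover have "0 \<le> s" by (simp add: s_def)
  ultimately show ?thesis unfolding on singular_values_def by blast
qed

lemma spectral_norm_eq_onorm: "spectral_norm (A :: real^'n^'m) = onorm ((*v) A)"
  unfolding spectral_norm_def
proof (rule Max_eqI[OF finite_singular_values _ onorm_in_singular_values])
  fix s assume "s \<in> singular_values A"
  then obtain x where s: "0 \<le> s" and x: "x \<noteq> 0" "(transpose A ** A) *v x = s\<^sup>2 *\<^sub>R x"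
    by (auto simp: singular_values_def singular_space_def)
  have "(norm (A *v x))\<^sup>2 = (s * norm x)\<^sup>2"
    using gram_inner[of A x x] x(2) by (simp add: power2_norm_eq_inner power_mult_distrib)
  then have "norm (A *v x) = s * norm x"
    using s by (simp add: power2_eq_iff_nonneg)
  then have "s * norm x \<le> onorm ((*v) A) * norm x"
    using onorm[of "(*v) A" x] by simp
  then show "s \<le> onorm ((*v) A)" using x(1) by simp
qed

definition entry_divide :: "real^'n^'m \<Rightarrow> real^'n^'m \<Rightarrow> real^'n^'m" where
  "entry_divide A B = (\<chi> i j. A $ i $ j / B $ i $ j)"

definition entry_square :: "real^'n^'m \<Rightarrow> real^'n^'m" where
  "entry_square A = (\<chi> i j. (A $ i $ j)\<^sup>2)"

definition entry_sqrt :: "real^'n^'m \<Rightarrow> real^'n^'m" where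
  "entry_sqrt A = (\<chi> i j. sqrt (A $ i $ j))"

definition entry_add :: "real^'n^'m \<Rightarrow> real \<Rightarrow> real^'n^'m" where
  "entry_add A c = (\<chi> i j. A $ i $ j + c)"

definition gradient :: "('a::euclidean_space \<Rightarrow> real) \<Rightarrow> 'a \<Rightarrow> 'a" where
  "gradient f x = (THE D. GDERIV f x :> D)"

lemma GDERIV_gradient:
  fixes f :: "'a::euclidean_space \<Rightarrow> real"
  assumes "f differentiable (at x)"
  shows "GDERIV f x :> gradient f x"
proof -
  obtain f' where f': "(f has_derivative f') (at x)"
    using assms by (auto simp: differentiable_def)
  then interpret bounded_linear f' by (rule has_derivative_bounded_linear)
  define D where "D = (\<Sum>b\<in>Basis. f' b *\<^sub>R b)"
  have "f' = (\<lambda>h. h \<bullet> D)"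
  proof
    fix h
    have "f' h = f' (\<Sum>b\<in>Basis. (h \<bullet> b) *\<^sub>R b)" by (simp add: euclidean_representation)
    also have "\<dots> = h \<bullet> D"
      by (simp add: sum scaleR D_def inner_sum_right mult.commute)
    finally show "f' h = h \<bullet> D" .
  qed
  then have D: "GDERIV f x :> D"
    using f' by (simp add: gderiv_def)
  have "D' = D" if "GDERIV f x :> D'" for D'
  proof -
    have "(\<lambda>h. h \<bullet> D') = (\<lambda>h. h \<bullet> D)"
      using that D unfolding gderiv_def by (rule has_derivative_unique)
    then have "(D' - D) \<bullet> D' = (D' - D) \<bullet> D" by (rule fun_cong)
    then have "(D' - D) \<bullet> (D' - D) = 0" by (simp add: inner_diff_right)
    then show ?thesis by simp
  qed
  with D show ?thesis unfolding gradient_def by (rule theI)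
qed

text \<open>
  \<open>sample_filtration \<Omega> S \<zeta> k\<close> is the \<open>\<sigma>\<close>-algebra on \<^term>\<open>space \<Omega>\<close> generated by
  \<open>\<zeta> 1, \<dots>, \<zeta> k\<close>; for \<open>k = 0\<close> it is trivial. Only its space and its measurable sets matter.
\<close>

definition sample_filtration ::
    "'w measure \<Rightarrow> 'z measure \<Rightarrow> (nat \<Rightarrow> 'w \<Rightarrow> 'z) \<Rightarrow> nat \<Rightarrow> 'w measure" where
  "sample_filtration \<Omega> S \<zeta> k =
     sigma (space \<Omega>) {\<zeta> i -` B \<inter> space \<Omega> | i B. i \<in> {1..k} \<and> B \<in> sets S}"

definition matrix_cond_exp ::
    "'w measure \<Rightarrow> 'w measure \<Rightarrow> ('w \<Rightarrow> real^'n^'m) \<Rightarrow> 'w \<Rightarrow> real^'n^'m" where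
  "matrix_cond_exp \<Omega> F G \<omega> = (\<chi> i j. real_cond_exp \<Omega> F (\<lambda>\<omega>'. G \<omega>' $ i $ j) \<omega>)"

text \<open>
  The random matrices \<open>X\<close>, \<open>G\<close>, \<open>Mo\<close> (momentum), \<open>V\<close>, \<open>P\<close>, \<open>Q\<close> form a run of \<open>K\<close> iterations.
  \<open>g x z\<close> is the stochastic gradient at \<open>x\<close> computed from the sample \<open>z\<close>. The matrices \<open>P k\<close> and
  \<open>Q k\<close> are arbitrary orthogonal matrices that depend measurably on the first \<open>k\<close> samples.
\<close>

definition generalized_soap ::
    "'w measure \<Rightarrow> 'z measure \<Rightarrow> (nat \<Rightarrow> 'w \<Rightarrow> 'z) \<Rightarrow> (real^'n^'m \<Rightarrow> 'z \<Rightarrow> real^'n^'m) \<Rightarrow>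
     nat \<Rightarrow> real \<Rightarrow> real \<Rightarrow> real \<Rightarrow> real \<Rightarrow> real^'n^'m \<Rightarrow> real^'m^'m \<Rightarrow> real^'n^'n \<Rightarrow>
     (nat \<Rightarrow> 'w \<Rightarrow> real^'n^'m) \<Rightarrow> (nat \<Rightarrow> 'w \<Rightarrow> real^'n^'m) \<Rightarrow>
     (nat \<Rightarrow> 'w \<Rightarrow> real^'n^'m) \<Rightarrow> (nat \<Rightarrow> 'w \<Rightarrow> real^'n^'m) \<Rightarrow>
     (nat \<Rightarrow> 'w \<Rightarrow> real^'m^'m) \<Rightarrow> (nat \<Rightarrow> 'w \<Rightarrow> real^'n^'n) \<Rightarrow> bool" where
  "generalized_soap \<Omega> S \<zeta> g K \<eta> \<theta> \<beta> \<epsilon> X1 P0 Q0 X G Mo V P Q \<longleftrightarrow>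
     (\<forall>k\<in>{1..K}. \<zeta> k \<in> \<Omega> \<rightarrow>\<^sub>M S) \<and>
     (\<lambda>(x, z). g x z) \<in> borel \<Otimes>\<^sub>M S \<rightarrow>\<^sub>M borel \<and>
     orthogonal_matrix P0 \<and> orthogonal_matrix Q0 \<and>
     (\<forall>\<omega>\<in>space \<Omega>. X 1 \<omega> = X1 \<and> Mo 0 \<omega> = 0 \<and> V 0 \<omega> = 0 \<and> P 0 \<omega> = P0 \<and> Q 0 \<omega> = Q0) \<and>
     (\<forall>k\<in>{1..K}. \<forall>\<omega>\<in>space \<Omega>.
        G k \<omega> = g (X k \<omega>) (\<zeta> k \<omega>) \<and>
        Mo k \<omega> = \<theta> *\<^sub>R Mo (k - 1) \<omega> + (1 - \<theta>) *\<^sub>R G k \<omega> \<and>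
        (let G' = transpose (P (k - 1) \<omega>) ** G k \<omega> ** Q (k - 1) \<omega>;
             M' = transpose (P (k - 1) \<omega>) ** Mo k \<omega> ** Q (k - 1) \<omega>
         in V k \<omega> = \<beta> *\<^sub>R V (k - 1) \<omega> + (1 - \<beta>) *\<^sub>R entry_square G' \<and>
            X (k + 1) \<omega> = X k \<omega> - \<eta> *\<^sub>R
              (P (k - 1) \<omega> ** entry_divide M' (entry_sqrt (entry_add (V k \<omega>) \<epsilon>))
                 ** transpose (Q (k - 1) \<omega>)))) \<and>
     (\<forall>k\<in>{1..K}.
        P k \<in> sample_filtration \<Omega> S \<zeta> k \<rightarrow>\<^sub>M borel \<and>
        Q k \<in> sample_filtration \<Omega> S \<zeta> k \<rightarrow>\<^sub>M borel \<and>
        (\<forall>\<omega>\<in>space \<Omega>. orthogonal_matrix (P k \<omega>) \<and> orthogonal_matrix (Q k \<omega>)))"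

end

theory Submission
  imports Defs
begin

text \<open>
  Write \<open>g'\<close> and \<open>m'\<close> for the rotated gradient and momentum and \<open>s\<close> for the entrywise scale
  \<open>sqrt (V + \<epsilon>)\<close>. The descent lemma in rotated coordinates, together with
  \<open>-2 g' m' = (g' - m')\<^sup>2 - g'\<^sup>2 - m'\<^sup>2\<close>, makes \<open>f\<close> decrease by a multiple of
  \<open>\<Sum> g'\<^sup>2 / s + \<Sum> m'\<^sup>2 / s\<close> up to the momentum error; the latter contracts by the factor \<open>\<theta>\<close>, and its
  drift is absorbed by the term in \<open>m'\<close>. This bounds the sum of the expectations of \<open>\<Sum> g'\<^sup>2 / s\<close>.

  The scale depends on the current sample, so it is compared with the predictable proxy
  \<open>t\<^sup>2 = \<beta> V + (1 - \<beta>) (g'\<^sup>2 + \<sigma>op\<^sup>2) + \<epsilon>\<close>, where \<open>V\<close> is the previous second moment: every entry of the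
  rotated noise is at most its spectral norm, hence \<open>t\<^sup>2\<close> dominates the conditional expectation of
  \<open>s\<^sup>2\<close>, and Jensen's inequality gives \<open>E (g'\<^sup>2 / t) \<le> E (g'\<^sup>2 / s)\<close>. Unrolling the recursion of \<open>V\<close>
  under the square root, again with Jensen, bounds the sum of \<open>E t\<close> by
  \<open>K sqrt 2 \<sigma>op\<close> plus twice the sum of \<open>E (g'\<^sup>2 / t)\<close>, uniformly in \<open>\<beta>\<close>. The weighted inequality
  \<open>2 \<bar>g'\<bar> \<le> c g'\<^sup>2 / t + t / c\<close> then bounds the entrywise norm, which by duality dominates the
  nuclear norm in any pair of orthonormal bases.
\<close>

section \<open>The nuclear norm as a dual norm\<close>

text \<open>The descent part rests on one relation,
  \<open>\<eta> = (1 - \<theta>) * \<sigma>op / (2 * L)\<close>. As the scale is at least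
  \<open>\<sigma>op\<close>, the quadratic term of a step costs at most half of the negative
  momentum term, and the gradient drift caused by the step costs half of the rest. What survives is
  the initial gap, the initial gradient and the noise; the choice of \<open>\<theta>\<close> gives
  these three the same order.

  The obstacle is the size of the scale. It accumulates squared gradients of the whole past, on
  which no bound is assumed, so its expectation is not bounded by a constant but by the very ratios
  that descent controls. With \<open>W\<close> bounding their sum over entries and steps, the
  estimate becomes the root of \<open>W\<close> times a noise part plus \<open>2 * W\<close>: the
  second summand yields the first term of the rate, the noise part the fourth root.

  No moment of the gradients is assumed either, so square integrability is derived along the run. If
  \<open>f X1\<close> is already minimal, then \<open>\<theta> = 1\<close> and
  \<open>\<eta> = 0\<close>; this case is settled separately.\<close>

lemma orthonormal_Parseval:
  fixes U :: "'a::euclidean_space set"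
  assumes "pairwise orthogonal U" "\<And>b. b \<in> U \<Longrightarrow> norm b = 1" "span U = UNIV" "finite U"
  shows "x \<bullet> y = (\<Sum>b\<in>U. (x \<bullet> b) * (y \<bullet> b))"
proof -
  have "x \<bullet> y = (\<Sum>b\<in>U. (x \<bullet> b) *\<^sub>R b) \<bullet> y"
    using orthonormal_basis_expand[of U x] assms by simp
  also have "\<dots> = (\<Sum>b\<in>U. (x \<bullet> b) * (y \<bullet> b))"
    by (simp add: inner_sum_left inner_commute[of y])
  finally show ?thesis .
qed

text \<open>The Frobenius inner product is the trace of \<open>transpose A ** B\<close>, hence
  independent of the orthonormal basis; Parseval is applied to each row. It is used both for the
  standard basis and for a basis of singular vectors.\<close>

lemma frobenius_inner_basis:
  fixes A B :: "real^'n^'m"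
  assumes "pairwise orthogonal U" "\<And>b. b \<in> U \<Longrightarrow> norm b = 1" "span U = UNIV" "finite U"
  shows "A \<bullet> B = (\<Sum>b\<in>U. (A *v b) \<bullet> (B *v b))"
proof -
  have "A \<bullet> B = (\<Sum>i\<in>UNIV. A $ i \<bullet> B $ i)"
    by (simp add: inner_vec_def)
  also have "\<dots> = (\<Sum>i\<in>UNIV. \<Sum>b\<in>U. (A $ i \<bullet> b) * (B $ i \<bullet> b))"
    by (intro sum.cong refl orthonormal_Parseval assms)
  also have "\<dots> = (\<Sum>b\<in>U. \<Sum>i\<in>UNIV. (A $ i \<bullet> b) * (B $ i \<bullet> b))"
    by (rule sum.swap)
  also have "\<dots> = (\<Sum>b\<in>U. (A *v b) \<bullet> (B *v b))"
    by (simp add: inner_vec_def matrix_vector_mult_def mult.commute)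
  finally show ?thesis .
qed

lemma quadratic_nonneg_imp_linear_coeff_0:
  fixes a c :: real
  assumes "\<And>t. 0 \<le> t\<^sup>2 * a + 2 * t * c"
  shows "c = 0"
proof (rule ccontr)
  assume c: "c \<noteq> 0"
  \<comment> \<open>Any positive upper bound of \<open>a\<close> serves, so the sign of
    \<open>a\<close> is irrelevant. The point \<open>- c / d\<close> minimises
    \<open>t\<^sup>2 * d + 2 * t * c\<close>.\<close>
  define d where "d = \<bar>a\<bar> + 1"
  have d: "0 < d" "a \<le> d" by (auto simp: d_def)
  have "(- c / d)\<^sup>2 * a \<le> (- c / d)\<^sup>2 * d"
    using d by (intro mult_left_mono) auto
  also have "\<dots> = c\<^sup>2 / d"
    using d by (simp add: power2_eq_square)
  finally have "0 \<le> c\<^sup>2 / d + 2 * (- c / d) * c"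
    using assms[of "- c / d"] by linarith
  also have "\<dots> = - (c\<^sup>2 / d)"
    by (simp add: power2_eq_square)
  finally show False
    using c d by (simp add: divide_le_0_iff)
qed

text \<open>
  Maximising \<open>norm (A *v x)\<close> over the unit sphere of an invariant subspace yields a singular vector.
\<close>

lemma singular_vector_in_invariant_subspace:
  fixes A :: "real^'n^'m"
  assumes W: "subspace W" and inv: "\<And>x. x \<in> W \<Longrightarrow> (transpose A ** A) *v x \<in> W"
    and w: "w \<in> W" "w \<noteq> 0"
  shows "\<exists>s\<in>singular_values A. \<exists>x\<in>singular_space A s. x \<in> W \<and> x \<noteq> 0"
proof -
  have "\<exists>x\<in>sphere 0 1 \<inter> W. \<forall>y\<in>sphere 0 1 \<inter> W. norm (A *v y) \<le> norm (A *v x)"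
  proof (rule continuous_attains_sup)
    show "compact (sphere 0 1 \<inter> W)"
      by (intro compact_Int_closed closed_subspace W compact_sphere)
    have "w /\<^sub>R norm w \<in> sphere 0 1 \<inter> W"
      using w W by (auto intro: subspace_mul)
    then show "sphere 0 1 \<inter> W \<noteq> {}" by blast
  qed (simp add: continuous_on_norm linear_continuous_on)
  then obtain x where x: "norm x = 1" "x \<in> W"
    and max: "\<And>y. norm y = 1 \<Longrightarrow> y \<in> W \<Longrightarrow> norm (A *v y) \<le> norm (A *v x)"
    by auto
  define s where "s = norm (A *v x)"
  have bound: "norm (A *v y) \<le> s * norm y" if "y \<in> W" for y
  proof (cases "y = 0")
    case False
    have "norm (A *v (y /\<^sub>R norm y)) \<le> s"
      unfolding s_def by (rule max) (use False that W in \<open>auto intro: subspace_mul\<close>)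
    then show ?thesis
      using False by (simp add: matrix_vector_mult_scaleR field_simps)
  qed simp
  \<comment> \<open>The form
    \<open>s\<^sup>2 * (v \<bullet> v) - (A *v v) \<bullet> (A *v v)\<close> is nonnegative on
    \<open>W\<close> and vanishes at \<open>x\<close>; \<open>y\<close> is half its gradient there.
    By invariance \<open>y\<close> lies in \<open>W\<close>, so the minimality of \<open>x\<close>
    can be tested along \<open>y\<close> itself, where the linear coefficient is
    \<open>y \<bullet> y\<close>.\<close>
  define y where "y = s\<^sup>2 *\<^sub>R x - (transpose A ** A) *v x"
  have yW: "y \<in> W"
    unfolding y_def using W x inv by (intro subspace_diff subspace_mul)
  have yy: "y \<bullet> y = s\<^sup>2 * (x \<bullet> y) - (A *v x) \<bullet> (A *v y)"
    using gram_inner[of A x y] by (subst (1) y_def) (simp add: inner_diff_left)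
  have xs: "(A *v x) \<bullet> (A *v x) = s\<^sup>2 * (x \<bullet> x)"
    using x by (simp add: s_def power2_norm_eq_inner[symmetric])
  define a where "a = s\<^sup>2 * (y \<bullet> y) - (A *v y) \<bullet> (A *v y)"
  have "y \<bullet> y = 0"
  proof (rule quadratic_nonneg_imp_linear_coeff_0)
    fix t :: real
    have "(norm (A *v (x + t *\<^sub>R y)))\<^sup>2 \<le> (s * norm (x + t *\<^sub>R y))\<^sup>2"
      by (intro power_mono bound) (use W x yW in \<open>auto intro!: subspace_add subspace_mul\<close>)
    then have "(A *v x + t *\<^sub>R (A *v y)) \<bullet> (A *v x + t *\<^sub>R (A *v y))
        \<le> s\<^sup>2 * ((x + t *\<^sub>R y) \<bullet> (x + t *\<^sub>R y))"
      by (simp add: power2_norm_eq_inner power_mult_distrib matrix_vector_right_distrib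
          matrix_vector_mult_scaleR)
    then have "0 \<le> t\<^sup>2 * a + 2 * t * (s\<^sup>2 * (x \<bullet> y) - (A *v x) \<bullet> (A *v y))"
      unfolding a_def using xs
      by (simp add: inner_add_left inner_add_right inner_commute power2_eq_square algebra_simps)
    then show "0 \<le> t\<^sup>2 * a + 2 * t * (y \<bullet> y)"
      by (simp only: yy)
  qed
  then have "x \<in> singular_space A s"
    by (simp add: y_def singular_space_def)
  moreover have "x \<noteq> 0" "0 \<le> s" using x by (auto simp: s_def)
  ultimately show ?thesis using x unfolding singular_values_def by blast
qed

lemma subspace_singular_space: "subspace (singular_space A s)"
  unfolding subspace_def singular_space_def
  by (auto simp: matrix_vector_right_distrib matrix_vector_mult_scaleR scaleR_add_right)

text \<open>The spectral theorem for the Gram matrix: by symmetry the orthogonal complement of all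
  singular spaces is invariant, so if it were nonzero it would contain a singular vector, which
  would be orthogonal to itself.\<close>

lemma span_singular_spaces:
  fixes A :: "real^'n^'m"
  shows "span (\<Union>s\<in>singular_values A. singular_space A s) = UNIV" (is "span ?S = UNIV")
proof (rule ccontr)
  assume "span ?S \<noteq> UNIV"
  then have "span ?S \<subset> span UNIV" by auto
  then obtain w where w: "w \<noteq> 0" "\<And>y. y \<in> span ?S \<Longrightarrow> orthogonal w y"
    using orthogonal_to_subspace_exists_gen by metis
  define W where "W = {x. \<forall>y\<in>?S. orthogonal x y}"
  have "subspace W"
    unfolding W_def subspace_def by (auto simp: orthogonal_def inner_add_left)
  moreover have "(transpose A ** A) *v x \<in> W" if "x \<in> W" for x
  proof -
    have "((transpose A ** A) *v x) \<bullet> y = 0" if "s \<in> singular_values A" "y \<in> singular_space A s" for y s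
    proof -
      have "((transpose A ** A) *v x) \<bullet> y = ((transpose A ** A) *v y) \<bullet> x"
        using gram_inner[of A x y] gram_inner[of A y x] by (simp add: inner_commute)
      also have "\<dots> = s\<^sup>2 * (x \<bullet> y)"
        using that by (simp add: singular_space_def inner_commute)
      also have "x \<bullet> y = 0"
        using \<open>x \<in> W\<close> that by (auto simp: W_def orthogonal_def)
      finally show ?thesis by simp
    qed
    then show ?thesis by (auto simp: W_def orthogonal_def)
  qed
  moreover have "w \<in> W" using w by (auto simp: W_def intro: span_base)
  ultimately obtain s x where "s \<in> singular_values A" "x \<in> singular_space A s" "x \<in> W" "x \<noteq> 0"
    using singular_vector_in_invariant_subspace[of W A w] w by blast
  then have "x \<bullet> x = 0" unfolding W_def orthogonal_def by blast
  then show False using \<open>x \<noteq> 0\<close> by simp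
qed

text \<open>Orthonormal bases of the singular spaces fit together because different spaces are
  orthogonal. The images under \<open>A\<close> are again orthogonal, with the singular values as
  norms, so this is a singular value decomposition with the left singular vectors left implicit. The
  multiplicities in \<open>nuclear_norm\<close> become cardinalities of the bases.\<close>

lemma singular_basis:
  fixes A :: "real^'n^'m"
  obtains U where "finite U" "pairwise orthogonal U" "\<And>b. b \<in> U \<Longrightarrow> norm b = 1" "span U = UNIV"
    "\<And>b c. b \<in> U \<Longrightarrow> c \<in> U \<Longrightarrow> b \<noteq> c \<Longrightarrow> (A *v b) \<bullet> (A *v c) = 0"
    "nuclear_norm A = (\<Sum>b\<in>U. norm (A *v b))"
proof -
  have "\<forall>s. \<exists>B. B \<subseteq> singular_space A s \<and> pairwise orthogonal B \<and> (\<forall>b\<in>B. norm b = 1) \<and>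
      finite B \<and> card B = dim (singular_space A s) \<and> span B = singular_space A s"
    by (metis orthonormal_basis_subspace[OF subspace_singular_space] finiteI_independent)
  then obtain B where B: "\<And>s. B s \<subseteq> singular_space A s" "\<And>s. pairwise orthogonal (B s)"
    "\<And>s b. b \<in> B s \<Longrightarrow> norm b = 1" "\<And>s. finite (B s)"
    "\<And>s. card (B s) = dim (singular_space A s)" "\<And>s. span (B s) = singular_space A s"
    by metis
  define U where "U = (\<Union>s\<in>singular_values A. B s)"
  have orth: "b \<bullet> c = 0" if bc: "b \<in> U" "c \<in> U" "b \<noteq> c" for b c
  proof -
    obtain s t where st: "s \<in> singular_values A" "b \<in> B s" "t \<in> singular_values A" "c \<in> B t"
      using bc(1,2) unfolding U_def by blast
    show ?thesis
    proof (cases "s = t")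
      case True
      then show ?thesis using B(2)[of s] st bc by (auto simp: pairwise_def orthogonal_def)
    next
      case False
      then show ?thesis
        using singular_spaces_orthogonal[of b A s c t] st B(1) by (auto simp: singular_values_def)
    qed
  qed
  have norm_sv: "norm (A *v b) = s" if "s \<in> singular_values A" "b \<in> B s" for s b
  proof -
    have "0 \<le> s" using that by (auto simp: singular_values_def)
    have "(transpose A ** A) *v b = s\<^sup>2 *\<^sub>R b" using B(1) that by (auto simp: singular_space_def)
    then have "(norm (A *v b))\<^sup>2 = s\<^sup>2 * (norm b)\<^sup>2"
      using gram_inner[of A b b] by (simp add: power2_norm_eq_inner)
    then show ?thesis using B(3) that \<open>0 \<le> s\<close> by (auto simp: power2_eq_iff_nonneg)
  qed
  show thesis
  proof
    show "finite U" using finite_singular_values[of A] B(4) by (auto simp: U_def)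
    show "pairwise orthogonal U" using orth by (auto simp: pairwise_def orthogonal_def)
    show "norm b = 1" if "b \<in> U" for b using that B(3) by (auto simp: U_def)
    have "singular_space A s \<subseteq> span U" if "s \<in> singular_values A" for s
      using that span_mono[of "B s" U] B(6)[of s] by (auto simp: U_def)
    then have "span (\<Union>s\<in>singular_values A. singular_space A s) \<subseteq> span U"
      by (intro span_minimal) auto
    then show "span U = UNIV" by (auto simp: span_singular_spaces)
    show "(A *v b) \<bullet> (A *v c) = 0" if bc: "b \<in> U" "c \<in> U" "b \<noteq> c" for b c
    proof -
      obtain s where "b \<in> singular_space A s" using bc(1) B(1) by (auto simp: U_def)
      then show ?thesis
        using orth[OF bc] gram_inner[of A b c] by (simp add: singular_space_def)
    qed
    have "nuclear_norm A = (\<Sum>s\<in>singular_values A. \<Sum>b\<in>B s. norm (A *v b))"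
      unfolding nuclear_norm_def by (intro sum.cong refl) (simp add: norm_sv B(5))
    also have "\<dots> = (\<Sum>b\<in>U. norm (A *v b))"
      unfolding U_def
    proof (rule sum.UNION_disjoint[symmetric])
      \<comment> \<open>A basis vector determines its singular value as the norm of its image, so it
        belongs to only one basis.\<close>
      show "\<forall>s\<in>singular_values A. \<forall>t\<in>singular_values A. s \<noteq> t \<longrightarrow> B s \<inter> B t = {}"
        using norm_sv by blast
    qed (use finite_singular_values B in auto)
    finally show "nuclear_norm A = (\<Sum>b\<in>U. norm (A *v b))" .
  qed
qed

text \<open>The optimal \<open>C\<close> is the partial isometry of the polar decomposition of
  \<open>A\<close>: it sends each right singular vector to the normalised image under
  \<open>A\<close>.\<close>

lemma nuclear_norm_dual:
  fixes A :: "real^'n^'m"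
  obtains C where "onorm ((*v) C) \<le> 1" "nuclear_norm A = A \<bullet> C"
proof -
  obtain U where U: "finite U" "pairwise orthogonal U" "\<And>b. b \<in> U \<Longrightarrow> norm b = 1" "span U = UNIV"
    "\<And>b c. b \<in> U \<Longrightarrow> c \<in> U \<Longrightarrow> b \<noteq> c \<Longrightarrow> (A *v b) \<bullet> (A *v c) = 0"
    "nuclear_norm A = (\<Sum>b\<in>U. norm (A *v b))"
    by (rule singular_basis[of A]) blast
  \<comment> \<open>Division by zero makes \<open>u b\<close> vanish when \<open>A *v b = 0\<close>.
    Hence \<open>C\<close> need not be an isometry, but it never increases the norm.\<close>
  define u where "u b = A *v b /\<^sub>R norm (A *v b)" for b
  define C where "C = matrix (\<lambda>x. \<Sum>b\<in>U. (b \<bullet> x) *\<^sub>R u b)"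
  have "linear (\<lambda>x. \<Sum>b\<in>U. (b \<bullet> x) *\<^sub>R u b)"
    by (intro linear_compose_sum ballI linearI)
      (auto simp: inner_add_right scaleR_add_left)
  then have C: "C *v x = (\<Sum>b\<in>U. (b \<bullet> x) *\<^sub>R u b)" for x
    unfolding C_def by (simp add: matrix_works)
  have uu: "u b \<bullet> u c = (if b = c then if A *v b = 0 then 0 else 1 else 0)" if "b \<in> U" "c \<in> U" for b c
    using U(5)[OF that] by (cases "A *v b = 0") (auto simp: u_def dot_square_norm power2_eq_square field_simps)
  have "norm (C *v x) \<le> 1 * norm x" for x
  proof -
    have "(norm (C *v x))\<^sup>2 = (\<Sum>b\<in>U. \<Sum>c\<in>U. (b \<bullet> x) * (c \<bullet> x) * (u c \<bullet> u b))"
      unfolding C power2_norm_eq_inner by (simp add: inner_sum_left inner_sum_right sum_distrib_left mult_ac)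
    also have "\<dots> \<le> (\<Sum>b\<in>U. (x \<bullet> b) * (x \<bullet> b))"
    proof (rule sum_mono)
      fix b assume b: "b \<in> U"
      have "(\<Sum>c\<in>U. (b \<bullet> x) * (c \<bullet> x) * (u c \<bullet> u b))
          = (\<Sum>c\<in>U. if c = b then (b \<bullet> x) * (b \<bullet> x) * (u b \<bullet> u b) else 0)"
        by (rule sum.cong[OF refl]) (use uu[OF _ b] in force)
      also have "\<dots> \<le> (x \<bullet> b) * (x \<bullet> b)"
        unfolding sum.delta[OF U(1)] uu[OF b b] using b by (simp add: inner_commute[of b x])
      finally show "(\<Sum>c\<in>U. (b \<bullet> x) * (c \<bullet> x) * (u c \<bullet> u b)) \<le> (x \<bullet> b) * (x \<bullet> b)" .
    qed
    also have "\<dots> = (norm x)\<^sup>2"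
      using orthonormal_Parseval[OF U(2,3,4,1), of x x] by (simp add: power2_norm_eq_inner)
    finally show ?thesis using power2_le_imp_le[OF _ norm_ge_zero] by simp
  qed
  then have "onorm ((*v) C) \<le> 1" by (intro onorm_le)
  moreover have "nuclear_norm A = A \<bullet> C"
  proof -
    have "C *v b = u b" if "b \<in> U" for b
    proof -
      have "C *v b = (\<Sum>c\<in>U. if c = b then u b else 0)"
        unfolding C using U(2,3) that
        by (intro sum.cong) (auto simp: pairwise_def orthogonal_def simp flip: power2_norm_eq_inner)
      then show ?thesis using U(1) that by simp
    qed
    then have "A \<bullet> C = (\<Sum>b\<in>U. (A *v b) \<bullet> u b)"
      using frobenius_inner_basis[OF U(2,3,4,1), of A C] by simp
    also have "\<dots> = nuclear_norm A"
      unfolding U(6) by (intro sum.cong refl)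
        (auto simp: u_def dot_square_norm power2_eq_square field_simps)
    finally show ?thesis ..
  qed
  ultimately show thesis by (rule that)
qed

text \<open>Cauchy-Schwarz on each singular vector. With \<open>nuclear_norm_dual\<close> this makes
  the nuclear norm the maximum of \<open>A \<bullet> C\<close> over all contractions
  \<open>C\<close>, from which its subadditivity follows.\<close>

lemma inner_le_nuclear_norm:
  fixes A C :: "real^'n^'m"
  assumes "onorm ((*v) C) \<le> 1"
  shows "A \<bullet> C \<le> nuclear_norm A"
proof -
  obtain U where U: "finite U" "pairwise orthogonal U" "\<And>b. b \<in> U \<Longrightarrow> norm b = 1" "span U = UNIV"
    "nuclear_norm A = (\<Sum>b\<in>U. norm (A *v b))"
    by (rule singular_basis[of A]) blast
  have "(A *v b) \<bullet> (C *v b) \<le> norm (A *v b)" if "b \<in> U" for b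
  proof -
    have "norm (C *v b) \<le> 1"
      using onorm[of "(*v) C" b] U(3)[OF that] assms by simp
    then have "norm (A *v b) * norm (C *v b) \<le> norm (A *v b)"
      by (simp add: mult_left_le)
    then show ?thesis using norm_cauchy_schwarz[of "A *v b" "C *v b"] by linarith
  qed
  then show ?thesis
    unfolding U(5) frobenius_inner_basis[OF U(2,3,4,1), of A C, simplified] by (rule sum_mono)
qed

text \<open>The entries of a contraction lie between -1 and 1, and the entrywise norm is dual to the
  maximum norm.\<close>

lemma inner_le_entry_l1_norm:
  fixes A C :: "real^'n^'m"
  assumes "onorm ((*v) C) \<le> 1"
  shows "A \<bullet> C \<le> entry_l1_norm A"
proof -
  have "A $ i $ j * C $ i $ j \<le> \<bar>A $ i $ j\<bar>" for i j
  proof -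
    have "\<bar>C $ i $ j\<bar> \<le> 1"
      using matrix_component_le_onorm[of C i j] assms by linarith
    then have "\<bar>A $ i $ j * C $ i $ j\<bar> \<le> \<bar>A $ i $ j\<bar>"
      by (simp add: abs_mult mult_left_le)
    then show ?thesis by linarith
  qed
  then show ?thesis
    unfolding entry_l1_norm_def inner_vec_def by (auto intro!: sum_mono)
qed

section \<open>Continuity of the nuclear and spectral norms\<close>

lemma nuclear_norm_diff_le: "nuclear_norm A - nuclear_norm B \<le> entry_l1_norm (A - B)"
proof -
  obtain C where C: "onorm ((*v) C) \<le> 1" "nuclear_norm A = A \<bullet> C"
    by (rule nuclear_norm_dual)
  have "nuclear_norm A = B \<bullet> C + (A - B) \<bullet> C"
    by (simp add: C(2) inner_diff_left)
  then show ?thesis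
    using inner_le_nuclear_norm[OF C(1), of B] inner_le_entry_l1_norm[OF C(1), of "A - B"]
    by linarith
qed

lemma entry_l1_norm_le_norm:
  "entry_l1_norm (A :: real^'n^'m) \<le> real CARD('m) * real CARD('n) * norm A"
proof -
  have "\<bar>A $ i $ j\<bar> \<le> norm A" for i j
    using component_le_norm_cart[of "A $ i" j] Finite_Cartesian_Product.norm_nth_le[of A i] by linarith
  then have "entry_l1_norm A \<le> (\<Sum>i\<in>(UNIV::'m set). \<Sum>j\<in>(UNIV::'n set). norm A)"
    unfolding entry_l1_norm_def by (intro sum_mono)
  then show ?thesis by (simp add: mult.assoc)
qed

text \<open>Continuity serves only to make the norm of a random matrix measurable, so a crude
  Lipschitz constant is enough.\<close>

lemma continuous_on_nuclear_norm: "continuous_on UNIV (nuclear_norm :: real^'n^'m \<Rightarrow> real)"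
proof (rule lipschitz_on_continuous_on)
  show "(real CARD('m) * real CARD('n))-lipschitz_on UNIV (nuclear_norm :: real^'n^'m \<Rightarrow> real)"
  proof (rule lipschitz_onI)
    fix A B :: "real^'n^'m"
    show "dist (nuclear_norm A) (nuclear_norm B) \<le> real CARD('m) * real CARD('n) * dist A B"
      using nuclear_norm_diff_le[of A B] nuclear_norm_diff_le[of B A]
        entry_l1_norm_le_norm[of "A - B"] entry_l1_norm_le_norm[of "B - A"]
      by (simp add: dist_norm norm_minus_commute)
  qed simp
qed

lemma onorm_matrix_diff_le:
  fixes A B :: "real^'n^'m"
  shows "onorm ((*v) A) - onorm ((*v) B) \<le> entry_l1_norm (A - B)"
proof -
  have "(*v) A = (\<lambda>x. B *v x + (A - B) *v x)"
    by (simp add: fun_eq_iff matrix_vector_mult_diff_rdistrib)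
  then have "onorm ((*v) A) \<le> onorm ((*v) B) + onorm ((*v) (A - B))"
    using onorm_triangle[of "(*v) B" "(*v) (A - B)"] by simp
  then show ?thesis
    using onorm_le_matrix_component_sum[of "A - B"] unfolding entry_l1_norm_def by linarith
qed

lemma continuous_on_spectral_norm: "continuous_on UNIV (spectral_norm :: real^'n^'m \<Rightarrow> real)"
proof (rule lipschitz_on_continuous_on)
  show "(real CARD('m) * real CARD('n))-lipschitz_on UNIV (spectral_norm :: real^'n^'m \<Rightarrow> real)"
  proof (rule lipschitz_onI)
    fix A B :: "real^'n^'m"
    show "dist (spectral_norm A) (spectral_norm B) \<le> real CARD('m) * real CARD('n) * dist A B"
      using onorm_matrix_diff_le[of A B] onorm_matrix_diff_le[of B A]
        entry_l1_norm_le_norm[of "A - B"] entry_l1_norm_le_norm[of "B - A"]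
      by (simp add: dist_norm norm_minus_commute spectral_norm_eq_onorm)
  qed simp
qed

section \<open>Orthogonal changes of coordinates\<close>

lemma orthogonal_matrix_norm [simp]:
  fixes P :: "real^'n^'n"
  assumes "orthogonal_matrix P"
  shows "norm (P *v x) = norm x"
proof -
  have "(P *v x) \<bullet> (P *v x) = x \<bullet> x"
    using gram_inner[of P x x] assms by (simp add: orthogonal_matrix_def)
  then show ?thesis by (simp add: norm_eq_sqrt_inner)
qed

lemma onorm_orthogonal_conj_le:
  fixes A :: "real^'n^'m"
  assumes "orthogonal_matrix P" "orthogonal_matrix Q"
  shows "onorm ((*v) (P ** A ** Q)) \<le> onorm ((*v) A)"
proof (rule onorm_le)
  fix x
  have "norm ((P ** A ** Q) *v x) = norm (A *v (Q *v x))"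
    using assms by (simp flip: matrix_vector_mul_assoc)
  also have "\<dots> \<le> onorm ((*v) A) * norm (Q *v x)"
    by (rule onorm) simp
  finally show "norm ((P ** A ** Q) *v x) \<le> onorm ((*v) A) * norm x"
    using assms by simp
qed

lemma inner_matrix_mult_left:
  fixes A :: "real^'n^'m" and P :: "real^'m^'k"
  shows "(P ** A) \<bullet> B = A \<bullet> (transpose P ** B)"
proof -
  have "(P ** A) \<bullet> B = (\<Sum>b\<in>Basis. ((P ** A) *v b) \<bullet> (B *v b))"
    by (rule frobenius_inner_basis) (auto simp: pairwise_def orthogonal_def inner_Basis)
  also have "\<dots> = (\<Sum>b\<in>Basis. (A *v b) \<bullet> ((transpose P ** B) *v b))"
    by (simp add: dot_lmul_matrix[symmetric] inner_commute flip: matrix_vector_mul_assoc)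
  also have "\<dots> = A \<bullet> (transpose P ** B)"
    by (rule frobenius_inner_basis[symmetric]) (auto simp: pairwise_def orthogonal_def inner_Basis)
  finally show ?thesis .
qed

lemma inner_transpose: "transpose A \<bullet> transpose B = A \<bullet> (B :: real^'n^'m)"
  unfolding inner_vec_def transpose_def by simp (rule sum.swap)

lemma inner_matrix_mult_right:
  fixes A :: "real^'n^'m" and Q :: "real^'k^'n"
  shows "(A ** Q) \<bullet> B = A \<bullet> (B ** transpose Q)"
proof -
  have "(A ** Q) \<bullet> B = (transpose Q ** transpose A) \<bullet> transpose B"
    by (simp add: inner_transpose flip: matrix_transpose_mul)
  also have "\<dots> = transpose A \<bullet> (Q ** transpose B)"
    by (simp add: inner_matrix_mult_left)
  also have "Q ** transpose B = transpose (B ** transpose Q)"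
    by (simp add: matrix_transpose_mul)
  finally show ?thesis by (simp add: inner_transpose)
qed

lemma inner_orthogonal_conj:
  fixes A B :: "real^'n^'m"
  assumes "orthogonal_matrix P" "orthogonal_matrix Q"
  shows "(P ** A ** Q) \<bullet> (P ** B ** Q) = A \<bullet> B"
proof -
  have "(P ** A ** Q) \<bullet> (P ** B ** Q) = (P ** A) \<bullet> (P ** B)"
    using assms inner_matrix_mult_right[of "P ** A" Q "P ** B ** Q"]
    by (simp add: orthogonal_matrix_def flip: matrix_mul_assoc)
  also have "\<dots> = A \<bullet> B"
    using assms inner_matrix_mult_left[of P A "P ** B"]
    by (simp add: matrix_mul_assoc orthogonal_matrix_def)
  finally show ?thesis .
qed

text \<open>Rotating the dual certificate \<open>C\<close> along with \<open>A\<close> preserves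
  both the pairing and the contraction property, and a contraction has small entries in every pair
  of orthonormal bases. This carries the bound on the entrywise norm over to the nuclear
  norm.\<close>

lemma nuclear_norm_le_entry_l1_norm_conj:
  fixes A :: "real^'n^'m"
  assumes "orthogonal_matrix P" "orthogonal_matrix Q"
  shows "nuclear_norm A \<le> entry_l1_norm (P ** A ** Q)"
proof -
  obtain C where C: "onorm ((*v) C) \<le> 1" "nuclear_norm A = A \<bullet> C"
    by (rule nuclear_norm_dual)
  have "onorm ((*v) (P ** C ** Q)) \<le> 1"
    using onorm_orthogonal_conj_le[OF assms, of C] C(1) by linarith
  then show ?thesis
    using inner_le_entry_l1_norm[of "P ** C ** Q" "P ** A ** Q"] inner_orthogonal_conj[OF assms, of A C] C(2)
    by simp
qed

lemma nuclear_norm_nonneg: "0 \<le> nuclear_norm A"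
  unfolding nuclear_norm_def by (auto intro!: sum_nonneg simp: singular_values_def)

section \<open>Smooth functions\<close>

lemma gradient_descent_lemma:
  fixes f :: "'a::euclidean_space \<Rightarrow> real"
  assumes diff: "\<And>x. f differentiable (at x)"
    and smooth: "\<And>x y. norm (gradient f y - gradient f x) \<le> L * norm (y - x)"
  shows "f y \<le> f x + gradient f x \<bullet> (y - x) + L / 2 * (norm (y - x))\<^sup>2"
proof -
  define d where "d = y - x"
  \<comment> \<open>The gap between \<open>f\<close> on the segment and its quadratic majorant. Its
    derivative is nonpositive by the Lipschitz bound, so the gradient need not be
    integrated.\<close>
  define \<phi> where "\<phi> t = f (x + t *\<^sub>R d) - t * (gradient f x \<bullet> d) - L * t\<^sup>2 / 2 * (norm d)\<^sup>2" for t
  have "\<phi> 1 \<le> \<phi> 0"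
  proof (rule DERIV_nonpos_imp_nonincreasing[where f = \<phi>])
    fix t :: real assume t: "0 \<le> t" "t \<le> 1"
    have "(f has_derivative (\<lambda>h. h \<bullet> gradient f (x + t *\<^sub>R d))) (at (x + t *\<^sub>R d))"
      using GDERIV_gradient[OF diff] by (simp add: gderiv_def)
    moreover have "((\<lambda>t. x + t *\<^sub>R d) has_derivative (\<lambda>h. h *\<^sub>R d)) (at t)"
      by (auto intro!: derivative_eq_intros)
    ultimately have "((\<lambda>t. f (x + t *\<^sub>R d)) has_derivative
        (\<lambda>h. (h *\<^sub>R d) \<bullet> gradient f (x + t *\<^sub>R d))) (at t)"
      using diff_chain_at[of "\<lambda>t. x + t *\<^sub>R d" "\<lambda>h. h *\<^sub>R d" t f
          "\<lambda>h. h \<bullet> gradient f (x + t *\<^sub>R d)"] by (simp add: o_def)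
    then have "((\<lambda>t. f (x + t *\<^sub>R d)) has_field_derivative (d \<bullet> gradient f (x + t *\<^sub>R d))) (at t)"
      by (simp add: has_field_derivative_def mult_commute_abs)
    then have "(\<phi> has_field_derivative
        (d \<bullet> gradient f (x + t *\<^sub>R d) - gradient f x \<bullet> d - L * t * (norm d)\<^sup>2)) (at t)"
      unfolding \<phi>_def by (auto intro!: derivative_eq_intros)
    moreover have "d \<bullet> gradient f (x + t *\<^sub>R d) - gradient f x \<bullet> d \<le> L * t * (norm d)\<^sup>2"
    proof -
      have "d \<bullet> gradient f (x + t *\<^sub>R d) - gradient f x \<bullet> d
          = d \<bullet> (gradient f (x + t *\<^sub>R d) - gradient f x)"
        by (simp add: inner_diff_right inner_commute)
      also have "\<dots> \<le> norm d * norm (gradient f (x + t *\<^sub>R d) - gradient f x)"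
        by (rule norm_cauchy_schwarz)
      also have "\<dots> \<le> norm d * (L * norm ((x + t *\<^sub>R d) - x))"
        by (intro mult_left_mono smooth) simp
      also have "\<dots> = L * t * (norm d)\<^sup>2"
        using t by (simp add: power2_eq_square)
      finally show ?thesis .
    qed
    ultimately show "\<exists>y. DERIV \<phi> t :> y \<and> y \<le> 0"
      by (intro exI conjI) auto
  qed simp
  then show ?thesis
    by (simp add: \<phi>_def d_def)
qed

text \<open>A gradient step of length \<open>1 / L\<close> lowers \<open>f\<close> by at least
  \<open>(norm (gradient f x))\<^sup>2 / (2 * L)\<close> and cannot pass below
  \<open>c\<close>.\<close>

lemma norm_gradient_le_gap:
  fixes f :: "'a::euclidean_space \<Rightarrow> real"
  assumes diff: "\<And>x. f differentiable (at x)"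
    and smooth: "\<And>x y. norm (gradient f y - gradient f x) \<le> L * norm (y - x)"
    and lower: "\<And>x. c \<le> f x" and "0 < L"
  shows "(norm (gradient f x))\<^sup>2 \<le> 2 * L * (f x - c)"
proof -
  define g where "g = gradient f x"
  have "c \<le> f (x - (1 / L) *\<^sub>R g)" by (rule lower)
  also have "\<dots> \<le> f x + g \<bullet> (- (1 / L) *\<^sub>R g) + L / 2 * (norm ((1 / L) *\<^sub>R g))\<^sup>2"
    using gradient_descent_lemma[of f L "x - (1 / L) *\<^sub>R g" x, OF diff smooth] by (simp add: g_def)
  also have "\<dots> = f x - (norm g)\<^sup>2 / (2 * L)"
    using \<open>0 < L\<close> by (simp add: dot_square_norm power_mult_distrib power2_eq_square field_simps)
  finally show ?thesis
    using \<open>0 < L\<close> by (simp add: g_def field_simps)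
qed

section \<open>Scalar inequalities\<close>

text \<open>The tangent at \<open>z\<^sup>2\<close> to the convex function
  \<open>1 / sqrt u\<close>, evaluated at \<open>u = y\<^sup>2\<close>. The bound is linear in
  \<open>y\<^sup>2\<close>, so it can be integrated against the law of a squared sample.\<close>

lemma inverse_tangent_le:
  fixes y z :: real
  assumes "0 < y" "0 < z"
  shows "1 / z - (y\<^sup>2 - z\<^sup>2) / (2 * z ^ 3) \<le> 1 / y"
proof -
  have "1 / y - (1 / z - (y\<^sup>2 - z\<^sup>2) / (2 * z ^ 3)) = (z - y)\<^sup>2 * (2 * z + y) / (2 * z ^ 3 * y)"
    using assms by (simp add: field_simps power2_eq_square power3_eq_cube)
  also have "\<dots> \<ge> 0" using assms by simp
  finally show ?thesis by simp
qed

lemma sqrt_tangent_ge: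
  fixes y z :: real
  assumes "0 \<le> y" "0 < z"
  shows "sqrt y \<le> sqrt z + (y - z) / (2 * sqrt z)"
proof -
  have "0 \<le> (sqrt y - sqrt z)\<^sup>2" by simp
  then have "2 * sqrt y * sqrt z \<le> y + z"
    using assms by (simp add: power2_diff)
  then have "sqrt y \<le> (y + z) / (2 * sqrt z)"
    using assms by (simp add: field_simps)
  also have "\<dots> = sqrt z + (y - z) / (2 * sqrt z)"
    using assms by (simp add: field_simps)
  finally show ?thesis .
qed

text \<open>The increment is charged as \<open>c\<close> over the new root rather than as
  \<open>sqrt c\<close>. For \<open>c\<close> a multiple of a squared gradient entry this is a ratio
  that descent controls, whereas \<open>sqrt c\<close> would be the quantity to be bounded.\<close>

lemma sqrt_add_le_div:
  fixes a c :: real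
  assumes "0 \<le> a" "0 \<le> c" "0 < a + c"
  shows "sqrt (a + c) \<le> sqrt a + c / sqrt (a + c)"
proof -
  have "sqrt a * sqrt a \<le> sqrt a * sqrt (a + c)"
    using assms by (intro mult_left_mono) auto
  then have "a / sqrt (a + c) \<le> sqrt a"
    using assms by (simp add: pos_divide_le_eq)
  moreover have "sqrt (a + c) = a / sqrt (a + c) + c / sqrt (a + c)"
    using assms real_div_sqrt[of "a + c"] by (simp flip: add_divide_distrib)
  ultimately show ?thesis by linarith
qed

text \<open>Young's inequality with the weights \<open>1 / \<theta>\<close> and
  \<open>1 / (1 - \<theta>)\<close>, multiplied by \<open>\<theta>\<^sup>2\<close> so that
  \<open>\<theta> = 0\<close> is covered. One factor \<open>\<theta>\<close> is given up to admit
  the drift \<open>y\<close>; the other still contracts.\<close>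

lemma momentum_young:
  fixes x y \<theta> :: real
  assumes "0 \<le> \<theta>" "\<theta> < 1"
  shows "\<theta>\<^sup>2 * (x + y)\<^sup>2 \<le> \<theta> * x\<^sup>2 + \<theta>\<^sup>2 / (1 - \<theta>) * y\<^sup>2"
proof -
  have "\<theta> * x\<^sup>2 + \<theta>\<^sup>2 / (1 - \<theta>) * y\<^sup>2 - \<theta>\<^sup>2 * (x + y)\<^sup>2 = \<theta> * ((1 - \<theta>) * x - \<theta> * y)\<^sup>2 / (1 - \<theta>)"
    using assms by (simp add: field_simps power2_eq_square)
  also have "\<dots> \<ge> 0" using assms by simp
  finally show ?thesis by simp
qed

text \<open>Polarisation yields \<open>- (\<eta> / 2) * (m\<^sup>2 / s)\<close>, and the quadratic
  term uses at most half of it because \<open>L * \<eta> \<le> s / 2\<close>. Only in the error term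
  is \<open>s\<close> replaced by its lower bound, since the momentum error is tracked in the
  unweighted norm.\<close>

lemma preconditioned_step_le:
  fixes x m s \<eta> L c :: real
  assumes "0 < c" "c \<le> s" "0 \<le> \<eta>" "0 \<le> L" "L * \<eta> \<le> c / 2"
  shows "- \<eta> * (x * (m / s)) + L / 2 * \<eta>\<^sup>2 * (m / s)\<^sup>2
    \<le> - (\<eta> / 2) * (x\<^sup>2 / s) - \<eta> / 4 * (m\<^sup>2 / s) + \<eta> / (2 * c) * (x - m)\<^sup>2"
proof -
  have s: "0 < s" using assms by linarith
  have "(x - m)\<^sup>2 / s \<le> (x - m)\<^sup>2 / c"
    using assms s by (intro divide_left_mono) auto
  then have 1: "\<eta> / 2 * ((x - m)\<^sup>2 / s) \<le> \<eta> / 2 * ((x - m)\<^sup>2 / c)"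
    using assms by (intro mult_left_mono) auto
  have "L * \<eta> * (m\<^sup>2 / s\<^sup>2) \<le> s / 2 * (m\<^sup>2 / s\<^sup>2)"
    using assms by (intro mult_right_mono) auto
  also have "\<dots> = m\<^sup>2 / s / 2" using s by (simp add: power2_eq_square)
  finally have "\<eta> / 2 * (L * \<eta> * (m\<^sup>2 / s\<^sup>2)) \<le> \<eta> / 2 * (m\<^sup>2 / s / 2)"
    using assms by (intro mult_left_mono) auto
  then have 2: "L / 2 * \<eta>\<^sup>2 * (m / s)\<^sup>2 \<le> \<eta> / 4 * (m\<^sup>2 / s)"
    by (simp add: power2_eq_square mult_ac)
  have "- \<eta> * (x * (m / s)) = \<eta> / 2 * ((x - m)\<^sup>2 / s) - \<eta> / 2 * (x\<^sup>2 / s) - \<eta> / 2 * (m\<^sup>2 / s)"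
    using s by (simp add: field_simps power2_eq_square)
  then show ?thesis using 1 2 by simp
qed

text \<open>The sum of \<open>r ^ (k - 1 - j) * q j\<close> over \<open>j < k\<close>, in the
  recursive form in which it arises from unrolling a moving average.\<close>

primrec decayed_sum :: "real \<Rightarrow> (nat \<Rightarrow> real) \<Rightarrow> nat \<Rightarrow> real" where
  "decayed_sum r q 0 = 0"
| "decayed_sum r q (Suc k) = r * decayed_sum r q k + q k"

lemma decayed_sum_nonneg:
  assumes "0 \<le> r" "\<And>k. k < n \<Longrightarrow> 0 \<le> q k"
  shows "0 \<le> decayed_sum r q n"
  using assms(2) by (induction n) (use assms(1) in auto)

text \<open>The recursion, solved for \<open>q k\<close> and summed, telescopes; the term
  \<open>r * decayed_sum r q n\<close> is what the truncation of the geometric series leaves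
  over.\<close>

lemma sum_decayed_sum:
  "(1 - r) * (\<Sum>k<n. decayed_sum r q (Suc k)) + r * decayed_sum r q n = (\<Sum>k<n. q k)"
proof (induction n)
  case (Suc n)
  have "(1 - r) * (\<Sum>k<Suc n. decayed_sum r q (Suc k)) + r * decayed_sum r q (Suc n)
      = (1 - r) * (\<Sum>k<n. decayed_sum r q (Suc k)) + decayed_sum r q (Suc n)"
    by (simp add: algebra_simps del: decayed_sum.simps)
  then show ?case using Suc by simp
qed simp

lemma sum_decayed_sum_le:
  assumes "0 \<le> r" "\<And>k. k < n \<Longrightarrow> 0 \<le> q k"
  shows "(1 - r) * (\<Sum>k<n. decayed_sum r q (Suc k)) \<le> (\<Sum>k<n. q k)"
proof -
  have "0 \<le> r * decayed_sum r q n" using decayed_sum_nonneg[of r n q] assms by simp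
  then show ?thesis using sum_decayed_sum[of r q n] by linarith
qed

text \<open>With one constant \<open>c\<close> for all entries, steps and outcomes, the right-hand
  side is linear in the ratio and in the scale. Summing, integrating and then optimising
  \<open>c\<close> once has the effect of Cauchy-Schwarz on the totals.\<close>

lemma weighted_young:
  fixes x s c :: real
  assumes "0 < s" "0 < c"
  shows "\<bar>x\<bar> \<le> (c * (x\<^sup>2 / s) + s / c) / 2"
proof -
  have "0 \<le> (c * \<bar>x\<bar> - s)\<^sup>2 / (c * s)" using assms by simp
  also have "\<dots> = c * (x\<^sup>2 / s) + s / c - 2 * \<bar>x\<bar>"
    using assms by (simp add: power2_diff power_mult_distrib field_simps) (simp add: power2_eq_square)
  finally show ?thesis by simp
qed

lemma young_optimal:
  fixes a b :: real
  assumes "0 < a" "0 < b"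
  obtains c where "0 < c" "(c * a + b / c) / 2 = sqrt (a * b)"
proof
  show "0 < sqrt b / sqrt a" using assms by simp
  have "sqrt b / sqrt a * a = sqrt a * sqrt b" "b / (sqrt b / sqrt a) = sqrt a * sqrt b"
    using assms by (simp_all add: field_simps)
  then show "(sqrt b / sqrt a * a + b / (sqrt b / sqrt a)) / 2 = sqrt (a * b)"
    by (simp add: real_sqrt_mult)
qed

text \<open>The constants come from \<open>7 * 14 = 98 \<le> 10\<^sup>2\<close> and
  \<open>7 * sqrt 2 \<le> 16 = 4\<^sup>2\<close>; the cross term of the square is dropped.\<close>

lemma rate_arithmetic:
  fixes A d \<sigma> :: real
  assumes "0 < A" "0 < \<sigma>" "0 \<le> d"
  shows "sqrt (7 * A * (d * (sqrt 2 * \<sigma>) + 14 * A)) \<le> 10 * A + 4 * sqrt d * sqrt (A * \<sigma>)"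
proof (rule real_le_lsqrt)
  have "sqrt 2 \<le> (16 / 7 :: real)" by (rule real_le_lsqrt) (auto simp: power2_eq_square)
  then have "7 * A * (d * (sqrt 2 * \<sigma>)) \<le> 7 * A * (d * (16 / 7 * \<sigma>))"
    using assms by (intro mult_left_mono mult_right_mono) auto
  also have "\<dots> = (4 * sqrt d * sqrt (A * \<sigma>))\<^sup>2"
    using assms by (simp add: power_mult_distrib)
  finally have "7 * A * (d * (sqrt 2 * \<sigma>)) \<le> (4 * sqrt d * sqrt (A * \<sigma>))\<^sup>2" .
  moreover have "7 * A * (14 * A) \<le> (10 * A)\<^sup>2" by (simp add: power2_eq_square)
  moreover have "0 \<le> 10 * A * (4 * sqrt d * sqrt (A * \<sigma>))" using assms by simp
  ultimately show "7 * A * (d * (sqrt 2 * \<sigma>) + 14 * A) \<le> (10 * A + 4 * sqrt d * sqrt (A * \<sigma>))\<^sup>2"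
    unfolding power2_sum by (simp only: distrib_left)
  show "0 \<le> 10 * A + 4 * sqrt d * sqrt (A * \<sigma>)" using assms by simp
qed

section \<open>Square-integrable random matrices and conditional expectation\<close>

lemma matrix_basis_eq:
  "(Basis :: (real^'n^'m) set) = (\<Union>i. \<Union>j. {axis i (axis j 1)})"
  by (auto simp: Basis_vec_def)

lemma borel_measurable_matrix_iff:
  fixes F :: "'a \<Rightarrow> real^'n^'m"
  shows "F \<in> borel_measurable N \<longleftrightarrow> (\<forall>i j. (\<lambda>x. F x $ i $ j) \<in> borel_measurable N)"
  by (subst borel_measurable_euclidean_space) (auto simp: matrix_basis_eq inner_axis)

lemma borel_measurable_matrix_entry:
  fixes F :: "'a \<Rightarrow> real^'n^'m"
  shows "F \<in> borel_measurable N \<Longrightarrow> (\<lambda>x. F x $ i $ j) \<in> borel_measurable N"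
  by (simp add: borel_measurable_matrix_iff)

lemma borel_measurable_matrix_mult:
  fixes A :: "'a \<Rightarrow> real^'n^'m" and B :: "'a \<Rightarrow> real^'k^'n"
  assumes "A \<in> borel_measurable N" "B \<in> borel_measurable N"
  shows "(\<lambda>x. A x ** B x) \<in> borel_measurable N"
  using assms unfolding borel_measurable_matrix_iff matrix_matrix_mult_def by (auto intro!: borel_measurable_sum borel_measurable_times)

lemma borel_measurable_transpose:
  fixes A :: "'a \<Rightarrow> real^'n^'m"
  shows "A \<in> borel_measurable N \<Longrightarrow> (\<lambda>x. transpose (A x)) \<in> borel_measurable N"
  unfolding borel_measurable_matrix_iff transpose_def by simp

lemma borel_measurable_entry_divide:
  fixes A B :: "'a \<Rightarrow> real^'n^'m"
  shows "A \<in> borel_measurable N \<Longrightarrow> B \<in> borel_measurable N \<Longrightarrow>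
    (\<lambda>x. entry_divide (A x) (B x)) \<in> borel_measurable N"
  unfolding borel_measurable_matrix_iff entry_divide_def by (auto intro!: borel_measurable_divide)

lemma borel_measurable_entry_square:
  fixes A :: "'a \<Rightarrow> real^'n^'m"
  shows "A \<in> borel_measurable N \<Longrightarrow> (\<lambda>x. entry_square (A x)) \<in> borel_measurable N"
  unfolding borel_measurable_matrix_iff entry_square_def by (auto intro!: borel_measurable_power)

lemma borel_measurable_entry_sqrt:
  fixes A :: "'a \<Rightarrow> real^'n^'m"
  shows "A \<in> borel_measurable N \<Longrightarrow> (\<lambda>x. entry_sqrt (A x)) \<in> borel_measurable N"
  unfolding borel_measurable_matrix_iff entry_sqrt_def by (auto intro!: measurable_compose[OF _ borel_measurable_sqrt])

lemma borel_measurable_entry_add: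
  fixes A :: "'a \<Rightarrow> real^'n^'m"
  shows "A \<in> borel_measurable N \<Longrightarrow> (\<lambda>x. entry_add (A x) c) \<in> borel_measurable N"
  unfolding borel_measurable_matrix_iff entry_add_def by (auto intro!: borel_measurable_add)

lemmas borel_measurable_matrix_intros =
  borel_measurable_matrix_mult borel_measurable_transpose borel_measurable_entry_divide
  borel_measurable_entry_square borel_measurable_entry_sqrt borel_measurable_entry_add
  borel_measurable_matrix_entry

section \<open>Square-integrable random vectors\<close>

definition square_integrable :: "'a measure \<Rightarrow> ('a \<Rightarrow> 'b::euclidean_space) \<Rightarrow> bool" where
  "square_integrable M Y \<longleftrightarrow> Y \<in> borel_measurable M \<and> integrable M (\<lambda>x. (norm (Y x))\<^sup>2)"

lemma square_integrable_measurable: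
  "square_integrable M Y \<Longrightarrow> Y \<in> borel_measurable M"
  by (simp add: square_integrable_def)

lemma square_integrable_integrable:
  "square_integrable M Y \<Longrightarrow> integrable M (\<lambda>x. (norm (Y x))\<^sup>2)"
  by (simp add: square_integrable_def)

lemma square_integrable_bound:
  assumes "square_integrable M Y" "Z \<in> borel_measurable M"
    and "\<And>x. x \<in> space M \<Longrightarrow> norm (Z x) \<le> c * norm (Y x)"
  shows "square_integrable M Z"
  unfolding square_integrable_def
proof
  show Z [measurable]: "Z \<in> borel_measurable M" by fact
  show "integrable M (\<lambda>x. (norm (Z x))\<^sup>2)"
  proof (rule Bochner_Integration.integrable_bound)
    show "integrable M (\<lambda>x. c\<^sup>2 * (norm (Y x))\<^sup>2)"
      using assms(1) by (simp add: square_integrable_def)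
    show "AE x in M. norm ((norm (Z x))\<^sup>2) \<le> norm (c\<^sup>2 * (norm (Y x))\<^sup>2)"
      using assms(3) by (intro AE_I2) (simp add: power_mono flip: power_mult_distrib)
  qed simp
qed

lemma square_integrable_add:
  assumes "square_integrable M Y" "square_integrable M Z"
  shows "square_integrable M (\<lambda>x. Y x + Z x)"
  unfolding square_integrable_def
proof
  have [measurable]: "Y \<in> borel_measurable M" "Z \<in> borel_measurable M"
    using assms by (auto simp: square_integrable_def)
  show "(\<lambda>x. Y x + Z x) \<in> borel_measurable M" by simp
  show "integrable M (\<lambda>x. (norm (Y x + Z x))\<^sup>2)"
  proof (rule Bochner_Integration.integrable_bound)
    show "integrable M (\<lambda>x. 2 * (norm (Y x))\<^sup>2 + 2 * (norm (Z x))\<^sup>2)"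
      using assms by (simp add: square_integrable_def)
    have "(norm (Y x + Z x))\<^sup>2 \<le> 2 * (norm (Y x))\<^sup>2 + 2 * (norm (Z x))\<^sup>2" for x
    proof -
      have "(norm (Y x + Z x))\<^sup>2 \<le> (norm (Y x) + norm (Z x))\<^sup>2"
        by (intro power_mono norm_triangle_ineq) simp
      also have "\<dots> \<le> 2 * (norm (Y x))\<^sup>2 + 2 * (norm (Z x))\<^sup>2"
        using sum_squares_bound[of "norm (Y x)" "norm (Z x)"] by (simp add: power2_sum)
      finally show ?thesis .
    qed
    then show "AE x in M. norm ((norm (Y x + Z x))\<^sup>2) \<le> norm (2 * (norm (Y x))\<^sup>2 + 2 * (norm (Z x))\<^sup>2)"
      by (intro AE_I2) simp
  qed simp
qed

lemma square_integrable_scaleR: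
  assumes "square_integrable M Y"
  shows "square_integrable M (\<lambda>x. c *\<^sub>R Y x)"
  by (rule square_integrable_bound[OF assms, of _ "\<bar>c\<bar>"])
    (use assms in \<open>auto simp: square_integrable_def\<close>)

lemma square_integrable_diff:
  assumes "square_integrable M Y" "square_integrable M Z"
  shows "square_integrable M (\<lambda>x. Y x - Z x)"
  using square_integrable_add[OF assms(1) square_integrable_scaleR[OF assms(2), of "-1"]] by simp

lemma square_integrable_inner:
  assumes "square_integrable M Y" "square_integrable M Z"
  shows "integrable M (\<lambda>x. Y x \<bullet> Z x)"
proof (rule Bochner_Integration.integrable_bound)
  show "integrable M (\<lambda>x. (norm (Y x))\<^sup>2 + (norm (Z x))\<^sup>2)"
    using assms by (simp add: square_integrable_def)
  show "(\<lambda>x. Y x \<bullet> Z x) \<in> borel_measurable M"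
    using assms by (auto simp: square_integrable_def)
  have "\<bar>Y x \<bullet> Z x\<bar> \<le> (norm (Y x))\<^sup>2 + (norm (Z x))\<^sup>2" for x
  proof -
    have "\<bar>Y x \<bullet> Z x\<bar> \<le> norm (Y x) * norm (Z x)"
      by (rule Cauchy_Schwarz_ineq2)
    also have "\<dots> \<le> 2 * norm (Y x) * norm (Z x)" by simp
    also have "\<dots> \<le> (norm (Y x))\<^sup>2 + (norm (Z x))\<^sup>2"
      by (rule sum_squares_bound)
    finally show ?thesis .
  qed
  then show "AE x in M. norm (Y x \<bullet> Z x) \<le> norm ((norm (Y x))\<^sup>2 + (norm (Z x))\<^sup>2)"
    by (intro AE_I2) simp
qed

lemma square_integrable_entry:
  fixes Y :: "'a \<Rightarrow> real^'n^'m"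
  assumes "square_integrable M Y"
  shows "square_integrable M (\<lambda>x. Y x $ i $ j)"
proof (rule square_integrable_bound[OF assms, of _ 1])
  show "(\<lambda>x. Y x $ i $ j) \<in> borel_measurable M"
    using assms by (auto simp: square_integrable_def intro: borel_measurable_matrix_entry)
  show "norm (Y x $ i $ j) \<le> 1 * norm (Y x)" for x
    using component_le_norm_cart[of "Y x $ i" j] Finite_Cartesian_Product.norm_nth_le[of "Y x" i] by simp
qed

lemma square_integrable_cong:
  assumes "\<And>x. x \<in> space M \<Longrightarrow> Y x = Z x"
  shows "square_integrable M Y \<longleftrightarrow> square_integrable M Z"
  unfolding square_integrable_def using assms
  by (intro arg_cong2[where f = "(\<and>)"] measurable_cong Bochner_Integration.integrable_cong refl) auto

lemma (in finite_measure) square_integrable_bounded: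
  assumes "Y \<in> borel_measurable M" "\<And>x. x \<in> space M \<Longrightarrow> norm (Y x) \<le> c"
  shows "square_integrable M Y"
  by (rule square_integrable_bound[of M "\<lambda>_. 1 :: real" _ c])
    (use assms in \<open>auto simp: square_integrable_def\<close>)

lemma (in finite_measure) square_integrable_imp_integrable:
  assumes "square_integrable M Y"
  shows "integrable M (\<lambda>x. norm (Y x))"
proof (rule Bochner_Integration.integrable_bound)
  show "integrable M (\<lambda>x. 1 + (norm (Y x))\<^sup>2)"
    using assms by (simp add: square_integrable_def)
  show "(\<lambda>x. norm (Y x)) \<in> borel_measurable M"
    using assms by (auto simp: square_integrable_def)
  have "norm (Y x) \<le> 1 + (norm (Y x))\<^sup>2" for x
  proof -
    have "2 * norm (Y x) \<le> 1 + (norm (Y x))\<^sup>2"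
      using sum_squares_bound[of 1 "norm (Y x)"] by simp
    then show ?thesis using norm_ge_zero[of "Y x"] by linarith
  qed
  then show "AE x in M. norm (norm (Y x)) \<le> norm (1 + (norm (Y x))\<^sup>2)"
    by (intro AE_I2) simp
qed

lemma (in finite_measure) integrable_sqrt:
  assumes "integrable M y" "\<And>x. x \<in> space M \<Longrightarrow> 0 \<le> y x"
  shows "integrable M (\<lambda>x. sqrt (y x))"
proof -
  have [measurable]: "y \<in> borel_measurable M" using assms(1) by simp
  have "integrable M (\<lambda>x. (norm (sqrt (y x)))\<^sup>2) \<longleftrightarrow> integrable M y"
    using assms(2) by (intro Bochner_Integration.integrable_cong) auto
  then have "square_integrable M (\<lambda>x. sqrt (y x))"
    using assms(1) by (simp add: square_integrable_def)
  then have "integrable M (\<lambda>x. norm (sqrt (y x)))"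
    by (rule square_integrable_imp_integrable)
  moreover have "integrable M (\<lambda>x. norm (sqrt (y x))) \<longleftrightarrow> integrable M (\<lambda>x. sqrt (y x))"
    using assms(2) by (intro Bochner_Integration.integrable_cong) auto
  ultimately show ?thesis by simp
qed

section \<open>Conditional moments tested against measurable weights\<close>

lemma inner_matrix_def: "(A :: real^'n^'m) \<bullet> B = (\<Sum>i\<in>UNIV. \<Sum>j\<in>UNIV. A $ i $ j * B $ i $ j)"
  by (simp add: inner_vec_def)

lemma norm_matrix_sq: "(norm (A :: real^'n^'m))\<^sup>2 = (\<Sum>i\<in>UNIV. \<Sum>j\<in>UNIV. (A $ i $ j)\<^sup>2)"
  by (simp add: norm_eq_frobenius sum_nonneg)

text \<open>Centred noise is orthogonal to everything known beforehand. Matrix conditional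
  expectation is entrywise, so the known factor is pulled out of each entry separately.\<close>

lemma expectation_inner_cond_exp:
  fixes Y Z W :: "'a \<Rightarrow> real^'n^'m"
  assumes "sigma_finite_subalgebra M F"
    and Y: "Y \<in> borel_measurable F" "square_integrable M Y"
    and Z: "square_integrable M Z" and W: "square_integrable M W"
    and ce: "AE x in M. matrix_cond_exp M F Z x = W x"
  shows "(\<integral>x. Y x \<bullet> (Z x - W x) \<partial>M) = 0"
proof -
  interpret sigma_finite_subalgebra M F by fact
  have eq: "(\<integral>x. Y x $ i $ j * Z x $ i $ j \<partial>M) = (\<integral>x. Y x $ i $ j * W x $ i $ j \<partial>M)"
    and int: "integrable M (\<lambda>x. Y x $ i $ j * Z x $ i $ j)" "integrable M (\<lambda>x. Y x $ i $ j * W x $ i $ j)"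
    for i j
  proof -
    show *: "integrable M (\<lambda>x. Y x $ i $ j * Z x $ i $ j)" "integrable M (\<lambda>x. Y x $ i $ j * W x $ i $ j)"
      using square_integrable_inner[OF square_integrable_entry[OF Y(2)] square_integrable_entry[OF Z], of i j i j]
        square_integrable_inner[OF square_integrable_entry[OF Y(2)] square_integrable_entry[OF W], of i j i j]
      by simp_all
    have Zm: "(\<lambda>x. Z x $ i $ j) \<in> borel_measurable M" and Wm: "(\<lambda>x. W x $ i $ j) \<in> borel_measurable M"
      and Ym: "(\<lambda>x. Y x $ i $ j) \<in> borel_measurable M"
      using Z W Y(2) by (auto simp: square_integrable_def intro: borel_measurable_matrix_entry)
    have "(\<integral>x. Y x $ i $ j * Z x $ i $ j \<partial>M)
        = (\<integral>x. Y x $ i $ j * real_cond_exp M F (\<lambda>x. Z x $ i $ j) x \<partial>M)"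
      using *(1) borel_measurable_matrix_entry[OF Y(1)] Zm by (intro real_cond_exp_intg(2)[symmetric])
    also have "\<dots> = (\<integral>x. Y x $ i $ j * W x $ i $ j \<partial>M)"
    proof (rule integral_cong_AE)
      show "AE x in M. Y x $ i $ j * real_cond_exp M F (\<lambda>x. Z x $ i $ j) x = Y x $ i $ j * W x $ i $ j"
        using ce by eventually_elim (auto simp: matrix_cond_exp_def vec_eq_iff)
    qed (use Ym Wm in \<open>auto intro!: borel_measurable_times\<close>)
    finally show "(\<integral>x. Y x $ i $ j * Z x $ i $ j \<partial>M) = (\<integral>x. Y x $ i $ j * W x $ i $ j \<partial>M)" .
  qed
  have "(\<integral>x. Y x \<bullet> (Z x - W x) \<partial>M)
      = (\<integral>x. (\<Sum>i\<in>UNIV. \<Sum>j\<in>UNIV. Y x $ i $ j * Z x $ i $ j - Y x $ i $ j * W x $ i $ j) \<partial>M)"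
    by (simp add: inner_matrix_def right_diff_distrib)
  also have "\<dots> = (\<Sum>i\<in>UNIV. \<Sum>j\<in>UNIV. (\<integral>x. Y x $ i $ j * Z x $ i $ j \<partial>M) - (\<integral>x. Y x $ i $ j * W x $ i $ j \<partial>M))"
    using int by simp
  finally show ?thesis by (simp add: eq)
qed

text \<open>The nonnegative conditional expectation makes sense for any measurable \<open>U\<close>,
  so integrability is a conclusion here; the bound on \<open>h\<close> keeps the right-hand side
  finite.\<close>

lemma nn_cond_exp_bound_integral:
  fixes U h :: "'a \<Rightarrow> real"
  assumes "sigma_finite_subalgebra M F" "finite_measure M"
    and h: "h \<in> borel_measurable F" "\<And>x. x \<in> space M \<Longrightarrow> 0 \<le> h x" "\<And>x. x \<in> space M \<Longrightarrow> h x \<le> b"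
    and U: "U \<in> borel_measurable M" "\<And>x. 0 \<le> U x"
    and ce: "AE x in M. nn_cond_exp M F (\<lambda>x. ennreal (U x)) x \<le> ennreal c" and "0 \<le> c"
  shows "integrable M (\<lambda>x. h x * U x)" "(\<integral>x. h x * U x \<partial>M) \<le> c * (\<integral>x. h x \<partial>M)"
proof -
  interpret sigma_finite_subalgebra M F by fact
  interpret finite_measure M by fact
  have hM [measurable]: "h \<in> borel_measurable M"
    using measurable_from_subalg[OF subalg h(1)] .
  note U(1) [measurable]
  have hi: "integrable M h"
    by (rule integrable_const_bound[of _ b]) (use h in auto)
  have "(\<integral>\<^sup>+x. ennreal (h x * U x) \<partial>M) = (\<integral>\<^sup>+x. ennreal (h x) * ennreal (U x) \<partial>M)"
    by (intro nn_integral_cong) (simp add: h U ennreal_mult)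
  also have "\<dots> = (\<integral>\<^sup>+x. ennreal (h x) * nn_cond_exp M F (\<lambda>x. ennreal (U x)) x \<partial>M)"
    using h(1) by (intro nn_cond_exp_intg[symmetric]) auto
  also have "\<dots> \<le> (\<integral>\<^sup>+x. ennreal (h x) * ennreal c \<partial>M)"
    using ce by (intro nn_integral_mono_AE) (auto elim!: eventually_mono intro!: mult_left_mono)
  also have "\<dots> = (\<integral>\<^sup>+x. ennreal (c * h x) \<partial>M)"
    using h(2) \<open>0 \<le> c\<close> by (intro nn_integral_cong) (simp add: ennreal_mult mult.commute)
  also have "\<dots> = ennreal (\<integral>x. c * h x \<partial>M)"
    using hi h(2) \<open>0 \<le> c\<close> by (intro nn_integral_eq_integral) auto
  finally have *: "(\<integral>\<^sup>+x. ennreal (h x * U x) \<partial>M) \<le> ennreal (c * (\<integral>x. h x \<partial>M))"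
    by simp
  show int: "integrable M (\<lambda>x. h x * U x)"
  proof (rule integrableI_nonneg)
    show "AE x in M. 0 \<le> h x * U x" using h(2) U(2) by auto
    show "(\<integral>\<^sup>+x. ennreal (h x * U x) \<partial>M) < \<infinity>"
      using * by (rule le_less_trans) simp
  qed simp
  have "ennreal (\<integral>x. h x * U x \<partial>M) \<le> ennreal (c * (\<integral>x. h x \<partial>M))"
    using * nn_integral_eq_integral[OF int] h(2) U(2) by auto
  moreover have "0 \<le> c * (\<integral>x. h x \<partial>M)"
    using h(2) \<open>0 \<le> c\<close> by (intro mult_nonneg_nonneg integral_nonneg_AE) auto
  ultimately show "(\<integral>x. h x * U x \<partial>M) \<le> c * (\<integral>x. h x \<partial>M)" by simp
qed

section \<open>The filtration generated by the samples\<close>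

lemma space_sample_filtration [simp]: "space (sample_filtration \<Omega> S \<zeta> k) = space \<Omega>"
  unfolding sample_filtration_def by (rule space_measure_of) auto

lemma sets_sample_filtration:
  "sets (sample_filtration \<Omega> S \<zeta> k) =
    sigma_sets (space \<Omega>) {\<zeta> i -` B \<inter> space \<Omega> | i B. i \<in> {1..k} \<and> B \<in> sets S}"
  unfolding sample_filtration_def by (rule sets_measure_of) auto

lemma subalgebra_sample_filtration:
  assumes "\<And>i. i \<in> {1..k} \<Longrightarrow> \<zeta> i \<in> \<Omega> \<rightarrow>\<^sub>M S"
  shows "subalgebra \<Omega> (sample_filtration \<Omega> S \<zeta> k)"
  unfolding subalgebra_def
proof
  show "sets (sample_filtration \<Omega> S \<zeta> k) \<subseteq> sets \<Omega>"
    unfolding sets_sample_filtration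
    by (rule sets.sigma_sets_subset) (use assms measurable_sets in blast)
qed simp

lemma subalgebra_sample_filtration_Suc:
  "subalgebra (sample_filtration \<Omega> S \<zeta> (Suc k)) (sample_filtration \<Omega> S \<zeta> k)"
  unfolding subalgebra_def sets_sample_filtration
  by (simp, intro sigma_sets_mono') (auto intro: le_SucI)

lemma measurable_sample:
  assumes "\<zeta> i \<in> \<Omega> \<rightarrow>\<^sub>M S" "i \<in> {1..k}"
  shows "\<zeta> i \<in> sample_filtration \<Omega> S \<zeta> k \<rightarrow>\<^sub>M S"
proof (rule measurableI)
  show "\<zeta> i x \<in> space S" if "x \<in> space (sample_filtration \<Omega> S \<zeta> k)" for x
    using that measurable_space[OF assms(1)] by simp
  show "\<zeta> i -` B \<inter> space (sample_filtration \<Omega> S \<zeta> k) \<in> sets (sample_filtration \<Omega> S \<zeta> k)"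
    if "B \<in> sets S" for B
    unfolding sets_sample_filtration space_sample_filtration
    by (rule sigma_sets.Basic) (use that assms(2) in blast)
qed

section \<open>Descent and momentum error\<close>

text \<open>Of the prescribed hyperparameters only \<open>0 \<le> \<theta> < 1\<close>,
  \<open>0 \<le> \<beta> < 1\<close>, the value of \<open>\<epsilon>\<close> and the relation
  between \<open>\<eta>\<close> and \<open>\<theta>\<close> are kept. The formula for
  \<open>\<theta>\<close> enters only when the final constants are computed. A vanishing initial gap
  would force \<open>\<theta> = 1\<close> and is therefore excluded.\<close>

locale soap_run = prob_space \<Omega>
  for \<Omega> :: "'w measure" +
  fixes f :: "real^'n^'m \<Rightarrow> real"
    and S :: "'z measure" and \<zeta> :: "nat \<Rightarrow> 'w \<Rightarrow> 'z"
    and g :: "real^'n^'m \<Rightarrow> 'z \<Rightarrow> real^'n^'m"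
    and X G Mo V :: "nat \<Rightarrow> 'w \<Rightarrow> real^'n^'m"
    and P :: "nat \<Rightarrow> 'w \<Rightarrow> real^'m^'m" and Q :: "nat \<Rightarrow> 'w \<Rightarrow> real^'n^'n"
    and X1 :: "real^'n^'m" and P0 :: "real^'m^'m" and Q0 :: "real^'n^'n"
    and K :: nat
    and \<eta> \<theta> \<beta> \<epsilon> L \<sigma>F \<sigma>op fstar :: real
  assumes diff: "\<And>Y. f differentiable (at Y)"
    and lower: "\<And>Y. fstar \<le> f Y"
    and run: "generalized_soap \<Omega> S \<zeta> g K \<eta> \<theta> \<beta> \<epsilon> X1 P0 Q0 X G Mo V P Q"
    and L_pos: "0 < L" and sop_pos: "0 < \<sigma>op"
    and smooth: "\<And>Y Z. norm (gradient f Z - gradient f Y) \<le> L * norm (Z - Y)"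
    and unbiased: "\<And>k. k \<in> {1..K} \<Longrightarrow> AE \<omega> in \<Omega>.
      matrix_cond_exp \<Omega> (sample_filtration \<Omega> S \<zeta> (k - 1)) (G k) \<omega> = gradient f (X k \<omega>)"
    and noise_F: "\<And>k. k \<in> {1..K} \<Longrightarrow> AE \<omega> in \<Omega>.
      nn_cond_exp \<Omega> (sample_filtration \<Omega> S \<zeta> (k - 1))
        (\<lambda>\<omega>. ennreal ((norm (G k \<omega> - gradient f (X k \<omega>)))\<^sup>2)) \<omega> \<le> ennreal (\<sigma>F\<^sup>2)"
    and noise_op: "\<And>k. k \<in> {1..K} \<Longrightarrow> AE \<omega> in \<Omega>.
      nn_cond_exp \<Omega> (sample_filtration \<Omega> S \<zeta> (k - 1))
        (\<lambda>\<omega>. ennreal ((spectral_norm (G k \<omega> - gradient f (X k \<omega>)))\<^sup>2)) \<omega> \<le> ennreal (\<sigma>op\<^sup>2)"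
    and theta: "0 \<le> \<theta>" "\<theta> < 1" and beta: "0 \<le> \<beta>" "\<beta> < 1"
    and eps: "\<epsilon> = \<sigma>op\<^sup>2"
    and eta: "\<eta> = (1 - \<theta>) * \<sigma>op / (2 * L)"
begin

abbreviation F :: "nat \<Rightarrow> 'w measure" where
  "F k \<equiv> sample_filtration \<Omega> S \<zeta> k"

text \<open>
  Steps are indexed from \<open>0\<close>: the step with index \<open>k\<close> leads from \<open>X (Suc k)\<close> to \<open>X (Suc (Suc k))\<close>
  and uses the rotations \<open>P k\<close>, \<open>Q k\<close>; everything known before it is \<open>F k\<close>-measurable.
\<close>

definition grad :: "nat \<Rightarrow> 'w \<Rightarrow> real^'n^'m" where
  "grad k \<omega> = gradient f (X (Suc k) \<omega>)"

definition noise :: "nat \<Rightarrow> 'w \<Rightarrow> real^'n^'m" where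
  "noise k \<omega> = G (Suc k) \<omega> - grad k \<omega>"

definition rot :: "nat \<Rightarrow> 'w \<Rightarrow> real^'n^'m \<Rightarrow> real^'n^'m" where
  "rot k \<omega> A = transpose (P k \<omega>) ** A ** Q k \<omega>"

definition scale :: "nat \<Rightarrow> 'w \<Rightarrow> real^'n^'m" where
  "scale k \<omega> = entry_sqrt (entry_add (V (Suc k) \<omega>) \<epsilon>)"

definition dir :: "nat \<Rightarrow> 'w \<Rightarrow> real^'n^'m" where
  "dir k \<omega> = entry_divide (rot k \<omega> (Mo (Suc k) \<omega>)) (scale k \<omega>)"

lemma sample_measurable: "k \<in> {1..K} \<Longrightarrow> \<zeta> k \<in> \<Omega> \<rightarrow>\<^sub>M S"
  using run unfolding generalized_soap_def by blast

lemma g_measurable: "(\<lambda>(x, z). g x z) \<in> borel \<Otimes>\<^sub>M S \<rightarrow>\<^sub>M borel"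
  using run unfolding generalized_soap_def by blast

lemma init:
  assumes "\<omega> \<in> space \<Omega>"
  shows "X (Suc 0) \<omega> = X1" "Mo 0 \<omega> = 0" "V 0 \<omega> = 0" "P 0 \<omega> = P0" "Q 0 \<omega> = Q0"
  using run assms unfolding generalized_soap_def One_nat_def by blast+

lemma step:
  assumes "k < K" "\<omega> \<in> space \<Omega>"
  shows "G (Suc k) \<omega> = g (X (Suc k) \<omega>) (\<zeta> (Suc k) \<omega>)"
    and "Mo (Suc k) \<omega> = \<theta> *\<^sub>R Mo k \<omega> + (1 - \<theta>) *\<^sub>R G (Suc k) \<omega>"
    and "V (Suc k) \<omega> = \<beta> *\<^sub>R V k \<omega> + (1 - \<beta>) *\<^sub>R entry_square (rot k \<omega> (G (Suc k) \<omega>))"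
    and "X (Suc (Suc k)) \<omega> = X (Suc k) \<omega> - \<eta> *\<^sub>R (P k \<omega> ** dir k \<omega> ** transpose (Q k \<omega>))"
proof -
  have "Suc k \<in> {1..K}" using assms by simp
  then have *: "G (Suc k) \<omega> = g (X (Suc k) \<omega>) (\<zeta> (Suc k) \<omega>) \<and>
    Mo (Suc k) \<omega> = \<theta> *\<^sub>R Mo (Suc k - 1) \<omega> + (1 - \<theta>) *\<^sub>R G (Suc k) \<omega> \<and>
        (let G' = transpose (P (Suc k - 1) \<omega>) ** G (Suc k) \<omega> ** Q (Suc k - 1) \<omega>;
             M' = transpose (P (Suc k - 1) \<omega>) ** Mo (Suc k) \<omega> ** Q (Suc k - 1) \<omega>
         in V (Suc k) \<omega> = \<beta> *\<^sub>R V (Suc k - 1) \<omega> + (1 - \<beta>) *\<^sub>R entry_square G' \<and>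
            X (Suc k + 1) \<omega> = X (Suc k) \<omega> - \<eta> *\<^sub>R
              (P (Suc k - 1) \<omega> ** entry_divide M' (entry_sqrt (entry_add (V (Suc k) \<omega>) \<epsilon>))
                 ** transpose (Q (Suc k - 1) \<omega>)))"
    using run assms(2) unfolding generalized_soap_def by blast
  show "G (Suc k) \<omega> = g (X (Suc k) \<omega>) (\<zeta> (Suc k) \<omega>)"
    and "Mo (Suc k) \<omega> = \<theta> *\<^sub>R Mo k \<omega> + (1 - \<theta>) *\<^sub>R G (Suc k) \<omega>"
    and "V (Suc k) \<omega> = \<beta> *\<^sub>R V k \<omega> + (1 - \<beta>) *\<^sub>R entry_square (rot k \<omega> (G (Suc k) \<omega>))"
    and "X (Suc (Suc k)) \<omega> = X (Suc k) \<omega> - \<eta> *\<^sub>R (P k \<omega> ** dir k \<omega> ** transpose (Q k \<omega>))"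
    using * by (simp_all add: rot_def dir_def scale_def Let_def)
qed

lemma orth:
  assumes "k \<le> K" "\<omega> \<in> space \<Omega>"
  shows "orthogonal_matrix (P k \<omega>)" "orthogonal_matrix (Q k \<omega>)"
proof -
  have "orthogonal_matrix P0 \<and> orthogonal_matrix Q0"
    using run unfolding generalized_soap_def by blast
  moreover have "orthogonal_matrix (P k \<omega>) \<and> orthogonal_matrix (Q k \<omega>)" if "k \<noteq> 0"
  proof -
    have "k \<in> {1..K}" using assms that by simp
    then show ?thesis using run assms(2) unfolding generalized_soap_def by blast
  qed
  ultimately show "orthogonal_matrix (P k \<omega>)" "orthogonal_matrix (Q k \<omega>)"
    using init[OF assms(2)] by (cases "k = 0"; simp)+
qed

lemma subalg: "k \<le> K \<Longrightarrow> subalgebra \<Omega> (F k)"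
  by (rule subalgebra_sample_filtration) (auto intro: sample_measurable)

lemma sigma_finite_subalg: "k \<le> K \<Longrightarrow> sigma_finite_subalgebra \<Omega> (F k)"
  by (intro finite_measure_subalgebra_is_sigma_finite finite_measure_subalgebra.intro
      finite_measure_axioms finite_measure_subalgebra_axioms.intro subalg)

lemma continuous_gradient: "continuous_on UNIV (gradient f)"
proof (rule lipschitz_on_continuous_on)
  show "L-lipschitz_on UNIV (gradient f)"
    using smooth L_pos by (auto intro!: lipschitz_onI simp: dist_norm)
qed

text \<open>The five sequences feed each other and need a joint induction. \<open>X\<close> runs one
  index ahead because \<open>X (Suc k)\<close> is fixed by the first \<open>k\<close> samples; the
  next sample enters through the joint measurability of \<open>g\<close>.\<close>

lemma adapted:
  assumes "k \<le> K"
  shows "X (Suc k) \<in> borel_measurable (F k) \<and> Mo k \<in> borel_measurable (F k) \<and>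
    V k \<in> borel_measurable (F k) \<and> P k \<in> borel_measurable (F k) \<and> Q k \<in> borel_measurable (F k)"
  using assms
proof (induction k)
  case 0
  \<comment> \<open>\<open>F 0\<close> is trivial, so measurability of the initial values rests on
    their being deterministic.\<close>
  have const: "h \<in> borel_measurable (F 0)" if "\<And>\<omega>. \<omega> \<in> space \<Omega> \<Longrightarrow> h \<omega> = c"
    for h :: "'w \<Rightarrow> 'c::topological_space" and c
    using that by (subst measurable_cong[of _ h "\<lambda>_. c"]) auto
  show ?case using init by (auto intro!: const)
next
  case (Suc k)
  then have k: "k < K" by simp
  let ?N = "F (Suc k)"
  have up: "h \<in> borel_measurable (F k) \<Longrightarrow> h \<in> borel_measurable ?N" for h :: "'w \<Rightarrow> 'c::topological_space"
    by (rule measurable_from_subalg[OF subalgebra_sample_filtration_Suc])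
  have X: "X (Suc k) \<in> borel_measurable ?N" and Mo: "Mo k \<in> borel_measurable ?N"
    and V: "V k \<in> borel_measurable ?N" and P: "P k \<in> borel_measurable ?N" and Q: "Q k \<in> borel_measurable ?N"
    using Suc by (auto intro: up)
  have "\<zeta> (Suc k) \<in> ?N \<rightarrow>\<^sub>M S"
    by (rule measurable_sample) (use sample_measurable k in auto)
  then have "(\<lambda>\<omega>. g (X (Suc k) \<omega>) (\<zeta> (Suc k) \<omega>)) \<in> borel_measurable ?N"
    using measurable_compose[OF measurable_Pair[OF X] g_measurable] by simp
  then have G: "G (Suc k) \<in> borel_measurable ?N"
    using step(1)[OF k] by (subst measurable_cong) auto
  have "(\<lambda>\<omega>. \<theta> *\<^sub>R Mo k \<omega> + (1 - \<theta>) *\<^sub>R G (Suc k) \<omega>) \<in> borel_measurable ?N"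
    by (intro borel_measurable_add borel_measurable_scaleR borel_measurable_const Mo G)
  then have Mo': "Mo (Suc k) \<in> borel_measurable ?N"
    using step(2)[OF k] by (subst measurable_cong) auto
  have "(\<lambda>\<omega>. \<beta> *\<^sub>R V k \<omega> + (1 - \<beta>) *\<^sub>R entry_square (rot k \<omega> (G (Suc k) \<omega>))) \<in> borel_measurable ?N"
    unfolding rot_def
    by (intro borel_measurable_add borel_measurable_scaleR borel_measurable_const
        borel_measurable_matrix_intros V G P Q)
  then have V': "V (Suc k) \<in> borel_measurable ?N"
    using step(3)[OF k] by (subst measurable_cong) auto
  have "(\<lambda>\<omega>. X (Suc k) \<omega> - \<eta> *\<^sub>R (P k \<omega> ** dir k \<omega> ** transpose (Q k \<omega>))) \<in> borel_measurable ?N"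
    unfolding rot_def dir_def scale_def
    by (intro borel_measurable_diff borel_measurable_scaleR borel_measurable_const
        borel_measurable_matrix_intros X V' Mo' P Q)
  then have X': "X (Suc (Suc k)) \<in> borel_measurable ?N"
    using step(4)[OF k] by (subst measurable_cong) auto
  have "Suc k \<in> {1..K}" using k by simp
  then have "P (Suc k) \<in> borel_measurable ?N" "Q (Suc k) \<in> borel_measurable ?N"
    using run unfolding generalized_soap_def by blast+
  with X' Mo' V' show ?case by blast
qed

lemmas X_adapted = adapted[THEN conjunct1]
  and Mo_adapted = adapted[THEN conjunct2, THEN conjunct1]
  and V_adapted = adapted[THEN conjunct2, THEN conjunct2, THEN conjunct1]
  and P_adapted = adapted[THEN conjunct2, THEN conjunct2, THEN conjunct2, THEN conjunct1]
  and Q_adapted = adapted[THEN conjunct2, THEN conjunct2, THEN conjunct2, THEN conjunct2]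

lemma measurable_from_F: "k \<le> K \<Longrightarrow> h \<in> borel_measurable (F k) \<Longrightarrow> h \<in> borel_measurable \<Omega>"
  by (rule measurable_from_subalg[OF subalg])

lemma grad_adapted: "k \<le> K \<Longrightarrow> grad k \<in> borel_measurable (F k)"
  unfolding grad_def[abs_def]
  by (rule measurable_compose[OF X_adapted borel_measurable_continuous_onI[OF continuous_gradient]])

lemma G_measurable:
  assumes "k < K"
  shows "G (Suc k) \<in> borel_measurable \<Omega>"
proof -
  have "X (Suc k) \<in> borel_measurable \<Omega>"
    using measurable_from_F[OF _ X_adapted] assms by simp
  moreover have "\<zeta> (Suc k) \<in> \<Omega> \<rightarrow>\<^sub>M S" using assms by (intro sample_measurable) simp
  ultimately have "(\<lambda>\<omega>. g (X (Suc k) \<omega>) (\<zeta> (Suc k) \<omega>)) \<in> borel_measurable \<Omega>"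
    using measurable_compose[OF measurable_Pair g_measurable] by simp
  then show ?thesis using step(1)[OF assms] by (subst measurable_cong) auto
qed

lemma noise_measurable: "k < K \<Longrightarrow> noise k \<in> borel_measurable \<Omega>"
  unfolding noise_def[abs_def]
  by (intro borel_measurable_diff G_measurable measurable_from_F[OF _ grad_adapted]) auto

lemma rot_measurable:
  assumes "k \<le> K" "A \<in> borel_measurable \<Omega>"
  shows "(\<lambda>\<omega>. rot k \<omega> (A \<omega>)) \<in> borel_measurable \<Omega>"
  unfolding rot_def using assms
  by (intro borel_measurable_matrix_intros measurable_from_F[OF _ P_adapted] measurable_from_F[OF _ Q_adapted])

lemma rot_adapted:
  assumes "k \<le> K" "A \<in> borel_measurable (F k)"
  shows "(\<lambda>\<omega>. rot k \<omega> (A \<omega>)) \<in> borel_measurable (F k)"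
  unfolding rot_def using assms
  by (intro borel_measurable_matrix_intros P_adapted Q_adapted)

lemma rot_diff: "rot k \<omega> (A - B) = rot k \<omega> A - rot k \<omega> B"
  by (simp add: rot_def matrix_matrix_mult_def vec_eq_iff algebra_simps sum_subtractf sum_distrib_left)

lemma rot_inner:
  assumes "k \<le> K" "\<omega> \<in> space \<Omega>"
  shows "rot k \<omega> A \<bullet> rot k \<omega> B = A \<bullet> B"
  unfolding rot_def using orth[OF assms] by (intro inner_orthogonal_conj) auto

lemma norm_rot:
  assumes "k \<le> K" "\<omega> \<in> space \<Omega>"
  shows "norm (rot k \<omega> A) = norm A"
  using rot_inner[OF assms, of A A] by (simp add: norm_eq_sqrt_inner)

lemma rot_back:
  assumes "k \<le> K" "\<omega> \<in> space \<Omega>"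
  shows "rot k \<omega> (P k \<omega> ** B ** transpose (Q k \<omega>)) = B"
proof -
  have "rot k \<omega> (P k \<omega> ** B ** transpose (Q k \<omega>))
      = (transpose (P k \<omega>) ** P k \<omega>) ** B ** (transpose (Q k \<omega>) ** Q k \<omega>)"
    by (simp add: rot_def matrix_mul_assoc)
  then show ?thesis using orth[OF assms] by (simp add: orthogonal_matrix_def)
qed

section \<open>The entrywise scale and the descent inequality\<close>

lemma V_nonneg:
  assumes "k \<le> K" "\<omega> \<in> space \<Omega>"
  shows "0 \<le> V k \<omega> $ i $ j"
  using assms(1)
proof (induction k)
  case 0
  then show ?case using init[OF assms(2)] by simp
next
  case (Suc k)
  then show ?case
    using step(3)[of k, OF _ assms(2)] beta by (simp add: entry_square_def)
qed

lemma scale_entry: "scale k \<omega> $ i $ j = sqrt (V (Suc k) \<omega> $ i $ j + \<epsilon>)"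
  by (simp add: scale_def entry_sqrt_def entry_add_def)

lemma scale_ge:
  assumes "k < K" "\<omega> \<in> space \<Omega>"
  shows "\<sigma>op \<le> scale k \<omega> $ i $ j"
proof -
  have "\<sigma>op = sqrt \<epsilon>" using sop_pos by (simp add: eps)
  also have "\<dots> \<le> scale k \<omega> $ i $ j"
    unfolding scale_entry using V_nonneg[of "Suc k" \<omega> i j] assms by simp
  finally show ?thesis .
qed

lemma scale_pos: "k < K \<Longrightarrow> \<omega> \<in> space \<Omega> \<Longrightarrow> 0 < scale k \<omega> $ i $ j"
  using scale_ge[of k \<omega> i j] sop_pos by linarith

lemma scale_measurable: "k < K \<Longrightarrow> scale k \<in> borel_measurable \<Omega>"
  unfolding scale_def[abs_def]
  by (intro borel_measurable_matrix_intros measurable_from_F[OF _ V_adapted]) auto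

lemma dir_entry: "dir k \<omega> $ i $ j = rot k \<omega> (Mo (Suc k) \<omega>) $ i $ j / scale k \<omega> $ i $ j"
  by (simp add: dir_def entry_divide_def)

definition weighted_sq :: "nat \<Rightarrow> 'w \<Rightarrow> real^'n^'m \<Rightarrow> real" where
  "weighted_sq k \<omega> A = (\<Sum>i\<in>UNIV. \<Sum>j\<in>UNIV. (rot k \<omega> A $ i $ j)\<^sup>2 / scale k \<omega> $ i $ j)"

lemma weighted_sq_nonneg: "k < K \<Longrightarrow> \<omega> \<in> space \<Omega> \<Longrightarrow> 0 \<le> weighted_sq k \<omega> A"
  unfolding weighted_sq_def by (intro sum_nonneg divide_nonneg_pos scale_pos) auto

lemma weighted_sq_le:
  assumes "k < K" "\<omega> \<in> space \<Omega>"
  shows "weighted_sq k \<omega> A \<le> (norm A)\<^sup>2 / \<sigma>op"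
proof -
  have "weighted_sq k \<omega> A \<le> (\<Sum>i\<in>UNIV. \<Sum>j\<in>UNIV. (rot k \<omega> A $ i $ j)\<^sup>2 / \<sigma>op)"
    unfolding weighted_sq_def
    using scale_ge[OF assms] sop_pos scale_pos[OF assms]
    by (intro sum_mono divide_left_mono) auto
  also have "\<dots> = (norm (rot k \<omega> A))\<^sup>2 / \<sigma>op"
    by (simp add: norm_matrix_sq sum_divide_distrib)
  finally show ?thesis using norm_rot[of k \<omega> A] assms by simp
qed

text \<open>Only one of the two factors \<open>1 / s\<close> is estimated by
  \<open>1 / \<sigma>op\<close>. The other is kept, so that the drift is expressed in the quantity
  that appears negatively in \<open>descent\<close>.\<close>

lemma norm_dir_le:
  assumes "k < K" "\<omega> \<in> space \<Omega>"
  shows "(norm (dir k \<omega>))\<^sup>2 \<le> weighted_sq k \<omega> (Mo (Suc k) \<omega>) / \<sigma>op"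
proof -
  have "(dir k \<omega> $ i $ j)\<^sup>2 \<le> (rot k \<omega> (Mo (Suc k) \<omega>) $ i $ j)\<^sup>2 / scale k \<omega> $ i $ j / \<sigma>op" for i j
  proof -
    have "(dir k \<omega> $ i $ j)\<^sup>2 = (rot k \<omega> (Mo (Suc k) \<omega>) $ i $ j)\<^sup>2 / scale k \<omega> $ i $ j / scale k \<omega> $ i $ j"
      by (simp add: dir_entry power2_eq_square)
    also have "\<dots> \<le> (rot k \<omega> (Mo (Suc k) \<omega>) $ i $ j)\<^sup>2 / scale k \<omega> $ i $ j / \<sigma>op"
      using scale_ge[OF assms, of i j] sop_pos scale_pos[OF assms, of i j]
      by (intro divide_left_mono divide_nonneg_pos) auto
    finally show ?thesis .
  qed
  then show ?thesis
    unfolding norm_matrix_sq weighted_sq_def sum_divide_distrib by (intro sum_mono)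
qed

lemma norm_step:
  assumes "k < K" "\<omega> \<in> space \<Omega>"
  shows "norm (X (Suc (Suc k)) \<omega> - X (Suc k) \<omega>) = \<bar>\<eta>\<bar> * norm (dir k \<omega>)"
  using norm_rot[of k \<omega> "P k \<omega> ** dir k \<omega> ** transpose (Q k \<omega>)"] rot_back[of k \<omega> "dir k \<omega>"] assms
  by (simp add: step(4))

lemma eta_nonneg: "0 \<le> \<eta>"
  using eta theta L_pos sop_pos by simp

lemma L_eta: "L * \<eta> = (1 - \<theta>) * \<sigma>op / 2"
  using eta L_pos by simp

lemma descent:
  assumes "k < K" "\<omega> \<in> space \<Omega>"
  shows "f (X (Suc (Suc k)) \<omega>) \<le> f (X (Suc k) \<omega>) - \<eta> / 2 * weighted_sq k \<omega> (grad k \<omega>)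
    - \<eta> / 4 * weighted_sq k \<omega> (Mo (Suc k) \<omega>)
    + \<eta> / (2 * \<sigma>op) * (norm (Mo (Suc k) \<omega> - grad k \<omega>))\<^sup>2"
proof -
  define x where "x i j = rot k \<omega> (grad k \<omega>) $ i $ j" for i j
  define m where "m i j = rot k \<omega> (Mo (Suc k) \<omega>) $ i $ j" for i j
  define s where "s i j = scale k \<omega> $ i $ j" for i j
  define R where "R = P k \<omega> ** dir k \<omega> ** transpose (Q k \<omega>)"
  have R: "rot k \<omega> R = dir k \<omega>" using assms by (simp add: R_def rot_back)
  have gR: "grad k \<omega> \<bullet> R = (\<Sum>i\<in>UNIV. \<Sum>j\<in>UNIV. x i j * (m i j / s i j))"
    using rot_inner[of k \<omega> "grad k \<omega>" R] assms
    by (simp add: R inner_matrix_def dir_entry x_def m_def s_def)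
  have nR: "(norm R)\<^sup>2 = (\<Sum>i\<in>UNIV. \<Sum>j\<in>UNIV. (m i j / s i j)\<^sup>2)"
    using norm_rot[of k \<omega> R] assms by (simp add: R norm_matrix_sq[symmetric] m_def s_def flip: dir_entry)
  have "f (X (Suc (Suc k)) \<omega>) \<le> f (X (Suc k) \<omega>) + grad k \<omega> \<bullet> (- \<eta> *\<^sub>R R) + L / 2 * (norm (- \<eta> *\<^sub>R R))\<^sup>2"
    using gradient_descent_lemma[of f L "X (Suc (Suc k)) \<omega>" "X (Suc k) \<omega>", OF diff smooth] step(4)[OF assms]
    by (simp add: grad_def R_def)
  also have "\<dots> = f (X (Suc k) \<omega>) + (\<Sum>i\<in>UNIV. \<Sum>j\<in>UNIV.
      - \<eta> * (x i j * (m i j / s i j)) + L / 2 * \<eta>\<^sup>2 * (m i j / s i j)\<^sup>2)"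
    by (simp add: power_mult_distrib gR nR sum.distrib sum_distrib_left sum_negf sum_subtractf mult_ac)
  also have "\<dots> \<le> f (X (Suc k) \<omega>) + (\<Sum>i\<in>UNIV. \<Sum>j\<in>UNIV.
      - (\<eta> / 2) * ((x i j)\<^sup>2 / s i j) - \<eta> / 4 * ((m i j)\<^sup>2 / s i j) + \<eta> / (2 * \<sigma>op) * (x i j - m i j)\<^sup>2)"
  proof (intro add_left_mono sum_mono preconditioned_step_le)
    show "L * \<eta> \<le> \<sigma>op / 2"
      unfolding L_eta using theta sop_pos by (simp add: field_simps)
  qed (use sop_pos scale_ge[OF assms] eta_nonneg L_pos in \<open>auto simp: s_def\<close>)
  also have "\<dots> = f (X (Suc k) \<omega>) - \<eta> / 2 * weighted_sq k \<omega> (grad k \<omega>)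
    - \<eta> / 4 * weighted_sq k \<omega> (Mo (Suc k) \<omega>)
    + \<eta> / (2 * \<sigma>op) * (\<Sum>i\<in>UNIV. \<Sum>j\<in>UNIV. (x i j - m i j)\<^sup>2)"
    unfolding weighted_sq_def x_def[symmetric] m_def[symmetric] s_def[symmetric]
    by (simp only: sum.distrib sum_subtractf sum_distrib_left[symmetric])
  also have "(\<Sum>i\<in>UNIV. \<Sum>j\<in>UNIV. (x i j - m i j)\<^sup>2) = (norm (rot k \<omega> (grad k \<omega> - Mo (Suc k) \<omega>)))\<^sup>2"
    by (simp add: rot_diff norm_matrix_sq x_def m_def)
  also have "\<dots> = (norm (Mo (Suc k) \<omega> - grad k \<omega>))\<^sup>2"
    using norm_rot assms by (simp add: norm_minus_commute)
  finally show ?thesis .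
qed

lemma descent_sum:
  assumes "\<omega> \<in> space \<Omega>" "n \<le> K"
  shows "(\<Sum>k<n. \<eta> / 2 * weighted_sq k \<omega> (grad k \<omega>) + \<eta> / 4 * weighted_sq k \<omega> (Mo (Suc k) \<omega>)
    - \<eta> / (2 * \<sigma>op) * (norm (Mo (Suc k) \<omega> - grad k \<omega>))\<^sup>2) \<le> f X1 - f (X (Suc n) \<omega>)"
  using assms(2)
proof (induction n)
  case 0
  then show ?case using init[OF assms(1)] by simp
next
  case (Suc n)
  then show ?case using descent[of n \<omega>] assms(1) by simp
qed

text \<open>The constant weight 1 turns the conditional variance bound into a total one and at the
  same time supplies integrability.\<close>

lemma noise_sq:
  assumes "k < K"
  shows "square_integrable \<Omega> (noise k)" "(\<integral>\<omega>. (norm (noise k \<omega>))\<^sup>2 \<partial>\<Omega>) \<le> \<sigma>F\<^sup>2"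
proof -
  note [measurable] = noise_measurable[OF assms]
  have "AE \<omega> in \<Omega>. nn_cond_exp \<Omega> (F k) (\<lambda>\<omega>. ennreal ((norm (noise k \<omega>))\<^sup>2)) \<omega> \<le> ennreal (\<sigma>F\<^sup>2)"
    using noise_F[of "Suc k"] assms by (simp add: noise_def grad_def)
  note * = nn_cond_exp_bound_integral[OF sigma_finite_subalg finite_measure_axioms _ _ _ _ _ this,
      of "\<lambda>_. 1" 1]
  have "integrable \<Omega> (\<lambda>\<omega>. 1 * (norm (noise k \<omega>))\<^sup>2)"
    by (rule *(1)) (use assms in auto)
  then show "square_integrable \<Omega> (noise k)"
    by (simp add: square_integrable_def)
  have "(\<integral>\<omega>. 1 * (norm (noise k \<omega>))\<^sup>2 \<partial>\<Omega>) \<le> \<sigma>F\<^sup>2 * (\<integral>\<omega>. 1 \<partial>\<Omega>)"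
    by (rule *(2)) (use assms in auto)
  then show "(\<integral>\<omega>. (norm (noise k \<omega>))\<^sup>2 \<partial>\<Omega>) \<le> \<sigma>F\<^sup>2"
    by (simp add: prob_space)
qed

lemma norm_grad_diff_le:
  assumes "k < K" "\<omega> \<in> space \<Omega>"
  shows "norm (grad (Suc k) \<omega> - grad k \<omega>) \<le> L * \<eta> * norm (dir k \<omega>)"
  using smooth[of "X (Suc (Suc k)) \<omega>" "X (Suc k) \<omega>"] norm_step[OF assms] eta_nonneg
  by (simp add: grad_def mult.assoc)

text \<open>The first gradient is deterministic, the noise is square-integrable, and a step changes
  the gradient by at most a multiple of the momentum. The two claims need each other because the
  sample gradient is gradient plus noise.\<close>

lemma square_integrable_Mo_grad:
  assumes "k \<le> K"
  shows "square_integrable \<Omega> (Mo k) \<and> square_integrable \<Omega> (grad k)"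
  using assms
proof (induction k)
  case 0
  have "square_integrable \<Omega> (Mo 0)"
    by (rule square_integrable_bounded[of _ 0]) (auto simp: init measurable_from_F[OF _ Mo_adapted])
  moreover have "square_integrable \<Omega> (grad 0)"
    by (rule square_integrable_bounded[of _ "norm (gradient f X1)"])
      (auto simp: grad_def init measurable_from_F[OF _ grad_adapted])
  ultimately show ?case ..
next
  case (Suc k)
  then have k: "k < K" and Mo: "square_integrable \<Omega> (Mo k)" and gr: "square_integrable \<Omega> (grad k)"
    by auto
  have "square_integrable \<Omega> (\<lambda>\<omega>. \<theta> *\<^sub>R Mo k \<omega> + (1 - \<theta>) *\<^sub>R (grad k \<omega> + noise k \<omega>))"
    by (intro square_integrable_add square_integrable_scaleR Mo gr noise_sq k)
  then have Mo': "square_integrable \<Omega> (Mo (Suc k))"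
    by (rule square_integrable_cong[THEN iffD1, rotated]) (simp add: step(2)[OF k] noise_def)
  have "square_integrable \<Omega> (\<lambda>\<omega>. grad (Suc k) \<omega> - grad k \<omega>)"
  \<comment> \<open>The Lipschitz factor \<open>L * \<eta>\<close> times the bound
    \<open>1 / \<sigma>op\<close> for the preconditioner.\<close>
  proof (rule square_integrable_bound[OF Mo', of _ "L * \<eta> / \<sigma>op"])
    show "(\<lambda>\<omega>. grad (Suc k) \<omega> - grad k \<omega>) \<in> borel_measurable \<Omega>"
      using Suc.prems by (intro borel_measurable_diff measurable_from_F[OF _ grad_adapted]) auto
    fix \<omega> assume \<omega>: "\<omega> \<in> space \<Omega>"
    have "(norm (dir k \<omega>))\<^sup>2 \<le> (norm (Mo (Suc k) \<omega>))\<^sup>2 / \<sigma>op / \<sigma>op"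
      using norm_dir_le[OF k \<omega>] weighted_sq_le[OF k \<omega>, of "Mo (Suc k) \<omega>"] sop_pos
      by (smt (verit) divide_right_mono)
    also have "\<dots> = (norm (Mo (Suc k) \<omega>) / \<sigma>op)\<^sup>2" by (simp add: power2_eq_square)
    finally have "norm (dir k \<omega>) \<le> norm (Mo (Suc k) \<omega>) / \<sigma>op"
      using sop_pos by (auto intro: power2_le_imp_le)
    then have "L * \<eta> * norm (dir k \<omega>) \<le> L * \<eta> * (norm (Mo (Suc k) \<omega>) / \<sigma>op)"
      using L_pos eta_nonneg by (intro mult_left_mono) auto
    then show "norm (grad (Suc k) \<omega> - grad k \<omega>) \<le> L * \<eta> / \<sigma>op * norm (Mo (Suc k) \<omega>)"
      using norm_grad_diff_le[OF k \<omega>] by simp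
  qed
  from square_integrable_add[OF gr this] Mo' show ?case by simp
qed

lemmas Mo_sq = square_integrable_Mo_grad[THEN conjunct1]
  and grad_sq = square_integrable_Mo_grad[THEN conjunct2]

lemma noise_orthogonal:
  assumes "k < K" "Y \<in> borel_measurable (F k)" "square_integrable \<Omega> Y"
  shows "(\<integral>\<omega>. Y \<omega> \<bullet> noise k \<omega> \<partial>\<Omega>) = 0"
proof -
  have "square_integrable \<Omega> (\<lambda>\<omega>. grad k \<omega> + noise k \<omega>)"
    using assms by (intro square_integrable_add noise_sq grad_sq) auto
  then have "square_integrable \<Omega> (G (Suc k))" by (simp add: noise_def)
  moreover have "AE \<omega> in \<Omega>. matrix_cond_exp \<Omega> (F k) (G (Suc k)) \<omega> = grad k \<omega>"
    using unbiased[of "Suc k"] assms by (simp add: grad_def)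
  ultimately show ?thesis
    unfolding noise_def
    using assms by (intro expectation_inner_cond_exp[OF sigma_finite_subalg]) (auto intro: grad_sq)
qed

lemma weighted_sq_integrable:
  assumes "k < K" "square_integrable \<Omega> A"
  shows "integrable \<Omega> (\<lambda>\<omega>. weighted_sq k \<omega> (A \<omega>))"
proof (rule Bochner_Integration.integrable_bound)
  show "integrable \<Omega> (\<lambda>\<omega>. (norm (A \<omega>))\<^sup>2 / \<sigma>op)"
    using assms by (simp add: square_integrable_def)
  show "(\<lambda>\<omega>. weighted_sq k \<omega> (A \<omega>)) \<in> borel_measurable \<Omega>"
    unfolding weighted_sq_def
    using rot_measurable[of k A] scale_measurable[of k] assms
    by (auto intro!: borel_measurable_sum borel_measurable_divide borel_measurable_power
        borel_measurable_matrix_entry simp: square_integrable_def)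
  show "AE \<omega> in \<Omega>. norm (weighted_sq k \<omega> (A \<omega>)) \<le> norm ((norm (A \<omega>))\<^sup>2 / \<sigma>op)"
    using weighted_sq_le weighted_sq_nonneg assms sop_pos by (intro AE_I2) auto
qed

section \<open>Contraction of the momentum error\<close>

definition momentum_error :: "nat \<Rightarrow> real" where
  "momentum_error k = (\<integral>\<omega>. (norm (Mo (Suc k) \<omega> - grad k \<omega>))\<^sup>2 \<partial>\<Omega>)"

text \<open>The new error is \<open>\<theta>\<close> times the old momentum's distance to the
  current gradient plus \<open>1 - \<theta>\<close> times the noise. The cross term has mean zero,
  which gives the full factor \<open>\<theta>\<^sup>2\<close>.\<close>

lemma momentum_error_le:
  assumes "k < K"
  shows "momentum_error k \<le> \<theta>\<^sup>2 * (\<integral>\<omega>. (norm (Mo k \<omega> - grad k \<omega>))\<^sup>2 \<partial>\<Omega>) + (1 - \<theta>)\<^sup>2 * \<sigma>F\<^sup>2"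
proof -
  define Y where "Y \<omega> = Mo k \<omega> - grad k \<omega>" for \<omega>
  have Y: "square_integrable \<Omega> Y" "Y \<in> borel_measurable (F k)"
    unfolding Y_def[abs_def] using assms
    by (auto intro!: square_integrable_diff Mo_sq grad_sq borel_measurable_diff Mo_adapted grad_adapted)
  have "(norm (Mo (Suc k) \<omega> - grad k \<omega>))\<^sup>2
      = \<theta>\<^sup>2 * (norm (Y \<omega>))\<^sup>2 + 2 * \<theta> * (1 - \<theta>) * (Y \<omega> \<bullet> noise k \<omega>) + (1 - \<theta>)\<^sup>2 * (norm (noise k \<omega>))\<^sup>2"
    if "\<omega> \<in> space \<Omega>" for \<omega>
  proof -
    have eq: "Mo (Suc k) \<omega> - grad k \<omega> = \<theta> *\<^sub>R Y \<omega> + (1 - \<theta>) *\<^sub>R noise k \<omega>"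
      using step(2)[OF assms that] by (simp add: Y_def noise_def algebra_simps)
    have "(norm (\<theta> *\<^sub>R Y \<omega> + c *\<^sub>R noise k \<omega>))\<^sup>2
        = \<theta>\<^sup>2 * (norm (Y \<omega>))\<^sup>2 + 2 * \<theta> * c * (Y \<omega> \<bullet> noise k \<omega>) + c\<^sup>2 * (norm (noise k \<omega>))\<^sup>2" for c
      unfolding power2_norm_eq_inner
      by (simp add: inner_add_left inner_add_right inner_commute[of "noise k \<omega>" "Y \<omega>"] power2_eq_square algebra_simps)
    from this[of "1 - \<theta>"] show ?thesis unfolding eq .
  qed
  then have "momentum_error k = (\<integral>\<omega>. \<theta>\<^sup>2 * (norm (Y \<omega>))\<^sup>2 + 2 * \<theta> * (1 - \<theta>) * (Y \<omega> \<bullet> noise k \<omega>)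
      + (1 - \<theta>)\<^sup>2 * (norm (noise k \<omega>))\<^sup>2 \<partial>\<Omega>)"
    unfolding momentum_error_def by (intro Bochner_Integration.integral_cong) auto
  also have "\<dots> = \<theta>\<^sup>2 * (\<integral>\<omega>. (norm (Y \<omega>))\<^sup>2 \<partial>\<Omega>) + 2 * \<theta> * (1 - \<theta>) * (\<integral>\<omega>. Y \<omega> \<bullet> noise k \<omega> \<partial>\<Omega>)
      + (1 - \<theta>)\<^sup>2 * (\<integral>\<omega>. (norm (noise k \<omega>))\<^sup>2 \<partial>\<Omega>)"
    using square_integrable_integrable[OF Y(1)] square_integrable_integrable[OF noise_sq(1)[OF assms]]
      square_integrable_inner[OF Y(1) noise_sq(1)[OF assms]] by simp
  also have "(\<integral>\<omega>. Y \<omega> \<bullet> noise k \<omega> \<partial>\<Omega>) = 0"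
    by (rule noise_orthogonal[OF assms Y(2,1)])
  finally show ?thesis
    using mult_left_mono[OF noise_sq(2)[OF assms], of "(1 - \<theta>)\<^sup>2"] by (simp add: Y_def)
qed

text \<open>Since the momentum starts at zero, the initial error contains the whole gradient at
  \<open>X1\<close>, which smoothness bounds by the gap.\<close>

lemma momentum_error_0:
  assumes "0 < K"
  shows "momentum_error 0 \<le> 2 * L * (f X1 - fstar) + (1 - \<theta>)\<^sup>2 * \<sigma>F\<^sup>2"
proof -
  have "(\<integral>\<omega>. (norm (Mo 0 \<omega> - grad 0 \<omega>))\<^sup>2 \<partial>\<Omega>) = (\<integral>\<omega>. (norm (gradient f X1))\<^sup>2 \<partial>\<Omega>)"
    by (intro Bochner_Integration.integral_cong) (auto simp: init grad_def)
  also have "\<dots> = (norm (gradient f X1))\<^sup>2" by (simp add: prob_space)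
  finally have *: "(\<integral>\<omega>. (norm (Mo 0 \<omega> - grad 0 \<omega>))\<^sup>2 \<partial>\<Omega>) = (norm (gradient f X1))\<^sup>2" .
  have "\<theta>\<^sup>2 * (norm (gradient f X1))\<^sup>2 \<le> 1 * (norm (gradient f X1))\<^sup>2"
    using theta by (intro mult_right_mono) (auto intro: power_le_one)
  also have "\<dots> \<le> 2 * L * (f X1 - fstar)"
    using norm_gradient_le_gap[of f L fstar X1, OF diff smooth lower L_pos] by simp
  finally show ?thesis using momentum_error_le[OF assms] * by simp
qed

lemma momentum_error_Suc:
  assumes "Suc k < K"
  shows "momentum_error (Suc k) \<le> \<theta> * momentum_error k
    + (1 - \<theta>) * \<sigma>op / 4 * (\<integral>\<omega>. weighted_sq k \<omega> (Mo (Suc k) \<omega>) \<partial>\<Omega>) + (1 - \<theta>)\<^sup>2 * \<sigma>F\<^sup>2"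
proof -
  have k: "k < K" using assms by simp
  have Mo: "square_integrable \<Omega> (Mo (Suc k))" and gr: "square_integrable \<Omega> (grad k)"
    and gr': "square_integrable \<Omega> (grad (Suc k))"
    using assms by (auto intro: Mo_sq grad_sq)
  have int: "integrable \<Omega> (\<lambda>\<omega>. (norm (Mo (Suc k) \<omega> - grad k \<omega>))\<^sup>2)"
    "integrable \<Omega> (\<lambda>\<omega>. (norm (Mo (Suc k) \<omega> - grad (Suc k) \<omega>))\<^sup>2)"
    "integrable \<Omega> (\<lambda>\<omega>. weighted_sq k \<omega> (Mo (Suc k) \<omega>))"
    using square_integrable_integrable[OF square_integrable_diff[OF Mo gr]]
      square_integrable_integrable[OF square_integrable_diff[OF Mo gr']]
      weighted_sq_integrable[OF k Mo] by auto
  have "\<theta>\<^sup>2 * (\<integral>\<omega>. (norm (Mo (Suc k) \<omega> - grad (Suc k) \<omega>))\<^sup>2 \<partial>\<Omega>)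
      = (\<integral>\<omega>. \<theta>\<^sup>2 * (norm (Mo (Suc k) \<omega> - grad (Suc k) \<omega>))\<^sup>2 \<partial>\<Omega>)" by simp
  also have "\<dots> \<le> (\<integral>\<omega>. \<theta> * (norm (Mo (Suc k) \<omega> - grad k \<omega>))\<^sup>2
      + (1 - \<theta>) * \<sigma>op / 4 * weighted_sq k \<omega> (Mo (Suc k) \<omega>) \<partial>\<Omega>)"
  proof (rule integral_mono)
    fix \<omega> assume \<omega>: "\<omega> \<in> space \<Omega>"
    define x where "x = norm (Mo (Suc k) \<omega> - grad k \<omega>)"
    define y where "y = norm (grad (Suc k) \<omega> - grad k \<omega>)"
    define w where "w = weighted_sq k \<omega> (Mo (Suc k) \<omega>)"
    have "norm (Mo (Suc k) \<omega> - grad (Suc k) \<omega>) \<le> x + y"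
      unfolding x_def y_def using norm_triangle_ineq4[of "Mo (Suc k) \<omega> - grad k \<omega>" "grad (Suc k) \<omega> - grad k \<omega>"]
      by simp
    then have "\<theta>\<^sup>2 * (norm (Mo (Suc k) \<omega> - grad (Suc k) \<omega>))\<^sup>2 \<le> \<theta>\<^sup>2 * (x + y)\<^sup>2"
      by (intro mult_left_mono power_mono) auto
    also have "\<dots> \<le> \<theta> * x\<^sup>2 + \<theta>\<^sup>2 / (1 - \<theta>) * y\<^sup>2"
      using theta by (rule momentum_young)
    \<comment> \<open>Of the two factors \<open>1 - \<theta>\<close> in
      \<open>(L * \<eta>)\<^sup>2\<close> one cancels the Young factor and the other survives;
      \<open>\<theta>\<^sup>2\<close> is estimated by 1.\<close>
    also have "\<theta>\<^sup>2 / (1 - \<theta>) * y\<^sup>2 \<le> 1 / (1 - \<theta>) * (((1 - \<theta>) * \<sigma>op / 2)\<^sup>2 * (w / \<sigma>op))"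
    proof (rule mult_mono)
      have "y\<^sup>2 \<le> (L * \<eta> * norm (dir k \<omega>))\<^sup>2"
        unfolding y_def using norm_grad_diff_le[OF k \<omega>] by (intro power_mono) auto
      also have "\<dots> \<le> (L * \<eta>)\<^sup>2 * (w / \<sigma>op)"
        unfolding power_mult_distrib[of _ "norm (dir k \<omega>)"] w_def
        by (intro mult_left_mono norm_dir_le k \<omega>) simp
      finally show "y\<^sup>2 \<le> ((1 - \<theta>) * \<sigma>op / 2)\<^sup>2 * (w / \<sigma>op)" by (simp only: L_eta)
    qed (use theta in \<open>auto intro!: divide_right_mono power_le_one\<close>)
    also have "\<dots> = (1 - \<theta>) * \<sigma>op / 4 * w"
      using theta sop_pos by (simp add: field_simps power2_eq_square)
    finally show "\<theta>\<^sup>2 * (norm (Mo (Suc k) \<omega> - grad (Suc k) \<omega>))\<^sup>2 \<le> \<theta> * (norm (Mo (Suc k) \<omega> - grad k \<omega>))\<^sup>2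
      + (1 - \<theta>) * \<sigma>op / 4 * weighted_sq k \<omega> (Mo (Suc k) \<omega>)"
      by (simp add: x_def w_def)
  qed (use int in auto)
  also have "\<dots> = \<theta> * momentum_error k + (1 - \<theta>) * \<sigma>op / 4 * (\<integral>\<omega>. weighted_sq k \<omega> (Mo (Suc k) \<omega>) \<partial>\<Omega>)"
    using int by (simp add: momentum_error_def)
  finally show ?thesis using momentum_error_le[OF assms] by linarith
qed

text \<open>The extra \<open>\<theta> * momentum_error n\<close> closes the induction: at the next
  index it supplies exactly the contracted old error. The drift sum stops before \<open>n\<close>
  because the first error involves no drift.\<close>

lemma momentum_error_sum:
  assumes "n < K"
  shows "(1 - \<theta>) * (\<Sum>k\<le>n. momentum_error k) + \<theta> * momentum_error n \<le> 2 * L * (f X1 - fstar)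
    + real (Suc n) * (1 - \<theta>)\<^sup>2 * \<sigma>F\<^sup>2
    + (1 - \<theta>) * \<sigma>op / 4 * (\<Sum>k<n. \<integral>\<omega>. weighted_sq k \<omega> (Mo (Suc k) \<omega>) \<partial>\<Omega>)"
  using assms
proof (induction n)
  case 0
  then show ?case using momentum_error_0 by (simp add: algebra_simps)
next
  case (Suc n)
  then show ?case using momentum_error_Suc[of n] by (simp add: algebra_simps)
qed

lemma weighted_gradient_sum:
  assumes "0 < K"
  shows "(\<Sum>k<K. \<integral>\<omega>. weighted_sq k \<omega> (grad k \<omega>) \<partial>\<Omega>) \<le> 2 * (f X1 - fstar) / \<eta>
    + 1 / \<sigma>op * (2 * L * (f X1 - fstar) / (1 - \<theta>) + real K * (1 - \<theta>) * \<sigma>F\<^sup>2)"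
proof -
  define p where "p k = (\<integral>\<omega>. weighted_sq k \<omega> (grad k \<omega>) \<partial>\<Omega>)" for k
  define w where "w k = (\<integral>\<omega>. weighted_sq k \<omega> (Mo (Suc k) \<omega>) \<partial>\<Omega>)" for k
  define \<Delta> where "\<Delta> = f X1 - fstar"
  have eta_pos: "0 < \<eta>" using eta theta L_pos sop_pos by simp
  have Mo: "square_integrable \<Omega> (Mo (Suc k))" and gr: "square_integrable \<Omega> (grad k)" if "k < K" for k
    using that by (auto intro: Mo_sq grad_sq)
  have w_nonneg: "0 \<le> w k" if "k < K" for k
    unfolding w_def using weighted_sq_nonneg[OF that] by (intro integral_nonneg_AE AE_I2)
  have err_nonneg: "0 \<le> momentum_error k" for k
    by (simp add: momentum_error_def)
  note [simp] = weighted_sq_integrable[OF _ gr] weighted_sq_integrable[OF _ Mo]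
    square_integrable_integrable[OF square_integrable_diff[OF Mo gr]]
  have "(\<Sum>k<K. \<eta> / 2 * p k + \<eta> / 4 * w k - \<eta> / (2 * \<sigma>op) * momentum_error k)
    = (\<integral>\<omega>. (\<Sum>k<K. \<eta> / 2 * weighted_sq k \<omega> (grad k \<omega>) + \<eta> / 4 * weighted_sq k \<omega> (Mo (Suc k) \<omega>)
    - \<eta> / (2 * \<sigma>op) * (norm (Mo (Suc k) \<omega> - grad k \<omega>))\<^sup>2) \<partial>\<Omega>)"
    by (simp add: p_def w_def momentum_error_def)
  also have "\<dots> \<le> (\<integral>\<omega>. \<Delta> \<partial>\<Omega>)"
  proof (rule integral_mono)
    fix \<omega> assume "\<omega> \<in> space \<Omega>"
    then show "(\<Sum>k<K. \<eta> / 2 * weighted_sq k \<omega> (grad k \<omega>) + \<eta> / 4 * weighted_sq k \<omega> (Mo (Suc k) \<omega>)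
      - \<eta> / (2 * \<sigma>op) * (norm (Mo (Suc k) \<omega> - grad k \<omega>))\<^sup>2) \<le> \<Delta>"
      using descent_sum[of \<omega> K] lower[of "X (Suc K) \<omega>"] by (simp add: \<Delta>_def)
  qed (auto intro!: Bochner_Integration.integrable_sum Bochner_Integration.integrable_diff
      Bochner_Integration.integrable_add integrable_mult_right simp del: times_divide_eq_left)
  finally have 1: "\<eta> / 2 * (\<Sum>k<K. p k) + \<eta> / 4 * (\<Sum>k<K. w k) - \<eta> / (2 * \<sigma>op) * (\<Sum>k<K. momentum_error k) \<le> \<Delta>"
    by (simp add: prob_space sum.distrib sum_subtractf sum_distrib_left)
  define n where "n = K - 1"
  have n: "K = Suc n" using assms by (simp add: n_def)
  have "(1 - \<theta>) * (\<Sum>k<K. momentum_error k) + \<theta> * momentum_error n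
      \<le> 2 * L * \<Delta> + real K * (1 - \<theta>)\<^sup>2 * \<sigma>F\<^sup>2 + (1 - \<theta>) * \<sigma>op / 4 * (\<Sum>k<n. w k)"
    using momentum_error_sum[of n] by (simp add: n w_def \<Delta>_def lessThan_Suc_atMost)
  moreover have "0 \<le> \<theta> * momentum_error n" using theta err_nonneg by simp
  moreover have "(1 - \<theta>) * \<sigma>op / 4 * (\<Sum>k<n. w k) \<le> (1 - \<theta>) * \<sigma>op / 4 * (\<Sum>k<K. w k)"
    using theta sop_pos w_nonneg by (intro mult_left_mono sum_mono2) (auto simp: n)
  ultimately have "(1 - \<theta>) * (\<Sum>k<K. momentum_error k)
      \<le> 2 * L * \<Delta> + real K * (1 - \<theta>)\<^sup>2 * \<sigma>F\<^sup>2 + (1 - \<theta>) * \<sigma>op / 4 * (\<Sum>k<K. w k)" by linarith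
  then have "(\<Sum>k<K. momentum_error k)
      \<le> (2 * L * \<Delta> + real K * (1 - \<theta>)\<^sup>2 * \<sigma>F\<^sup>2 + (1 - \<theta>) * \<sigma>op / 4 * (\<Sum>k<K. w k)) / (1 - \<theta>)"
    using theta by (simp add: pos_le_divide_eq mult.commute)
  also have "\<dots> = 2 * L * \<Delta> / (1 - \<theta>) + real K * (1 - \<theta>) * \<sigma>F\<^sup>2 + \<sigma>op / 4 * (\<Sum>k<K. w k)"
  proof -
    obtain c where c: "1 - \<theta> = c" "0 < c" using theta by simp
    show ?thesis unfolding c(1) using c(2) by (simp add: add_divide_distrib power2_eq_square)
  qed
  finally have "\<eta> / (2 * \<sigma>op) * (\<Sum>k<K. momentum_error k)
      \<le> \<eta> / (2 * \<sigma>op) * (2 * L * \<Delta> / (1 - \<theta>) + real K * (1 - \<theta>) * \<sigma>F\<^sup>2 + \<sigma>op / 4 * (\<Sum>k<K. w k))"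
    using eta_pos sop_pos by (intro mult_left_mono) auto
  also have "\<dots> = \<eta> / 2 * (1 / \<sigma>op * (2 * L * \<Delta> / (1 - \<theta>) + real K * (1 - \<theta>) * \<sigma>F\<^sup>2)) + \<eta> / 8 * (\<Sum>k<K. w k)"
    using sop_pos by (simp add: distrib_left)
  finally have 2: "\<eta> / (2 * \<sigma>op) * (\<Sum>k<K. momentum_error k)
    \<le> \<eta> / 2 * (1 / \<sigma>op * (2 * L * \<Delta> / (1 - \<theta>) + real K * (1 - \<theta>) * \<sigma>F\<^sup>2)) + \<eta> / 8 * (\<Sum>k<K. w k)" .
  \<comment> \<open>The drift returns with the factor
    \<open>\<eta> / (2 * \<sigma>op) * (\<sigma>op / 4) = \<eta> / 8\<close>, half of what descent
    left available.\<close>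
  have 3: "\<eta> / 8 * (\<Sum>k<K. w k) \<le> \<eta> / 4 * (\<Sum>k<K. w k)"
    using eta_pos w_nonneg by (intro mult_right_mono sum_nonneg) auto
  define B where "B = 1 / \<sigma>op * (2 * L * \<Delta> / (1 - \<theta>) + real K * (1 - \<theta>) * \<sigma>F\<^sup>2)"
  have "\<eta> / 2 * (\<Sum>k<K. p k) \<le> \<Delta> + \<eta> / 2 * B"
    using 1 2 3 unfolding B_def[symmetric] by linarith
  also have "\<dots> = \<eta> / 2 * (2 * \<Delta> / \<eta> + B)"
    using eta_pos by (simp add: distrib_left)
  finally have "\<eta> / 2 * (\<Sum>k<K. p k) \<le> \<eta> / 2 * (2 * \<Delta> / \<eta> + B)" .
  then have "(\<Sum>k<K. p k) \<le> 2 * \<Delta> / \<eta> + B"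
    using eta_pos by (simp only: mult_le_cancel_left_pos half_gt_zero_iff)
  then show ?thesis by (simp only: p_def \<Delta>_def B_def)
qed

section \<open>The adaptive scaling\<close>

definition grad_entry :: "nat \<Rightarrow> 'm \<Rightarrow> 'n \<Rightarrow> 'w \<Rightarrow> real" where
  "grad_entry k i j \<omega> = rot k \<omega> (grad k \<omega>) $ i $ j"

definition sample_entry :: "nat \<Rightarrow> 'm \<Rightarrow> 'n \<Rightarrow> 'w \<Rightarrow> real" where
  "sample_entry k i j \<omega> = rot k \<omega> (G (Suc k) \<omega>) $ i $ j"

text \<open>
  An \<open>F k\<close>-measurable upper proxy for \<open>scale k\<close>: the squared sample entry is replaced by a bound
  on its conditional expectation.
\<close>

definition proxy_scale :: "nat \<Rightarrow> 'm \<Rightarrow> 'n \<Rightarrow> 'w \<Rightarrow> real" where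
  "proxy_scale k i j \<omega> =
    sqrt (\<beta> * V k \<omega> $ i $ j + (1 - \<beta>) * ((grad_entry k i j \<omega>)\<^sup>2 + \<sigma>op\<^sup>2) + \<epsilon>)"

definition proxy_ratio :: "nat \<Rightarrow> 'm \<Rightarrow> 'n \<Rightarrow> real" where
  "proxy_ratio k i j = (\<integral>\<omega>. (grad_entry k i j \<omega>)\<^sup>2 / proxy_scale k i j \<omega> \<partial>\<Omega>)"

section \<open>Integrability and lower bounds for the proxy scale\<close>

lemma G_sq: "k < K \<Longrightarrow> square_integrable \<Omega> (G (Suc k))"
  using square_integrable_add[OF grad_sq[of k] noise_sq(1)[of k]] by (simp add: noise_def)

lemma rot_sq:
  assumes "k \<le> K" "square_integrable \<Omega> A"
  shows "square_integrable \<Omega> (\<lambda>\<omega>. rot k \<omega> (A \<omega>))"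
  by (rule square_integrable_bound[OF assms(2), of _ 1])
    (use assms in \<open>auto intro: rot_measurable square_integrable_measurable simp: norm_rot\<close>)

lemma grad_entry_sq: "k < K \<Longrightarrow> square_integrable \<Omega> (grad_entry k i j)"
  unfolding grad_entry_def[abs_def]
  by (intro square_integrable_entry rot_sq grad_sq) auto

lemma sample_entry_sq: "k < K \<Longrightarrow> square_integrable \<Omega> (sample_entry k i j)"
  unfolding sample_entry_def[abs_def]
  by (intro square_integrable_entry rot_sq G_sq) auto

lemma grad_entry_adapted: "k < K \<Longrightarrow> grad_entry k i j \<in> borel_measurable (F k)"
  unfolding grad_entry_def[abs_def]
  by (intro borel_measurable_matrix_entry rot_adapted grad_adapted) auto

lemma proxy_scale_adapted:
  assumes "k < K"
  shows "proxy_scale k i j \<in> borel_measurable (F k)"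
proof -
  note [measurable] = grad_entry_adapted[OF assms, of i j]
    borel_measurable_matrix_entry[OF V_adapted[OF less_imp_le[OF assms]], of i j]
  show ?thesis unfolding proxy_scale_def[abs_def] by measurable
qed

lemma proxy_scale_sq:
  assumes "k < K" "\<omega> \<in> space \<Omega>"
  shows "(proxy_scale k i j \<omega>)\<^sup>2
      = \<beta> * V k \<omega> $ i $ j + (1 - \<beta>) * ((grad_entry k i j \<omega>)\<^sup>2 + \<sigma>op\<^sup>2) + \<epsilon>"
  unfolding proxy_scale_def using V_nonneg[of k \<omega> i j] assms beta eps by simp

lemma proxy_scale_ge:
  assumes "k < K" "\<omega> \<in> space \<Omega>"
  shows "\<sigma>op \<le> proxy_scale k i j \<omega>"
proof -
  have "\<sigma>op = sqrt \<epsilon>" using sop_pos by (simp add: eps)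
  also have "\<dots> \<le> proxy_scale k i j \<omega>"
    unfolding proxy_scale_def using V_nonneg[of k \<omega> i j] assms beta by simp
  finally show ?thesis .
qed

lemma proxy_scale_pos: "k < K \<Longrightarrow> \<omega> \<in> space \<Omega> \<Longrightarrow> 0 < proxy_scale k i j \<omega>"
  using proxy_scale_ge[of k \<omega> i j] sop_pos by linarith

lemma V_Suc_entry:
  assumes "k < K" "\<omega> \<in> space \<Omega>"
  shows "V (Suc k) \<omega> $ i $ j = \<beta> * V k \<omega> $ i $ j + (1 - \<beta>) * (sample_entry k i j \<omega>)\<^sup>2"
  using step(3)[OF assms] by (simp add: entry_square_def sample_entry_def)

lemma V_integrable:
  assumes "k \<le> K"
  shows "integrable \<Omega> (\<lambda>\<omega>. V k \<omega> $ i $ j)"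
  using assms
proof (induction k)
  case 0
  have "integrable \<Omega> (\<lambda>\<omega>. V 0 \<omega> $ i $ j) \<longleftrightarrow> integrable \<Omega> (\<lambda>\<omega>. 0 :: real)"
    by (intro Bochner_Integration.integrable_cong) (auto simp: init)
  then show ?case by simp
next
  case (Suc k)
  then have k: "k < K" by simp
  have "integrable \<Omega> (\<lambda>\<omega>. V (Suc k) \<omega> $ i $ j) \<longleftrightarrow>
    integrable \<Omega> (\<lambda>\<omega>. \<beta> * V k \<omega> $ i $ j + (1 - \<beta>) * (sample_entry k i j \<omega>)\<^sup>2)"
    by (intro Bochner_Integration.integrable_cong) (auto simp: V_Suc_entry[OF k])
  then show ?case
    using Suc square_integrable_integrable[OF sample_entry_sq[OF k, of i j]] by simp
qed

lemma noise_entry_le: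
  assumes "k < K" "\<omega> \<in> space \<Omega>"
  shows "(rot k \<omega> (noise k \<omega>) $ i $ j)\<^sup>2 \<le> (spectral_norm (noise k \<omega>))\<^sup>2"
proof -
  have "\<bar>rot k \<omega> (noise k \<omega>) $ i $ j\<bar> \<le> onorm ((*v) (rot k \<omega> (noise k \<omega>)))"
    by (rule matrix_component_le_onorm)
  also have "\<dots> \<le> spectral_norm (noise k \<omega>)"
    unfolding rot_def spectral_norm_eq_onorm
    using orth[of k \<omega>] assms by (intro onorm_orthogonal_conj_le) auto
  finally show ?thesis
    using power_mono[of "\<bar>rot k \<omega> (noise k \<omega>) $ i $ j\<bar>" "spectral_norm (noise k \<omega>)" 2] by simp
qed

text \<open>The conditional second moment of a sample entry is at most
  \<open>(grad_entry k i j \<omega>)\<^sup>2 + \<sigma>op\<^sup>2\<close>, stated in tested form.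
  This is what both tangent arguments consume: their slopes are bounded, measurable weights
  multiplying the squared sample.\<close>

lemma sample_entry_conditional_bound:
  assumes "k < K" and h: "h \<in> borel_measurable (F k)"
    "\<And>\<omega>. \<omega> \<in> space \<Omega> \<Longrightarrow> 0 \<le> h \<omega>" "\<And>\<omega>. \<omega> \<in> space \<Omega> \<Longrightarrow> h \<omega> \<le> c"
  shows "integrable \<Omega> (\<lambda>\<omega>. h \<omega> * ((sample_entry k i j \<omega>)\<^sup>2 - (grad_entry k i j \<omega>)\<^sup>2 - \<sigma>op\<^sup>2))"
    "(\<integral>\<omega>. h \<omega> * ((sample_entry k i j \<omega>)\<^sup>2 - (grad_entry k i j \<omega>)\<^sup>2 - \<sigma>op\<^sup>2) \<partial>\<Omega>) \<le> 0"
proof -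
  have k: "k \<le> K" using assms by simp
  \<comment> \<open>The preimage of a matrix unit under the rotation: a rotated entry of the noise
    is its inner product with \<open>R\<close>, which is known before the sample.\<close>
  define R where "R \<omega> = P k \<omega> ** axis i (axis j 1) ** transpose (Q k \<omega>)" for \<omega>
  have R: "rot k \<omega> (R \<omega>) = axis i (axis j 1)" if "\<omega> \<in> space \<Omega>" for \<omega>
    using rot_back[OF k that] by (simp add: R_def)
  define n where "n \<omega> = rot k \<omega> (noise k \<omega>) $ i $ j" for \<omega>
  have nR: "n \<omega> = noise k \<omega> \<bullet> R \<omega>" if "\<omega> \<in> space \<Omega>" for \<omega>
    using rot_inner[OF k that, of "noise k \<omega>" "R \<omega>"] by (simp add: R[OF that] n_def inner_axis)
  \<comment> \<open>The inner product of \<open>Y\<close> with the noise is half the weighted cross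
    term of the squared sample entry, and its expectation vanishes.\<close>
  define Y where "Y \<omega> = (h \<omega> * grad_entry k i j \<omega>) *\<^sub>R R \<omega>" for \<omega>
  have YF: "Y \<in> borel_measurable (F k)"
    unfolding Y_def[abs_def] R_def
    by (intro borel_measurable_scaleR borel_measurable_times h grad_entry_adapted assms
        borel_measurable_matrix_intros P_adapted Q_adapted k) simp
  have Y: "square_integrable \<Omega> Y"
  proof (rule square_integrable_bound[OF grad_entry_sq[OF assms(1), of i j], of _ c])
    show "Y \<in> borel_measurable \<Omega>" using measurable_from_F[OF k YF] .
    fix \<omega> assume \<omega>: "\<omega> \<in> space \<Omega>"
    have "norm (R \<omega>) = 1"
      using norm_rot[OF k \<omega>, of "R \<omega>"] R[OF \<omega>] by simp
    then have "norm (Y \<omega>) = h \<omega> * \<bar>grad_entry k i j \<omega>\<bar>"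
      using h(2)[OF \<omega>] by (simp add: Y_def abs_mult)
    also have "\<dots> \<le> c * norm (grad_entry k i j \<omega>)"
      using h(3)[OF \<omega>] by (simp add: mult_right_mono)
    finally show "norm (Y \<omega>) \<le> c * norm (grad_entry k i j \<omega>)" .
  qed
  have hM: "h \<in> borel_measurable \<Omega>" using measurable_from_F[OF k h(1)] .
  have hi: "integrable \<Omega> h"
    by (rule integrable_const_bound[of _ c]) (use h hM in auto)
  have "AE \<omega> in \<Omega>. nn_cond_exp \<Omega> (F k) (\<lambda>\<omega>. ennreal ((spectral_norm (noise k \<omega>))\<^sup>2)) \<omega> \<le> ennreal (\<sigma>op\<^sup>2)"
    using noise_op[of "Suc k"] assms by (simp add: noise_def grad_def)
  note * = nn_cond_exp_bound_integral[OF sigma_finite_subalg[OF k] finite_measure_axioms h _ _ this]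
  have sm: "(\<lambda>\<omega>. (spectral_norm (noise k \<omega>))\<^sup>2) \<in> borel_measurable \<Omega>"
    by (intro borel_measurable_power measurable_compose[OF noise_measurable[OF assms(1)]]
        borel_measurable_continuous_onI continuous_on_spectral_norm)
  have si: "integrable \<Omega> (\<lambda>\<omega>. h \<omega> * (spectral_norm (noise k \<omega>))\<^sup>2)"
    and sb: "(\<integral>\<omega>. h \<omega> * (spectral_norm (noise k \<omega>))\<^sup>2 \<partial>\<Omega>) \<le> \<sigma>op\<^sup>2 * (\<integral>\<omega>. h \<omega> \<partial>\<Omega>)"
    by (rule *(1); use sm in auto) (rule *(2); use sm in auto)
  have nm: "n \<in> borel_measurable \<Omega>"
    unfolding n_def[abs_def]
    by (intro borel_measurable_matrix_entry rot_measurable k noise_measurable assms)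
  have ni: "integrable \<Omega> (\<lambda>\<omega>. h \<omega> * (n \<omega>)\<^sup>2)"
  proof (rule Bochner_Integration.integrable_bound[OF si])
    show "(\<lambda>\<omega>. h \<omega> * (n \<omega>)\<^sup>2) \<in> borel_measurable \<Omega>" using hM nm by simp
    show "AE \<omega> in \<Omega>. norm (h \<omega> * (n \<omega>)\<^sup>2) \<le> norm (h \<omega> * (spectral_norm (noise k \<omega>))\<^sup>2)"
      using noise_entry_le[OF assms(1)] h(2)
      by (intro AE_I2) (simp add: abs_mult mult_left_mono n_def)
  qed
  have split: "h \<omega> * ((sample_entry k i j \<omega>)\<^sup>2 - (grad_entry k i j \<omega>)\<^sup>2 - \<sigma>op\<^sup>2)
      = 2 * (Y \<omega> \<bullet> noise k \<omega>) + h \<omega> * (n \<omega>)\<^sup>2 - \<sigma>op\<^sup>2 * h \<omega>" if "\<omega> \<in> space \<Omega>" for \<omega>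
  proof -
    have "n \<omega> = sample_entry k i j \<omega> - grad_entry k i j \<omega>"
      by (simp add: n_def noise_def rot_diff sample_entry_def grad_entry_def)
    then have "sample_entry k i j \<omega> = grad_entry k i j \<omega> + n \<omega>" by simp
    moreover have "Y \<omega> \<bullet> noise k \<omega> = h \<omega> * grad_entry k i j \<omega> * n \<omega>"
      by (simp add: Y_def nR[OF that] inner_commute)
    ultimately show ?thesis by (simp add: power2_eq_square algebra_simps)
  qed
  note ints = square_integrable_inner[OF Y noise_sq(1)[OF assms(1)]] ni hi
  have "integrable \<Omega> (\<lambda>\<omega>. h \<omega> * ((sample_entry k i j \<omega>)\<^sup>2 - (grad_entry k i j \<omega>)\<^sup>2 - \<sigma>op\<^sup>2)) \<longleftrightarrow>
      integrable \<Omega> (\<lambda>\<omega>. 2 * (Y \<omega> \<bullet> noise k \<omega>) + h \<omega> * (n \<omega>)\<^sup>2 - \<sigma>op\<^sup>2 * h \<omega>)"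
    by (intro Bochner_Integration.integrable_cong refl split)
  then show "integrable \<Omega> (\<lambda>\<omega>. h \<omega> * ((sample_entry k i j \<omega>)\<^sup>2 - (grad_entry k i j \<omega>)\<^sup>2 - \<sigma>op\<^sup>2))"
    using ints by simp
  have "(\<integral>\<omega>. h \<omega> * ((sample_entry k i j \<omega>)\<^sup>2 - (grad_entry k i j \<omega>)\<^sup>2 - \<sigma>op\<^sup>2) \<partial>\<Omega>)
      = (\<integral>\<omega>. 2 * (Y \<omega> \<bullet> noise k \<omega>) + h \<omega> * (n \<omega>)\<^sup>2 - \<sigma>op\<^sup>2 * h \<omega> \<partial>\<Omega>)"
    by (intro Bochner_Integration.integral_cong refl split)
  also have "\<dots> = 2 * (\<integral>\<omega>. Y \<omega> \<bullet> noise k \<omega> \<partial>\<Omega>) + (\<integral>\<omega>. h \<omega> * (n \<omega>)\<^sup>2 \<partial>\<Omega>) - \<sigma>op\<^sup>2 * (\<integral>\<omega>. h \<omega> \<partial>\<Omega>)"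
    using ints by simp
  also have "(\<integral>\<omega>. Y \<omega> \<bullet> noise k \<omega> \<partial>\<Omega>) = 0"
    by (rule noise_orthogonal[OF assms(1) YF Y])
  also have "(\<integral>\<omega>. h \<omega> * (n \<omega>)\<^sup>2 \<partial>\<Omega>) \<le> (\<integral>\<omega>. h \<omega> * (spectral_norm (noise k \<omega>))\<^sup>2 \<partial>\<Omega>)"
    using noise_entry_le[OF assms(1)] h(2)
    by (intro integral_mono ni si) (auto simp: n_def intro!: mult_left_mono)
  finally show "(\<integral>\<omega>. h \<omega> * ((sample_entry k i j \<omega>)\<^sup>2 - (grad_entry k i j \<omega>)\<^sup>2 - \<sigma>op\<^sup>2) \<partial>\<Omega>) \<le> 0"
    using sb by simp
qed

lemma proxy_ratio_integrable:
  assumes "k < K"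
  shows "integrable \<Omega> (\<lambda>\<omega>. (grad_entry k i j \<omega>)\<^sup>2 / proxy_scale k i j \<omega>)"
proof (rule Bochner_Integration.integrable_bound)
  show "integrable \<Omega> (\<lambda>\<omega>. (norm (grad_entry k i j \<omega>))\<^sup>2 / \<sigma>op)"
    using square_integrable_integrable[OF grad_entry_sq[OF assms, of i j]] by simp
  show "(\<lambda>\<omega>. (grad_entry k i j \<omega>)\<^sup>2 / proxy_scale k i j \<omega>) \<in> borel_measurable \<Omega>"
    using measurable_from_F[OF _ grad_entry_adapted[OF assms]] measurable_from_F[OF _ proxy_scale_adapted[OF assms]] assms
    by (intro borel_measurable_divide borel_measurable_power) auto
  show "AE \<omega> in \<Omega>. norm ((grad_entry k i j \<omega>)\<^sup>2 / proxy_scale k i j \<omega>) \<le> norm ((norm (grad_entry k i j \<omega>))\<^sup>2 / \<sigma>op)"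
  proof (rule AE_I2)
    fix \<omega> assume "\<omega> \<in> space \<Omega>"
    then show "norm ((grad_entry k i j \<omega>)\<^sup>2 / proxy_scale k i j \<omega>) \<le> norm ((norm (grad_entry k i j \<omega>))\<^sup>2 / \<sigma>op)"
      using proxy_scale_ge[OF assms, of \<omega> i j] proxy_scale_pos[OF assms, of \<omega> i j] sop_pos
      by (auto intro!: divide_left_mono)
  qed
qed

lemma proxy_ratio_nonneg: "k < K \<Longrightarrow> 0 \<le> proxy_ratio k i j"
  unfolding proxy_ratio_def using proxy_scale_pos
  by (intro integral_nonneg_AE AE_I2) (auto intro: divide_nonneg_pos)

lemma ratio_integrable:
  assumes "k < K"
  shows "integrable \<Omega> (\<lambda>\<omega>. (grad_entry k i j \<omega>)\<^sup>2 / scale k \<omega> $ i $ j)"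
proof (rule Bochner_Integration.integrable_bound)
  show "integrable \<Omega> (\<lambda>\<omega>. (norm (grad_entry k i j \<omega>))\<^sup>2 / \<sigma>op)"
    using square_integrable_integrable[OF grad_entry_sq[OF assms, of i j]] by simp
  show "(\<lambda>\<omega>. (grad_entry k i j \<omega>)\<^sup>2 / scale k \<omega> $ i $ j) \<in> borel_measurable \<Omega>"
    using measurable_from_F[OF _ grad_entry_adapted[OF assms]] assms
    by (intro borel_measurable_divide borel_measurable_power borel_measurable_matrix_entry scale_measurable) auto
  show "AE \<omega> in \<Omega>. norm ((grad_entry k i j \<omega>)\<^sup>2 / scale k \<omega> $ i $ j) \<le> norm ((norm (grad_entry k i j \<omega>))\<^sup>2 / \<sigma>op)"
  proof (rule AE_I2)
    fix \<omega> assume "\<omega> \<in> space \<Omega>"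
    then show "norm ((grad_entry k i j \<omega>)\<^sup>2 / scale k \<omega> $ i $ j) \<le> norm ((norm (grad_entry k i j \<omega>))\<^sup>2 / \<sigma>op)"
      using scale_ge[OF assms, of \<omega> i j] scale_pos[OF assms, of \<omega> i j] sop_pos
      by (auto intro!: divide_left_mono)
  qed
qed

text \<open>
  Conditional Jensen for the convex function \<open>1 / sqrt\<close>, in the form of its tangent at the proxy;
  likewise for the concave function \<open>sqrt\<close> below.
\<close>

lemma proxy_ratio_le:
  assumes "k < K"
  shows "proxy_ratio k i j \<le> (\<integral>\<omega>. (grad_entry k i j \<omega>)\<^sup>2 / scale k \<omega> $ i $ j \<partial>\<Omega>)"
proof -
  define x where "x = grad_entry k i j"
  define z where "z = proxy_scale k i j"
  \<comment> \<open>The tangent slope \<open>- 1 / (2 * z ^ 3)\<close> with its sign removed, times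
    the gradient factor and the weight \<open>1 - \<beta>\<close> of the new sample in
    \<open>V\<close>.\<close>
  define h where "h \<omega> = (x \<omega>)\<^sup>2 * (1 - \<beta>) / (2 * z \<omega> ^ 3)" for \<omega>
  define d where "d \<omega> = (sample_entry k i j \<omega>)\<^sup>2 - (x \<omega>)\<^sup>2 - \<sigma>op\<^sup>2" for \<omega>
  have hF: "h \<in> borel_measurable (F k)"
    unfolding h_def[abs_def] using grad_entry_adapted[OF assms, of i j] proxy_scale_adapted[OF assms, of i j]
    by (auto simp: x_def z_def)
  have h0: "0 \<le> h \<omega>" if "\<omega> \<in> space \<Omega>" for \<omega>
    using beta proxy_scale_pos[OF assms that, of i j] by (simp add: h_def z_def)
  \<comment> \<open>The gradient is unbounded, but its square is part of \<open>z\<^sup>2\<close>,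
    which leaves \<open>1 / (2 * z)\<close>.\<close>
  have hc: "h \<omega> \<le> 1 / (2 * \<sigma>op)" if \<omega>: "\<omega> \<in> space \<Omega>" for \<omega>
  proof -
    have z: "\<sigma>op \<le> z \<omega>" "0 < z \<omega>" using proxy_scale_ge[OF assms \<omega>] proxy_scale_pos[OF assms \<omega>] by (auto simp: z_def)
    have "0 \<le> \<beta> * V k \<omega> $ i $ j + (1 - \<beta>) * \<sigma>op\<^sup>2 + \<epsilon>"
      using V_nonneg[of k \<omega> i j] assms \<omega> beta eps by simp
    then have "(x \<omega>)\<^sup>2 * (1 - \<beta>) \<le> (z \<omega>)\<^sup>2"
      unfolding x_def z_def proxy_scale_sq[OF assms \<omega>] by (simp add: distrib_left mult.commute)
    then have "h \<omega> \<le> (z \<omega>)\<^sup>2 / (2 * z \<omega> ^ 3)"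
      unfolding h_def using z by (intro divide_right_mono) auto
    also have "\<dots> = 1 / (2 * z \<omega>)" using z by (simp add: power2_eq_square power3_eq_cube)
    also have "\<dots> \<le> 1 / (2 * \<sigma>op)" using z sop_pos by (intro divide_left_mono) auto
    finally show ?thesis .
  qed
  note J = sample_entry_conditional_bound[OF assms hF h0 hc, of i j, folded x_def, folded d_def]
  have "proxy_ratio k i j \<le> (\<integral>\<omega>. (x \<omega>)\<^sup>2 / z \<omega> \<partial>\<Omega>) - (\<integral>\<omega>. h \<omega> * d \<omega> \<partial>\<Omega>)"
    using J(2) by (simp add: proxy_ratio_def x_def z_def)
  also have "\<dots> = (\<integral>\<omega>. (x \<omega>)\<^sup>2 / z \<omega> - h \<omega> * d \<omega> \<partial>\<Omega>)"
    using J(1) proxy_ratio_integrable[OF assms, of i j] by (simp add: x_def z_def)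
  also have "\<dots> \<le> (\<integral>\<omega>. (x \<omega>)\<^sup>2 / scale k \<omega> $ i $ j \<partial>\<Omega>)"
  proof (rule integral_mono)
    show "integrable \<Omega> (\<lambda>\<omega>. (x \<omega>)\<^sup>2 / z \<omega> - h \<omega> * d \<omega>)"
      using J(1) proxy_ratio_integrable[OF assms, of i j] by (simp add: x_def z_def)
    show "integrable \<Omega> (\<lambda>\<omega>. (x \<omega>)\<^sup>2 / scale k \<omega> $ i $ j)"
      using ratio_integrable[OF assms] by (simp add: x_def)
    fix \<omega> assume \<omega>: "\<omega> \<in> space \<Omega>"
    define y where "y = scale k \<omega> $ i $ j"
    have y: "0 < y" and z: "0 < z \<omega>"
      using scale_pos[OF assms \<omega>] proxy_scale_pos[OF assms \<omega>] by (auto simp: y_def z_def)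
    have "y\<^sup>2 = V (Suc k) \<omega> $ i $ j + \<epsilon>"
      unfolding y_def scale_entry using V_nonneg[of "Suc k" \<omega> i j] assms \<omega> eps by simp
    then have yz: "y\<^sup>2 - (z \<omega>)\<^sup>2 = (1 - \<beta>) * d \<omega>"
      unfolding z_def proxy_scale_sq[OF assms \<omega>] V_Suc_entry[OF assms \<omega>] d_def x_def
      by (simp add: algebra_simps)
    have "(x \<omega>)\<^sup>2 * (1 / z \<omega> - (y\<^sup>2 - (z \<omega>)\<^sup>2) / (2 * z \<omega> ^ 3)) \<le> (x \<omega>)\<^sup>2 * (1 / y)"
      by (intro mult_left_mono inverse_tangent_le y z) simp
    moreover have "(x \<omega>)\<^sup>2 * (1 / z \<omega> - (y\<^sup>2 - (z \<omega>)\<^sup>2) / (2 * z \<omega> ^ 3)) = (x \<omega>)\<^sup>2 / z \<omega> - h \<omega> * d \<omega>"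
      unfolding yz h_def right_diff_distrib[of "(x \<omega>)\<^sup>2"] by (simp add: right_diff_distrib)
    ultimately show "(x \<omega>)\<^sup>2 / z \<omega> - h \<omega> * d \<omega> \<le> (x \<omega>)\<^sup>2 / scale k \<omega> $ i $ j"
      by (simp add: y_def)
  qed
  finally show ?thesis by (simp add: x_def)
qed

section \<open>Unrolling the second moment under the square root\<close>

lemma sqrt_V_integrable:
  assumes "k \<le> K" "0 \<le> w" "0 \<le> b"
  shows "integrable \<Omega> (\<lambda>\<omega>. sqrt (w * V k \<omega> $ i $ j + b))"
  using assms V_nonneg[OF assms(1)] V_integrable[OF assms(1)] by (intro integrable_sqrt) auto

text \<open>One unrolling multiplies the weight of \<open>V\<close> by \<open>\<beta>\<close> and
  moves noise variance into the constant, hence the free parameters \<open>w\<close> and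
  \<open>b\<close>. The gradient part is split off with \<open>sqrt_add_le_div\<close>.\<close>

lemma sqrt_V_Suc_le:
  assumes "k < K" "0 \<le> w" "0 < b" "w * \<epsilon> \<le> b"
  shows "(\<integral>\<omega>. sqrt (w * V (Suc k) \<omega> $ i $ j + b) \<partial>\<Omega>)
    \<le> (\<integral>\<omega>. sqrt (w * \<beta> * V k \<omega> $ i $ j + (b + w * (1 - \<beta>) * \<sigma>op\<^sup>2)) \<partial>\<Omega>)
      + sqrt w * (1 - \<beta>) * proxy_ratio k i j"
proof -
  define x where "x = grad_entry k i j"
  define z where "z = proxy_scale k i j"
  define u where "u \<omega> = w * \<beta> * V k \<omega> $ i $ j + (b + w * (1 - \<beta>) * \<sigma>op\<^sup>2)" for \<omega>
  \<comment> \<open>The radicand with the squared sample replaced by its conditional bound; the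
    tangent to \<open>sqrt\<close> is taken here.\<close>
  define a where "a \<omega> = u \<omega> + w * (1 - \<beta>) * (x \<omega>)\<^sup>2" for \<omega>
  define h where "h \<omega> = w * (1 - \<beta>) / (2 * sqrt (a \<omega>))" for \<omega>
  define d where "d \<omega> = (sample_entry k i j \<omega>)\<^sup>2 - (x \<omega>)\<^sup>2 - \<sigma>op\<^sup>2" for \<omega>
  have k: "k \<le> K" using assms by simp
  have u0: "b \<le> u \<omega>" if "\<omega> \<in> space \<Omega>" for \<omega>
    using V_nonneg[OF k that, of i j] beta assms by (simp add: u_def)
  have au: "u \<omega> \<le> a \<omega>" for \<omega>
    using beta assms by (simp add: a_def)
  note [measurable] = grad_entry_adapted[OF assms(1), of i j] proxy_scale_adapted[OF assms(1), of i j]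
    borel_measurable_matrix_entry[OF V_adapted[OF k], of i j]
  have hF: "h \<in> borel_measurable (F k)"
    unfolding h_def[abs_def] a_def u_def x_def by measurable
  have h0: "0 \<le> h \<omega>" if "\<omega> \<in> space \<Omega>" for \<omega>
    using beta assms u0[OF that] au[of \<omega>] by (simp add: h_def)
  have hc: "h \<omega> \<le> w * (1 - \<beta>) / (2 * sqrt b)" if "\<omega> \<in> space \<Omega>" for \<omega>
    unfolding h_def using beta assms u0[OF that] au[of \<omega>] by (intro divide_left_mono) auto
  note J = sample_entry_conditional_bound[OF assms(1) hF h0 hc, of i j, folded x_def, folded d_def]
  have ri: "integrable \<Omega> (\<lambda>\<omega>. (x \<omega>)\<^sup>2 / z \<omega>)"
    using proxy_ratio_integrable[OF assms(1)] by (simp add: x_def z_def)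
  have ui: "integrable \<Omega> (\<lambda>\<omega>. sqrt (u \<omega>))"
    unfolding u_def using k assms beta
    by (intro sqrt_V_integrable[of k "w * \<beta>" "b + w * (1 - \<beta>) * \<sigma>op\<^sup>2"]) auto
  have "(\<integral>\<omega>. sqrt (w * V (Suc k) \<omega> $ i $ j + b) \<partial>\<Omega>)
      \<le> (\<integral>\<omega>. sqrt (u \<omega>) + sqrt w * (1 - \<beta>) * ((x \<omega>)\<^sup>2 / z \<omega>) + h \<omega> * d \<omega> \<partial>\<Omega>)"
  proof (rule integral_mono)
    show "integrable \<Omega> (\<lambda>\<omega>. sqrt (w * V (Suc k) \<omega> $ i $ j + b))"
      using assms by (intro sqrt_V_integrable) auto
    show "integrable \<Omega> (\<lambda>\<omega>. sqrt (u \<omega>) + sqrt w * (1 - \<beta>) * ((x \<omega>)\<^sup>2 / z \<omega>) + h \<omega> * d \<omega>)"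
      by (intro Bochner_Integration.integrable_add integrable_mult_right ui ri J(1))
    fix \<omega> assume \<omega>: "\<omega> \<in> space \<Omega>"
    have a0: "0 < a \<omega>" using u0[OF \<omega>] au[of \<omega>] assms by linarith
    have z: "0 < z \<omega>" using proxy_scale_pos[OF assms(1) \<omega>] by (simp add: z_def)
    define y where "y = w * V (Suc k) \<omega> $ i $ j + b"
    have "y - a \<omega> = w * (1 - \<beta>) * d \<omega>"
      unfolding y_def V_Suc_entry[OF assms(1) \<omega>] a_def u_def d_def by (simp add: algebra_simps)
    then have hd: "(y - a \<omega>) / (2 * sqrt (a \<omega>)) = h \<omega> * d \<omega>"
      by (simp add: h_def)
    have "0 \<le> y" using V_nonneg[of "Suc k" \<omega> i j] assms \<omega> by (simp add: y_def)
    then have 1: "sqrt y \<le> sqrt (a \<omega>) + h \<omega> * d \<omega>"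
      using sqrt_tangent_ge[of y "a \<omega>"] a0 hd by simp
    have 2: "sqrt (a \<omega>) \<le> sqrt (u \<omega>) + w * (1 - \<beta>) * (x \<omega>)\<^sup>2 / sqrt (a \<omega>)"
      unfolding a_def using u0[OF \<omega>] assms beta
      by (intro sqrt_add_le_div add_pos_nonneg) auto
    \<comment> \<open>By \<open>w * \<epsilon> \<le> b\<close> the root of \<open>a\<close>
      dominates \<open>sqrt w\<close> times the proxy scale, so the split-off term is a multiple of
      the ratio with the proxy scale.\<close>
    have "w * (z \<omega>)\<^sup>2 \<le> a \<omega>"
      unfolding z_def proxy_scale_sq[OF assms(1) \<omega>] a_def u_def x_def using assms(4)
      by (simp add: algebra_simps)
    then have "sqrt w * z \<omega> \<le> sqrt (a \<omega>)"
      using z real_sqrt_le_mono[of "w * (z \<omega>)\<^sup>2" "a \<omega>"] by (simp add: real_sqrt_mult)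
    then have "sqrt w * (sqrt w * z \<omega>) \<le> sqrt w * sqrt (a \<omega>)"
      using assms by (intro mult_left_mono) auto
    then have "w * z \<omega> \<le> sqrt w * sqrt (a \<omega>)"
      using assms by (simp flip: mult.assoc)
    then have "w / sqrt (a \<omega>) \<le> sqrt w / z \<omega>"
      using z a0 by (simp add: field_simps)
    then have "w / sqrt (a \<omega>) * ((1 - \<beta>) * (x \<omega>)\<^sup>2) \<le> sqrt w / z \<omega> * ((1 - \<beta>) * (x \<omega>)\<^sup>2)"
      using beta by (intro mult_right_mono) auto
    then have "w * (1 - \<beta>) * (x \<omega>)\<^sup>2 / sqrt (a \<omega>) \<le> sqrt w * (1 - \<beta>) * ((x \<omega>)\<^sup>2 / z \<omega>)"
      by (simp add: mult_ac)
    then show "sqrt (w * V (Suc k) \<omega> $ i $ j + b)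
        \<le> sqrt (u \<omega>) + sqrt w * (1 - \<beta>) * ((x \<omega>)\<^sup>2 / z \<omega>) + h \<omega> * d \<omega>"
      using 1 2 unfolding y_def by linarith
  qed
  also have "\<dots> = (\<integral>\<omega>. sqrt (u \<omega>) \<partial>\<Omega>) + sqrt w * (1 - \<beta>) * (\<integral>\<omega>. (x \<omega>)\<^sup>2 / z \<omega> \<partial>\<Omega>) + (\<integral>\<omega>. h \<omega> * d \<omega> \<partial>\<Omega>)"
    using ui ri J(1) by (simp del: times_divide_eq_right)
  finally show ?thesis
    using J(2) unfolding u_def proxy_ratio_def x_def z_def by linarith
qed

text \<open>Because the weight sits under the root, each unrolling contributes
  \<open>sqrt \<beta>\<close>, not \<open>\<beta>\<close>, to the decay. The value
  \<open>b + w * \<sigma>op\<^sup>2\<close> is unchanged when the weight is lowered and the constant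
  raised.\<close>

lemma sqrt_V_le:
  assumes "k \<le> K" "0 \<le> w" "0 < b" "w * \<epsilon> \<le> b"
  shows "(\<integral>\<omega>. sqrt (w * V k \<omega> $ i $ j + b) \<partial>\<Omega>)
    \<le> sqrt (b + w * \<sigma>op\<^sup>2) + sqrt w * (1 - \<beta>) * decayed_sum (sqrt \<beta>) (\<lambda>k. proxy_ratio k i j) k"
  using assms
proof (induction k arbitrary: w b)
  case 0
  have "(\<integral>\<omega>. sqrt (w * V 0 \<omega> $ i $ j + b) \<partial>\<Omega>) = (\<integral>\<omega>. sqrt b \<partial>\<Omega>)"
    by (intro Bochner_Integration.integral_cong) (auto simp: init)
  then show ?case using 0 by (simp add: prob_space)
next
  case (Suc k)
  define b' where "b' = b + w * (1 - \<beta>) * \<sigma>op\<^sup>2"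
  have b': "b \<le> b'" using Suc.prems beta by (simp add: b'_def)
  have "w * \<beta> * \<epsilon> \<le> w * \<epsilon>"
    using Suc.prems beta eps by (simp add: mult_left_le mult_right_mono)
  then have "(\<integral>\<omega>. sqrt (w * \<beta> * V k \<omega> $ i $ j + b') \<partial>\<Omega>)
    \<le> sqrt (b' + w * \<beta> * \<sigma>op\<^sup>2) + sqrt (w * \<beta>) * (1 - \<beta>) * decayed_sum (sqrt \<beta>) (\<lambda>k. proxy_ratio k i j) k"
    using Suc.prems b' beta by (intro Suc.IH) auto
  moreover have "b' + w * \<beta> * \<sigma>op\<^sup>2 = b + w * \<sigma>op\<^sup>2" by (simp add: b'_def algebra_simps)
  moreover have "(\<integral>\<omega>. sqrt (w * V (Suc k) \<omega> $ i $ j + b) \<partial>\<Omega>)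
    \<le> (\<integral>\<omega>. sqrt (w * \<beta> * V k \<omega> $ i $ j + b') \<partial>\<Omega>) + sqrt w * (1 - \<beta>) * proxy_ratio k i j"
    unfolding b'_def using Suc.prems by (intro sqrt_V_Suc_le) auto
  ultimately show ?case by (simp add: real_sqrt_mult algebra_simps)
qed

lemma proxy_scale_integrable:
  assumes "k < K"
  shows "integrable \<Omega> (proxy_scale k i j)"
  unfolding proxy_scale_def[abs_def]
proof (rule integrable_sqrt)
  show "integrable \<Omega> (\<lambda>\<omega>. \<beta> * V k \<omega> $ i $ j + (1 - \<beta>) * ((grad_entry k i j \<omega>)\<^sup>2 + \<sigma>op\<^sup>2) + \<epsilon>)"
    using V_integrable[of k i j] square_integrable_integrable[OF grad_entry_sq[OF assms, of i j]] assms by simp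
  show "0 \<le> \<beta> * V k \<omega> $ i $ j + (1 - \<beta>) * ((grad_entry k i j \<omega>)\<^sup>2 + \<sigma>op\<^sup>2) + \<epsilon>" if "\<omega> \<in> space \<Omega>" for \<omega>
    using V_nonneg[of k \<omega> i j] assms that beta eps by simp
qed

lemma proxy_scale_expectation_le:
  assumes "k < K"
  shows "(\<integral>\<omega>. proxy_scale k i j \<omega> \<partial>\<Omega>)
    \<le> sqrt 2 * \<sigma>op + (1 - \<beta>) * decayed_sum (sqrt \<beta>) (\<lambda>k. proxy_ratio k i j) (Suc k)"
proof -
  define b where "b = \<epsilon> + (1 - \<beta>) * \<sigma>op\<^sup>2"
  have eps_pos: "0 < \<epsilon>" using eps sop_pos by simp
  have b: "0 < b" "\<beta> * \<epsilon> \<le> b"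
    using beta eps_pos sop_pos mult_right_mono[of \<beta> 1 \<epsilon>] by (auto simp: b_def add_pos_nonneg add_increasing2)
  have int: "integrable \<Omega> (\<lambda>\<omega>. sqrt (\<beta> * V k \<omega> $ i $ j + b))"
    using assms b beta by (intro sqrt_V_integrable) auto
  have "(\<integral>\<omega>. proxy_scale k i j \<omega> \<partial>\<Omega>)
      \<le> (\<integral>\<omega>. sqrt (\<beta> * V k \<omega> $ i $ j + b) + (1 - \<beta>) * ((grad_entry k i j \<omega>)\<^sup>2 / proxy_scale k i j \<omega>) \<partial>\<Omega>)"
  proof (rule integral_mono)
    fix \<omega> assume \<omega>: "\<omega> \<in> space \<Omega>"
    have eq: "proxy_scale k i j \<omega> = sqrt ((\<beta> * V k \<omega> $ i $ j + b) + (1 - \<beta>) * (grad_entry k i j \<omega>)\<^sup>2)"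
      by (simp add: proxy_scale_def b_def algebra_simps)
    have "0 \<le> \<beta> * V k \<omega> $ i $ j" using V_nonneg[of k \<omega> i j] beta assms \<omega> by simp
    then show "proxy_scale k i j \<omega> \<le> sqrt (\<beta> * V k \<omega> $ i $ j + b)
        + (1 - \<beta>) * ((grad_entry k i j \<omega>)\<^sup>2 / proxy_scale k i j \<omega>)"
      unfolding eq using sqrt_add_le_div[of "\<beta> * V k \<omega> $ i $ j + b" "(1 - \<beta>) * (grad_entry k i j \<omega>)\<^sup>2"] b beta
      by (simp add: add_nonneg_pos add_pos_nonneg)
  qed (intro proxy_scale_integrable Bochner_Integration.integrable_add integrable_mult_right
      proxy_ratio_integrable int assms)+
  also have "\<dots> = (\<integral>\<omega>. sqrt (\<beta> * V k \<omega> $ i $ j + b) \<partial>\<Omega>) + (1 - \<beta>) * proxy_ratio k i j"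
    using int proxy_ratio_integrable[OF assms, of i j]
    by (simp add: proxy_ratio_def del: times_divide_eq_right)
  also have "(\<integral>\<omega>. sqrt (\<beta> * V k \<omega> $ i $ j + b) \<partial>\<Omega>)
    \<le> sqrt (b + \<beta> * \<sigma>op\<^sup>2) + sqrt \<beta> * (1 - \<beta>) * decayed_sum (sqrt \<beta>) (\<lambda>k. proxy_ratio k i j) k"
    using assms b beta by (intro sqrt_V_le) auto
  \<comment> \<open>One \<open>\<sigma>op\<^sup>2\<close> is \<open>\<epsilon>\<close>, the other is
    the noise variance accumulated with total weight one; this is the origin of
    \<open>sqrt 2\<close>.\<close>
  also have "b + \<beta> * \<sigma>op\<^sup>2 = 2 * \<sigma>op\<^sup>2" by (simp add: b_def eps algebra_simps)
  finally show ?thesis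
    using sop_pos by (simp add: real_sqrt_mult algebra_simps)
qed

lemma proxy_scale_sum_le:
  "(\<Sum>k<K. \<integral>\<omega>. proxy_scale k i j \<omega> \<partial>\<Omega>) \<le> real K * (sqrt 2 * \<sigma>op) + 2 * (\<Sum>k<K. proxy_ratio k i j)"
proof -
  let ?c = "decayed_sum (sqrt \<beta>) (\<lambda>k. proxy_ratio k i j)"
  have r: "0 \<le> sqrt \<beta>" "sqrt \<beta> < 1" using beta by auto
  have "(\<Sum>k<K. \<integral>\<omega>. proxy_scale k i j \<omega> \<partial>\<Omega>) \<le> (\<Sum>k<K. sqrt 2 * \<sigma>op + (1 - \<beta>) * ?c (Suc k))"
    by (intro sum_mono proxy_scale_expectation_le) simp
  also have "\<dots> = real K * (sqrt 2 * \<sigma>op) + (1 + sqrt \<beta>) * ((1 - sqrt \<beta>) * (\<Sum>k<K. ?c (Suc k)))"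
  proof -
    \<comment> \<open>The factor \<open>1 - sqrt \<beta>\<close> cancels the geometric series and
      \<open>1 + sqrt \<beta>\<close> is at most 2, so nothing degenerates as \<open>\<beta>\<close>
      approaches 1.\<close>
    have "1 - \<beta> = (1 + sqrt \<beta>) * (1 - sqrt \<beta>)" using beta by (simp add: algebra_simps)
    then show ?thesis by (simp add: sum.distrib mult.assoc flip: sum_distrib_left del: decayed_sum.simps)
  qed
  also have "(1 - sqrt \<beta>) * (\<Sum>k<K. ?c (Suc k)) \<le> (\<Sum>k<K. proxy_ratio k i j)"
    using r proxy_ratio_nonneg by (intro sum_decayed_sum_le) auto
  also have "(1 + sqrt \<beta>) * (\<Sum>k<K. proxy_ratio k i j) \<le> 2 * (\<Sum>k<K. proxy_ratio k i j)"
    using r proxy_ratio_nonneg by (intro mult_right_mono sum_nonneg) auto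
  finally show ?thesis using r by (simp add: mult_left_mono)
qed

section \<open>From the ratios to the entrywise and nuclear norms\<close>

lemma entry_l1_norm_rot_integrable:
  assumes "k < K"
  shows "integrable \<Omega> (\<lambda>\<omega>. entry_l1_norm (rot k \<omega> (grad k \<omega>)))"
  unfolding entry_l1_norm_def grad_entry_def[symmetric]
  using square_integrable_imp_integrable[OF grad_entry_sq[OF assms]]
  by (intro Bochner_Integration.integrable_sum) simp

text \<open>Descent bounds only the total of the ratios, not the share of a single entry. Since the
  estimate for an entry is linear in its share, it can be summed before \<open>W\<close> is
  inserted.\<close>

lemma l1_sum_le:
  assumes W: "(\<Sum>k<K. \<integral>\<omega>. weighted_sq k \<omega> (grad k \<omega>) \<partial>\<Omega>) \<le> W" and "0 < c"
  shows "(\<Sum>k<K. \<integral>\<omega>. entry_l1_norm (rot k \<omega> (grad k \<omega>)) \<partial>\<Omega>)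
    \<le> (c * W + (real CARD('m) * real CARD('n) * (real K * (sqrt 2 * \<sigma>op)) + 2 * W) / c) / 2"
proof -
  define q where "q i j = (\<Sum>k<K. proxy_ratio k i j)" for i j
  define T where "T = (\<Sum>i\<in>UNIV. \<Sum>j\<in>UNIV. q i j)"
  have TW: "T \<le> W"
  proof -
    have "T \<le> (\<Sum>i\<in>UNIV. \<Sum>j\<in>UNIV. \<Sum>k<K. \<integral>\<omega>. (grad_entry k i j \<omega>)\<^sup>2 / scale k \<omega> $ i $ j \<partial>\<Omega>)"
      unfolding T_def q_def by (intro sum_mono proxy_ratio_le) simp
    also have "\<dots> = (\<Sum>k<K. \<Sum>i\<in>UNIV. \<Sum>j\<in>UNIV. \<integral>\<omega>. (grad_entry k i j \<omega>)\<^sup>2 / scale k \<omega> $ i $ j \<partial>\<Omega>)"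
      by (subst (2) sum.swap, subst sum.swap) (rule refl)
    also have "\<dots> = (\<Sum>k<K. \<integral>\<omega>. weighted_sq k \<omega> (grad k \<omega>) \<partial>\<Omega>)"
      unfolding weighted_sq_def grad_entry_def[symmetric]
      using ratio_integrable by (intro sum.cong refl) simp
    finally show ?thesis using W by linarith
  qed
  have entry: "(\<Sum>k<K. \<integral>\<omega>. \<bar>grad_entry k i j \<omega>\<bar> \<partial>\<Omega>) \<le> (c * q i j + (real K * (sqrt 2 * \<sigma>op) + 2 * q i j) / c) / 2" for i j
  proof -
    have "(\<Sum>k<K. \<integral>\<omega>. \<bar>grad_entry k i j \<omega>\<bar> \<partial>\<Omega>)
        \<le> (\<Sum>k<K. (c * proxy_ratio k i j + (\<integral>\<omega>. proxy_scale k i j \<omega> \<partial>\<Omega>) / c) / 2)"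
    proof (rule sum_mono)
      fix k assume "k \<in> {..<K}"
      then have k: "k < K" by simp
      have "(\<integral>\<omega>. \<bar>grad_entry k i j \<omega>\<bar> \<partial>\<Omega>)
          \<le> (\<integral>\<omega>. (c * ((grad_entry k i j \<omega>)\<^sup>2 / proxy_scale k i j \<omega>) + proxy_scale k i j \<omega> / c) / 2 \<partial>\<Omega>)"
      proof (rule integral_mono)
        show "integrable \<Omega> (\<lambda>\<omega>. \<bar>grad_entry k i j \<omega>\<bar>)"
          using square_integrable_imp_integrable[OF grad_entry_sq[OF k]] by simp
        show "integrable \<Omega> (\<lambda>\<omega>. (c * ((grad_entry k i j \<omega>)\<^sup>2 / proxy_scale k i j \<omega>) + proxy_scale k i j \<omega> / c) / 2)"
          by (intro integrable_divide Bochner_Integration.integrable_add integrable_mult_right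
              proxy_ratio_integrable proxy_scale_integrable k)
      qed (intro weighted_young proxy_scale_pos k \<open>0 < c\<close>)
      also have "\<dots> = (c * proxy_ratio k i j + (\<integral>\<omega>. proxy_scale k i j \<omega> \<partial>\<Omega>) / c) / 2"
        using proxy_ratio_integrable[OF k, of i j] proxy_scale_integrable[OF k, of i j]
        by (simp add: proxy_ratio_def del: times_divide_eq_right)
      finally show "(\<integral>\<omega>. \<bar>grad_entry k i j \<omega>\<bar> \<partial>\<Omega>)
          \<le> (c * proxy_ratio k i j + (\<integral>\<omega>. proxy_scale k i j \<omega> \<partial>\<Omega>) / c) / 2" .
    qed
    also have "\<dots> = (c * q i j + (\<Sum>k<K. \<integral>\<omega>. proxy_scale k i j \<omega> \<partial>\<Omega>) / c) / 2"
      by (simp add: q_def sum.distrib sum_distrib_left flip: sum_divide_distrib)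
    also have "\<dots> \<le> (c * q i j + (real K * (sqrt 2 * \<sigma>op) + 2 * q i j) / c) / 2"
      using proxy_scale_sum_le[of i j] \<open>0 < c\<close>
      by (intro divide_right_mono add_left_mono) (auto simp: q_def)
    finally show ?thesis .
  qed
  have "(\<Sum>k<K. \<integral>\<omega>. entry_l1_norm (rot k \<omega> (grad k \<omega>)) \<partial>\<Omega>)
      = (\<Sum>k<K. \<Sum>i\<in>UNIV. \<Sum>j\<in>UNIV. \<integral>\<omega>. \<bar>grad_entry k i j \<omega>\<bar> \<partial>\<Omega>)"
    unfolding entry_l1_norm_def grad_entry_def[symmetric]
    using square_integrable_imp_integrable[OF grad_entry_sq] by (intro sum.cong refl) simp
  also have "\<dots> = (\<Sum>i\<in>UNIV. \<Sum>j\<in>UNIV. \<Sum>k<K. \<integral>\<omega>. \<bar>grad_entry k i j \<omega>\<bar> \<partial>\<Omega>)"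
    by (subst sum.swap, subst (2) sum.swap) (rule refl)
  also have "\<dots> \<le> (\<Sum>i\<in>(UNIV::'m set). \<Sum>j\<in>(UNIV::'n set).
      (c * q i j + (real K * (sqrt 2 * \<sigma>op) + 2 * q i j) / c) / 2)"
    by (intro sum_mono entry)
  also have "\<dots> = (c * T + (real CARD('m) * real CARD('n) * (real K * (sqrt 2 * \<sigma>op)) + 2 * T) / c) / 2"
    by (simp add: T_def sum.distrib mult.assoc flip: sum_divide_distrib sum_distrib_left)
  also have "\<dots> \<le> (c * W + (real CARD('m) * real CARD('n) * (real K * (sqrt 2 * \<sigma>op)) + 2 * W) / c) / 2"
    using TW \<open>0 < c\<close> by (intro divide_right_mono add_mono mult_left_mono) auto
  finally show ?thesis .
qed

lemma nuclear_norm_grad: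
  assumes "k < K"
  shows "integrable \<Omega> (\<lambda>\<omega>. nuclear_norm (grad k \<omega>))"
    "(\<integral>\<omega>. nuclear_norm (grad k \<omega>) \<partial>\<Omega>) \<le> (\<integral>\<omega>. entry_l1_norm (rot k \<omega> (grad k \<omega>)) \<partial>\<Omega>)"
proof -
  have le: "nuclear_norm (grad k \<omega>) \<le> entry_l1_norm (rot k \<omega> (grad k \<omega>))" if "\<omega> \<in> space \<Omega>" for \<omega>
    unfolding rot_def using orth[of k \<omega>] assms that by (intro nuclear_norm_le_entry_l1_norm_conj) auto
  show int: "integrable \<Omega> (\<lambda>\<omega>. nuclear_norm (grad k \<omega>))"
  proof (rule Bochner_Integration.integrable_bound[OF entry_l1_norm_rot_integrable[OF assms]])
    show "(\<lambda>\<omega>. nuclear_norm (grad k \<omega>)) \<in> borel_measurable \<Omega>"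
      using assms by (intro measurable_compose[OF measurable_from_F[OF _ grad_adapted]]
          borel_measurable_continuous_onI continuous_on_nuclear_norm) auto
    show "AE \<omega> in \<Omega>. norm (nuclear_norm (grad k \<omega>)) \<le> norm (entry_l1_norm (rot k \<omega> (grad k \<omega>)))"
    proof (rule AE_I2)
      fix \<omega> assume "\<omega> \<in> space \<Omega>"
      from le[OF this] nuclear_norm_nonneg[of "grad k \<omega>"]
      show "norm (nuclear_norm (grad k \<omega>)) \<le> norm (entry_l1_norm (rot k \<omega> (grad k \<omega>)))"
        by simp
    qed
  qed
  show "(\<integral>\<omega>. nuclear_norm (grad k \<omega>) \<partial>\<Omega>) \<le> (\<integral>\<omega>. entry_l1_norm (rot k \<omega> (grad k \<omega>)) \<partial>\<Omega>)"
    using le by (intro integral_mono int entry_l1_norm_rot_integrable assms)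
qed

end

section \<open>The convergence rate\<close>

text \<open>Integrability is part of the conclusion because the integral of a non-integrable
  function is zero by convention, so the inequalities alone would not express a bound on the
  expectations.\<close>

theorem theorem1:
  fixes f :: "real^'n^'m \<Rightarrow> real"
    and \<Omega> :: "'w measure" and S :: "'z measure" and \<zeta> :: "nat \<Rightarrow> 'w \<Rightarrow> 'z"
    and g :: "real^'n^'m \<Rightarrow> 'z \<Rightarrow> real^'n^'m"
    and X G Mo V :: "nat \<Rightarrow> 'w \<Rightarrow> real^'n^'m"
    and P :: "nat \<Rightarrow> 'w \<Rightarrow> real^'m^'m" and Q :: "nat \<Rightarrow> 'w \<Rightarrow> real^'n^'n"
    and X1 :: "real^'n^'m" and P0 :: "real^'m^'m" and Q0 :: "real^'n^'n"
    and K :: nat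
    and \<eta> \<theta> \<beta> \<epsilon> L \<sigma>F \<sigma>op \<gamma> fstar sF2 :: real
  assumes "prob_space \<Omega>"
    and "\<forall>Y. f differentiable (at Y)"
    and "bdd_below (range f)" and "fstar = (INF Y. f Y)"
    and "1 \<le> K"
    and "generalized_soap \<Omega> S \<zeta> g K \<eta> \<theta> \<beta> \<epsilon> X1 P0 Q0 X G Mo V P Q"
    and "0 < L" and "0 \<le> \<sigma>F" and "0 < \<sigma>op"
    and smooth: "\<forall>Y Z. norm (gradient f Z - gradient f Y) \<le> L * norm (Z - Y)"
    and unbiased: "\<forall>k\<in>{1..K}. AE \<omega> in \<Omega>.
      matrix_cond_exp \<Omega> (sample_filtration \<Omega> S \<zeta> (k - 1)) (G k) \<omega> = gradient f (X k \<omega>)"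
    and noise_F: "\<forall>k\<in>{1..K}. AE \<omega> in \<Omega>.
      nn_cond_exp \<Omega> (sample_filtration \<Omega> S \<zeta> (k - 1))
        (\<lambda>\<omega>. ennreal ((norm (G k \<omega> - gradient f (X k \<omega>)))\<^sup>2)) \<omega> \<le> ennreal (\<sigma>F\<^sup>2)"
    and noise_op: "\<forall>k\<in>{1..K}. AE \<omega> in \<Omega>.
      nn_cond_exp \<Omega> (sample_filtration \<Omega> S \<zeta> (k - 1))
        (\<lambda>\<omega>. ennreal ((spectral_norm (G k \<omega> - gradient f (X k \<omega>)))\<^sup>2)) \<omega> \<le> ennreal (\<sigma>op\<^sup>2)"
    and "0 < \<gamma>" and "\<gamma> \<le> 1"
    and "sF2 = max (\<sigma>F\<^sup>2) (L * (f X1 - fstar) / (real K * \<gamma>\<^sup>2))" and "0 < sF2"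
    and "1 - \<theta> = sqrt (L * (f X1 - fstar) / (real K * sF2))"
    and "0 \<le> \<beta>" and "\<beta> < 1"
    and "\<epsilon> = \<sigma>op\<^sup>2"
    and "\<eta> = sqrt (\<epsilon> * (f X1 - fstar) / (4 * L * real K * sF2))"
  shows
    "(\<forall>k\<in>{1..K}.
        integrable \<Omega> (\<lambda>\<omega>. entry_l1_norm
          (transpose (P (k - 1) \<omega>) ** gradient f (X k \<omega>) ** Q (k - 1) \<omega>)) \<and>
        integrable \<Omega> (\<lambda>\<omega>. nuclear_norm (gradient f (X k \<omega>)))) \<and>
     1 / real K * (\<Sum>k=1..K. prob_space.expectation \<Omega> (\<lambda>\<omega>. entry_l1_norm
          (transpose (P (k - 1) \<omega>) ** gradient f (X k \<omega>) ** Q (k - 1) \<omega>)))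
       \<le> 10 * sqrt (sF2 * L * (f X1 - fstar) / (real K * \<sigma>op\<^sup>2))
         + 4 * sqrt (real CARD('m) * real CARD('n)) * root 4 (sF2 * L * (f X1 - fstar) / real K) \<and>
     1 / real K * (\<Sum>k=1..K. prob_space.expectation \<Omega> (\<lambda>\<omega>. nuclear_norm (gradient f (X k \<omega>))))
       \<le> 10 * sqrt (sF2 * L * (f X1 - fstar) / (real K * \<sigma>op\<^sup>2))
         + 4 * sqrt (real CARD('m) * real CARD('n)) * root 4 (sF2 * L * (f X1 - fstar) / real K)"
proof -
  interpret prob_space \<Omega> by fact
  define \<Delta> where "\<Delta> = f X1 - fstar"
  have lower: "fstar \<le> f Y" for Y
    using assms(3,4) by (simp add: cINF_lower)
  have Delta: "0 \<le> \<Delta>" using lower[of X1] by (simp add: \<Delta>_def)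
  have diff: "f differentiable (at Y)" for Y using assms(2) by simp
  have smooth': "norm (gradient f Z - gradient f Y) \<le> L * norm (Z - Y)" for Y Z using smooth by blast
  show ?thesis
  proof (cases "\<Delta> = 0")
    \<comment> \<open>A zero gap gives \<open>\<eta> = 0\<close>: the run never leaves
      \<open>X1\<close>, a minimiser, where the gradient vanishes.\<close>
    case True
    then have gap: "f X1 - fstar = 0" by (simp add: \<Delta>_def)
    then have "\<eta> = 0" using assms(22) by simp
    have X: "X (Suc k) \<omega> = X1" if "k < K" "\<omega> \<in> space \<Omega>" for k \<omega>
      using that(1)
    proof (induction k)
      case 0
      then show ?case using assms(6) that(2) unfolding generalized_soap_def by simp
    next
      case (Suc k)
      then have "Suc k \<in> {1..K}" by simp
      then have "X (Suc k + 1) \<omega> = X (Suc k) \<omega>"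
        using assms(6) that(2) unfolding generalized_soap_def \<open>\<eta> = 0\<close> Let_def
        by (metis (no_types, lifting) diff_zero scale_zero_left)
      then show ?case using Suc by simp
    qed
    have "gradient f X1 = 0"
      using norm_gradient_le_gap[of f L fstar X1, OF diff smooth' lower assms(7)] gap by simp
    then have zero: "gradient f (X k \<omega>) = 0" if "k \<in> {1..K}" "\<omega> \<in> space \<Omega>" for k \<omega>
      using X[of "k - 1" \<omega>] that by (cases k) auto
    have l1_0: "entry_l1_norm (0 :: real^'n^'m) = 0" by (simp add: entry_l1_norm_def)
    have nuc_0: "nuclear_norm (0 :: real^'n^'m) = 0"
      using nuclear_norm_nonneg[of "0 :: real^'n^'m"]
        nuclear_norm_le_entry_l1_norm_conj[OF orthogonal_matrix_id orthogonal_matrix_id, of "0 :: real^'n^'m"]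
      by (simp add: l1_0)
    have l1: "entry_l1_norm (transpose (P (k - 1) \<omega>) ** gradient f (X k \<omega>) ** Q (k - 1) \<omega>) = 0"
      and nuc: "nuclear_norm (gradient f (X k \<omega>)) = 0" if "k \<in> {1..K}" "\<omega> \<in> space \<Omega>" for k \<omega>
      using zero[OF that] by (simp_all add: nuc_0 entry_l1_norm_def matrix_matrix_mult_def)
    have int: "integrable \<Omega> h" "integral\<^sup>L \<Omega> h = 0" if "\<And>\<omega>. \<omega> \<in> space \<Omega> \<Longrightarrow> h \<omega> = 0" for h :: "'w \<Rightarrow> real"
      using Bochner_Integration.integrable_cong[of \<Omega> \<Omega> h "\<lambda>_. 0"]
        Bochner_Integration.integral_cong[of \<Omega> \<Omega> h "\<lambda>_. 0"] that by simp_all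
    show ?thesis using gap by (auto simp: int l1[unfolded One_nat_def] nuc)
  next
    case False
    then have Delta: "0 < \<Delta>" using Delta by simp
    have K: "0 < K" using assms(5) by simp
    define t where "t = 1 - \<theta>"
    have t_sqrt: "t = sqrt (L * \<Delta> / (real K * sF2))" using assms(18) by (simp add: t_def \<Delta>_def)
    have t_pos: "0 < t" unfolding t_sqrt using Delta K assms(7,17) by simp
    have t_sq: "t\<^sup>2 * (real K * sF2) = L * \<Delta>"
      unfolding t_sqrt using Delta K assms(7,17) by simp
    \<comment> \<open>Here the second entry of the maximum is used: it yields
      \<open>1 - \<theta> \<le> \<gamma> \<le> 1\<close>, hence
      \<open>0 \<le> \<theta>\<close>.\<close>
    have "L * \<Delta> / (real K * \<gamma>\<^sup>2) \<le> sF2" using assms(16) by (simp add: \<Delta>_def)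
    then have "L * \<Delta> \<le> \<gamma>\<^sup>2 * (real K * sF2)"
      using K assms(14) by (simp add: pos_divide_le_eq mult_ac)
    then have "t\<^sup>2 * (real K * sF2) \<le> \<gamma>\<^sup>2 * (real K * sF2)" by (simp only: t_sq)
    then have "t\<^sup>2 \<le> \<gamma>\<^sup>2" using K assms(17) by (simp add: mult_le_cancel_right)
    then have "t \<le> \<gamma>" by (rule power2_le_imp_le) (use assms(14) in simp)
    then have t_le: "t \<le> 1" using assms(15) by simp
    have eta_t: "\<eta> = t * \<sigma>op / (2 * L)"
    proof -
      have "\<epsilon> * \<Delta> / (4 * L * real K * sF2) = (t * \<sigma>op / (2 * L))\<^sup>2"
        using t_sq assms(7,17,21) K by (simp add: power_divide power_mult_distrib field_simps power2_eq_square)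
      then have "\<eta> = sqrt ((t * \<sigma>op / (2 * L))\<^sup>2)" using assms(22) by (simp add: \<Delta>_def)
      then show ?thesis using t_pos assms(7,9) by simp
    qed
    interpret soap_run \<Omega> f S \<zeta> g X G Mo V P Q X1 P0 Q0 K \<eta> \<theta> \<beta> \<epsilon> L \<sigma>F \<sigma>op fstar
    proof unfold_locales
      show "\<eta> = (1 - \<theta>) * \<sigma>op / (2 * L)" using eta_t by (simp add: t_def)
      show "0 \<le> \<theta>" "\<theta> < 1" using t_le t_pos by (simp_all add: t_def)
    qed (use diff lower smooth' unbiased noise_F noise_op assms in auto)
    \<comment> \<open>By \<open>t_sq\<close> this is the square root in the first term of the rate,
      and \<open>sqrt (A * \<sigma>op)\<close> is the fourth root in the second.\<close>
    define A where "A = sF2 * t / \<sigma>op"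
    have A: "0 < A" using t_pos assms(9,17) by (simp add: A_def)
    have st: "sF2 * L * \<Delta> / real K = (sF2 * t)\<^sup>2"
      using t_sq K by (simp add: field_simps power2_eq_square)
    have A_sqrt: "sqrt (sF2 * L * \<Delta> / (real K * \<sigma>op\<^sup>2)) = A"
    proof -
      have "sF2 * L * \<Delta> / (real K * \<sigma>op\<^sup>2) = A\<^sup>2"
        using st by (simp add: A_def power_divide flip: divide_divide_eq_left)
      then show ?thesis using A by simp
    qed
    have A_root: "root 4 (sF2 * L * \<Delta> / real K) = sqrt (A * \<sigma>op)"
    proof -
      have "A * \<sigma>op = sF2 * t" using assms(9) by (simp add: A_def)
      moreover have "root 4 ((sF2 * t)\<^sup>2) = root 4 (sqrt (sF2 * t) ^ 4)"
        using t_pos assms(17) by (simp add: power4_eq_xxxx power2_eq_square)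
      ultimately show ?thesis using t_pos assms(17) by (simp add: st real_root_power_cancel)
    qed
    \<comment> \<open>Seven is 4 from the gap over the step size, 2 from the initial momentum error
      and 1 from the noise.\<close>
    define W where "W = 7 * real K * A"
    have W: "(\<Sum>k<K. \<integral>\<omega>. weighted_sq k \<omega> (grad k \<omega>) \<partial>\<Omega>) \<le> W"
    proof -
      have "2 * \<Delta> / \<eta> = 4 * (L * \<Delta>) / (t * \<sigma>op)"
        unfolding eta_t using t_pos assms(7,9) by (simp add: field_simps)
      also have "\<dots> = 4 * real K * A"
        unfolding A_def t_sq[symmetric] using t_pos by (simp add: power2_eq_square)
      finally have "2 * \<Delta> / \<eta> = 4 * real K * A" .
      moreover have "1 / \<sigma>op * (2 * L * \<Delta> / t) = 2 * real K * A"
      proof -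
        have "1 / \<sigma>op * (2 * L * \<Delta> / t) = 2 * (L * \<Delta>) / (t * \<sigma>op)" by (simp add: mult_ac)
        also have "\<dots> = 2 * real K * A"
          unfolding A_def t_sq[symmetric] using t_pos by (simp add: power2_eq_square)
        finally show ?thesis .
      qed
      moreover have "1 / \<sigma>op * (real K * t * \<sigma>F\<^sup>2) \<le> real K * A"
      proof -
        have "1 / \<sigma>op * (real K * t * \<sigma>F\<^sup>2) \<le> 1 / \<sigma>op * (real K * t * sF2)"
          using t_pos assms(9,16) by (intro mult_left_mono) auto
        also have "\<dots> = real K * A" by (simp add: A_def)
        finally show ?thesis .
      qed
      ultimately have le: "2 * \<Delta> / \<eta> + (1 / \<sigma>op * (2 * L * \<Delta> / t) + 1 / \<sigma>op * (real K * t * \<sigma>F\<^sup>2))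
          \<le> 4 * real K * A + (2 * real K * A + real K * A)"
        by (intro add_mono) simp_all
      have "(\<Sum>k<K. \<integral>\<omega>. weighted_sq k \<omega> (grad k \<omega>) \<partial>\<Omega>)
          \<le> 2 * \<Delta> / \<eta> + (1 / \<sigma>op * (2 * L * \<Delta> / t) + 1 / \<sigma>op * (real K * t * \<sigma>F\<^sup>2))"
        using weighted_gradient_sum[OF K] unfolding \<Delta>_def[symmetric] t_def[symmetric] distrib_left .
      also note le
      also have "4 * real K * A + (2 * real K * A + real K * A) = W" by (simp add: W_def)
      finally show ?thesis .
    qed
    define d where "d = real CARD('m) * real CARD('n)"
    have d: "0 < d" by (simp add: d_def)
    define bound where "bound = 10 * A + 4 * sqrt d * sqrt (A * \<sigma>op)"
    \<comment> \<open>The factor \<open>real K\<close> is taken out first; the optimal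
      \<open>c\<close> turns the arithmetic mean into the geometric one.\<close>
    obtain c where c: "0 < c"
      "(c * (7 * A) + (d * (sqrt 2 * \<sigma>op) + 14 * A) / c) / 2 = sqrt (7 * A * (d * (sqrt 2 * \<sigma>op) + 14 * A))"
      using A d assms(9) young_optimal[of "7 * A" "d * (sqrt 2 * \<sigma>op) + 14 * A"] by (auto simp: add_pos_pos)
    have "(\<Sum>k<K. \<integral>\<omega>. entry_l1_norm (rot k \<omega> (grad k \<omega>)) \<partial>\<Omega>)
        \<le> (c * W + (d * (real K * (sqrt 2 * \<sigma>op)) + 2 * W) / c) / 2"
      unfolding d_def by (rule l1_sum_le[OF W c(1)])
    also have "\<dots> = real K * ((c * (7 * A) + (d * (sqrt 2 * \<sigma>op) + 14 * A) / c) / 2)"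
      using c(1) by (simp add: W_def field_simps)
    also have "\<dots> \<le> real K * bound"
      unfolding c(2) bound_def using A d assms(9) by (intro mult_left_mono rate_arithmetic) auto
    finally have l1: "(\<Sum>k<K. \<integral>\<omega>. entry_l1_norm (rot k \<omega> (grad k \<omega>)) \<partial>\<Omega>) \<le> real K * bound" .
    have "(\<Sum>k<K. \<integral>\<omega>. nuclear_norm (grad k \<omega>) \<partial>\<Omega>) \<le> (\<Sum>k<K. \<integral>\<omega>. entry_l1_norm (rot k \<omega> (grad k \<omega>)) \<partial>\<Omega>)"
      by (intro sum_mono nuclear_norm_grad(2)) simp
    then have nuc: "(\<Sum>k<K. \<integral>\<omega>. nuclear_norm (grad k \<omega>) \<partial>\<Omega>) \<le> real K * bound"
      using l1 by linarith
    have ints: "integrable \<Omega> (\<lambda>\<omega>. entry_l1_norm (transpose (P (k - 1) \<omega>) ** gradient f (X k \<omega>) ** Q (k - 1) \<omega>)) \<and>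
        integrable \<Omega> (\<lambda>\<omega>. nuclear_norm (gradient f (X k \<omega>)))" if k: "k \<in> {1..K}" for k
    proof -
      obtain l where l: "k = Suc l" "l < K" using k by (cases k) auto
      then show ?thesis
        using entry_l1_norm_rot_integrable[of l] nuclear_norm_grad(1)[of l] by (simp add: rot_def grad_def)
    qed
    have "bound = 10 * sqrt (sF2 * L * (f X1 - fstar) / (real K * \<sigma>op\<^sup>2))
         + 4 * sqrt (real CARD('m) * real CARD('n)) * root 4 (sF2 * L * (f X1 - fstar) / real K)"
      unfolding bound_def d_def \<Delta>_def[symmetric] A_sqrt A_root by (rule refl)
    moreover have "1 / real K * (\<Sum>k=1..K. \<integral>\<omega>. entry_l1_norm
        (transpose (P (k - 1) \<omega>) ** gradient f (X k \<omega>) ** Q (k - 1) \<omega>) \<partial>\<Omega>) \<le> bound"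
      using l1 K by (simp add: sum.atLeast1_atMost_eq rot_def grad_def divide_le_eq mult.commute)
    moreover have "1 / real K * (\<Sum>k=1..K. \<integral>\<omega>. nuclear_norm (gradient f (X k \<omega>)) \<partial>\<Omega>) \<le> bound"
      using nuc K by (simp add: sum.atLeast1_atMost_eq grad_def divide_le_eq mult.commute)
    ultimately show ?thesis using ints by simp
  qed
qed

end
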